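(* Let $x:M^m\to\mathbb{R}^{m+p}$ be a $\xi$-submanifold. Then for any compact normal variation $F:M^m\times(-\varepsilon,\varepsilon)\to\mathbb{R}^{m+p}$ of $x$ with variation vector field $\eta=\frac{\partial F}{\partial t}|_{t=0}$, $$V_\xi''(0)=-\int_M\Big(\big\langle\triangle^\perp_M\eta-D^\perp_{x^\top+A_\xi(x^\top)}\eta+g^{ik}g^{jl}\langle h_{ij},\eta\rangle h_{kl}+\eta,\ \eta\big\rangle+\Big\langle\nabla\langle x,\xi\rangle,\frac{\partial^2F}{\partial t^2}\Big|_{t=0}\Big\rangle\Big)e^{-f}dV,$$ $$\bar V_\xi''(0)=-\int_M\Big(\big\langle\triangle^\perp_M\eta-D^\perp_{x^\top+A_\xi(x^\top)}\eta+g^{ik}g^{jl}\langle h_{ij},\eta\rangle h_{kl}+\eta,\ \eta\big\rangle+\Big\langle\nabla\langle x,\xi\rangle,\frac{\partial^2F}{\partial t^2}\Big|_{t=0}\Big\rangle\Big)e^{-\bar f}dV.$$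
   Context: For a smooth immersion $x:M^m\to\mathbb{R}^{m+p}$: $g$ is the induced metric, $dV$ its volume element, $\nabla$ its gradient/Levi-Civita connection (gradients viewed in $\mathbb{R}^{m+p}$ via $x_*$), $D$ the flat connection of $\mathbb{R}^{m+p}$, $h$ the second fundamental form with components $h_{ij}=h(\partial_i,\partial_j)$ in local coordinates, $H=\mathrm{tr}_g h$, $D^\perp$ the normal connection, $\triangle^\perp_M$ the (rough, trace of second covariant derivative) Laplacian on the normal bundle, $\langle A_\xi X,Y\rangle=\langle h(X,Y),\xi\rangle$ the Weingarten operator, and $x^\top,x^\perp$ the tangential and normal components of the position vector. Repeated indices are summed. $x$ is a $\xi$-submanifold if $H+x^\perp=\xi$ with $\xi$ a normal field satisfying $D^\perp\xi=0$. For this $\xi$, regarded as a fixed $\mathbb{R}^{m+p}$-valued function on $M$, and any immersion $y$, set $f_y=\frac12|y-\xi|^2$, $\bar f_y=f_y-\frac12|\xi|^2$, $V_\xi(y)=\int_M e^{-f_y}dV_y$, $\bar V_\xi(y)=\int_M e^{-\bar f_y}dV_y$; $f=f_x$, $\bar f=\bar f_x$. A variation of $x$ is a smooth map $F:M\times(-\varepsilon,\varepsilon)\to\mathbb{R}^{m+p}$ with $F(\cdot,0)=x$ and every $x_t=F(\cdot,t)$ an immersion; compact if there is a relatively compact open $B\subset M$ containing the support of $\partial F/\partial t(\cdot,t)$ for every $t$; normal if $\eta$ is normal along $x$. $V_\xi''(0)$, $\bar V_\xi''(0)$ are the second derivatives at $t=0$ of $V_\xi(x_t)$, $\bar V_\xi(x_t)$;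 if the functionals are infinite, derivatives are taken under the integral sign. *)

theory Defs
  imports "HOL-Analysis.Analysis"
begin

section \<open>Smooth maps between Euclidean spaces\<close>

text \<open>The set \<open>S\<close> is meant to be open.\<close>

primrec Ck_on :: "nat \<Rightarrow> 'a::euclidean_space set \<Rightarrow> ('a \<Rightarrow> 'b::euclidean_space) \<Rightarrow> bool" where
  "Ck_on 0 S f \<longleftrightarrow> continuous_on S f"
| "Ck_on (Suc k) S f \<longleftrightarrow>
     (\<forall>u\<in>S. f differentiable (at u)) \<and> (\<forall>v. Ck_on k S (\<lambda>u. frechet_derivative f (at u) v))"

definition smooth_on :: "'a::euclidean_space set \<Rightarrow> ('a \<Rightarrow> 'b::euclidean_space) \<Rightarrow> bool" where
  "smooth_on S f \<longleftrightarrow> (\<forall>k. Ck_on k S f)"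


section \<open>Smooth manifolds\<close>

text \<open>
  A chart is a pair \<open>(U, \<phi>)\<close>; the values of \<open>\<phi>\<close> outside \<open>U\<close> are irrelevant.  The manifold \<open>M\<close> is a
  whole Hausdorff, second countable type, equipped with a smooth atlas that need not be maximal.
\<close>

type_synonym ('a, 'm) chart = "'a set \<times> ('a \<Rightarrow> real ^ 'm)"

abbreviation chart_dom :: "('a, 'm) chart \<Rightarrow> 'a set" where "chart_dom \<equiv> fst"
abbreviation coord :: "('a, 'm) chart \<Rightarrow> 'a \<Rightarrow> real ^ 'm" where "coord \<equiv> snd"

abbreviation coord_range :: "('a, 'm) chart \<Rightarrow> (real ^ 'm) set" where
  "coord_range c \<equiv> coord c ` chart_dom c"

definition param :: "('a, 'm) chart \<Rightarrow> real ^ 'm \<Rightarrow> 'a" where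
  "param c = inv_into (chart_dom c) (coord c)"

definition smooth_atlas ::
  "('a::{t2_space, second_countable_topology}, 'm::finite) chart set \<Rightarrow> bool" where
  "smooth_atlas \<A> \<longleftrightarrow>
     (\<forall>c\<in>\<A>. open (chart_dom c) \<and> open (coord_range c)
             \<and> homeomorphism (chart_dom c) (coord_range c) (coord c) (param c)) \<and>
     (\<Union>c\<in>\<A>. chart_dom c) = UNIV \<and>
     (\<forall>c\<in>\<A>. \<forall>d\<in>\<A>. smooth_on (coord c ` (chart_dom c \<inter> chart_dom d)) (coord d \<circ> param c))"

definition smooth_map ::
  "('a, 'm::finite) chart set \<Rightarrow> ('a \<Rightarrow> 'b::euclidean_space) \<Rightarrow> bool" where
  "smooth_map \<A> f \<longleftrightarrow> (\<forall>c\<in>\<A>. smooth_on (coord_range c) (f \<circ> param c))"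

definition immersion ::
  "('a, 'm::finite) chart set \<Rightarrow> ('a \<Rightarrow> 'b::euclidean_space) \<Rightarrow> bool" where
  "immersion \<A> y \<longleftrightarrow> smooth_map \<A> y \<and>
     (\<forall>c\<in>\<A>. \<forall>q\<in>chart_dom c. inj (frechet_derivative (y \<circ> param c) (at (coord c q))))"

text \<open>
  The coordinate vector field \<open>\<partial>\<^sub>i\<close> of the chart \<open>c\<close>, acting on vector-valued functions on \<open>M\<close>.
  For a function with values in the ambient Euclidean space this is the flat derivative \<open>D\<close> along
  \<open>\<partial>\<^sub>i\<close>; in particular \<open>x\<^sub>*\<partial>\<^sub>i = \<partial>\<^sub>i x\<close>.
\<close>

definition pd ::
  "('a, 'm::finite) chart \<Rightarrow> 'm \<Rightarrow> ('a \<Rightarrow> 'b::euclidean_space) \<Rightarrow> 'a \<Rightarrow> 'b" where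
  "pd c i f q = frechet_derivative (f \<circ> param c) (at (coord c q)) (axis i 1)"


section \<open>Geometry of an immersion, in a chart\<close>

text \<open>
  Everything below is evaluated at a point of \<open>chart_dom c\<close>.  Tangent vectors are identified with their
  images under \<open>x\<^sub>*\<close> in the ambient space.  The quantities without coordinate indices do not depend
  on the chart.
\<close>

definition metric :: "('a, 'm::finite) chart \<Rightarrow> ('a \<Rightarrow> 'b::euclidean_space) \<Rightarrow> 'a \<Rightarrow> real ^ 'm ^ 'm" where
  "metric c x q = (\<chi> i j. pd c i x q \<bullet> pd c j x q)"

definition inv_metric :: "('a, 'm::finite) chart \<Rightarrow> ('a \<Rightarrow> 'b::euclidean_space) \<Rightarrow> 'a \<Rightarrow> real ^ 'm ^ 'm" where
  "inv_metric c x q = matrix_inv (metric c x q)"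

definition vol_density :: "('a, 'm::finite) chart \<Rightarrow> ('a \<Rightarrow> 'b::euclidean_space) \<Rightarrow> 'a \<Rightarrow> real" where
  "vol_density c x q = sqrt (det (metric c x q))"

definition tangent_space :: "('a, 'm::finite) chart \<Rightarrow> ('a \<Rightarrow> 'b::euclidean_space) \<Rightarrow> 'a \<Rightarrow> 'b set" where
  "tangent_space c x q = span (range (\<lambda>i. pd c i x q))"

definition tan_part :: "('a, 'm::finite) chart \<Rightarrow> ('a \<Rightarrow> 'b::euclidean_space) \<Rightarrow> 'a \<Rightarrow> 'b \<Rightarrow> 'b" where
  "tan_part c x q v =
     (THE w. w \<in> tangent_space c x q \<and> (\<forall>z\<in>tangent_space c x q. orthogonal (v - w) z))"

definition nor_part :: "('a, 'm::finite) chart \<Rightarrow> ('a \<Rightarrow> 'b::euclidean_space) \<Rightarrow> 'a \<Rightarrow> 'b \<Rightarrow> 'b" where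
  "nor_part c x q v = v - tan_part c x q v"

text \<open>The components \<open>X\<^sup>i\<close> of a tangent vector \<open>X = X\<^sup>i \<partial>\<^sub>i x\<close>.\<close>

definition tan_comp :: "('a, 'm::finite) chart \<Rightarrow> ('a \<Rightarrow> 'b::euclidean_space) \<Rightarrow> 'a \<Rightarrow> 'b \<Rightarrow> real ^ 'm" where
  "tan_comp c x q X = (THE a. (\<Sum>i\<in>UNIV. a $ i *\<^sub>R pd c i x q) = X)"

text \<open>\<open>h\<^sub>i\<^sub>j = (D\<^bsub>\<partial>\<^sub>i\<^esub> x\<^sub>*\<partial>\<^sub>j)\<^sup>\<bottom>\<close>\<close>

definition sff :: "('a, 'm::finite) chart \<Rightarrow> ('a \<Rightarrow> 'b::euclidean_space) \<Rightarrow> 'm \<Rightarrow> 'm \<Rightarrow> 'a \<Rightarrow> 'b" where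
  "sff c x i j q = nor_part c x q (pd c i (pd c j x) q)"

definition second_form :: "('a, 'm::finite) chart \<Rightarrow> ('a \<Rightarrow> 'b::euclidean_space) \<Rightarrow> 'a \<Rightarrow> 'b \<Rightarrow> 'b \<Rightarrow> 'b" where
  "second_form c x q X Y =
     (\<Sum>i\<in>UNIV. \<Sum>j\<in>UNIV. (tan_comp c x q X $ i * tan_comp c x q Y $ j) *\<^sub>R sff c x i j q)"

definition mean_curvature :: "('a, 'm::finite) chart \<Rightarrow> ('a \<Rightarrow> 'b::euclidean_space) \<Rightarrow> 'a \<Rightarrow> 'b" where
  "mean_curvature c x q = (\<Sum>i\<in>UNIV. \<Sum>j\<in>UNIV. inv_metric c x q $ i $ j *\<^sub>R sff c x i j q)"

definition weingarten ::
  "('a, 'm::finite) chart \<Rightarrow> ('a \<Rightarrow> 'b::euclidean_space) \<Rightarrow> ('a \<Rightarrow> 'b) \<Rightarrow> 'a \<Rightarrow> 'b \<Rightarrow> 'b" where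
  "weingarten c x \<xi> q X =
     (THE Z. Z \<in> tangent_space c x q \<and>
             (\<forall>Y\<in>tangent_space c x q. Z \<bullet> Y = second_form c x q X Y \<bullet> \<xi> q))"

text \<open>The Christoffel symbols \<open>\<Gamma>\<^sup>k\<^sub>i\<^sub>j\<close> of the Levi-Civita connection of the induced metric.\<close>

definition christoffel :: "('a, 'm::finite) chart \<Rightarrow> ('a \<Rightarrow> 'b::euclidean_space) \<Rightarrow> 'm \<Rightarrow> 'm \<Rightarrow> 'm \<Rightarrow> 'a \<Rightarrow> real" where
  "christoffel c x k i j q =
     (\<Sum>l\<in>UNIV. inv_metric c x q $ k $ l *
        (pd c i (\<lambda>r. metric c x r $ j $ l) q + pd c j (\<lambda>r. metric c x r $ i $ l) q
         - pd c l (\<lambda>r. metric c x r $ i $ j) q)) / 2"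

definition gradient ::
  "('a, 'm::finite) chart \<Rightarrow> ('a \<Rightarrow> 'b::euclidean_space) \<Rightarrow> ('a \<Rightarrow> real) \<Rightarrow> 'a \<Rightarrow> 'b" where
  "gradient c x u q =
     (\<Sum>i\<in>UNIV. \<Sum>j\<in>UNIV. (inv_metric c x q $ i $ j * pd c i u q) *\<^sub>R pd c j x q)"

text \<open>\<open>D\<^sup>\<bottom>\<^bsub>\<partial>\<^sub>i\<^esub> \<nu>\<close>, and \<open>D\<^sup>\<bottom>\<^sub>X \<nu>\<close> for a tangent vector \<open>X\<close>.\<close>

definition nconn ::
  "('a, 'm::finite) chart \<Rightarrow> ('a \<Rightarrow> 'b::euclidean_space) \<Rightarrow> 'm \<Rightarrow> ('a \<Rightarrow> 'b) \<Rightarrow> 'a \<Rightarrow> 'b" where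
  "nconn c x i \<nu> q = nor_part c x q (pd c i \<nu> q)"

definition normal_connection ::
  "('a, 'm::finite) chart \<Rightarrow> ('a \<Rightarrow> 'b::euclidean_space) \<Rightarrow> 'b \<Rightarrow> ('a \<Rightarrow> 'b) \<Rightarrow> 'a \<Rightarrow> 'b" where
  "normal_connection c x X \<nu> q = (\<Sum>i\<in>UNIV. tan_comp c x q X $ i *\<^sub>R nconn c x i \<nu> q)"

text \<open>\<open>g\<^sup>i\<^sup>j (D\<^sup>\<bottom>\<^bsub>\<partial>\<^sub>i\<^esub> D\<^sup>\<bottom>\<^bsub>\<partial>\<^sub>j\<^esub> \<nu> - D\<^sup>\<bottom>\<^sub>Z \<nu>)\<close> with \<open>Z = \<nabla>\<^bsub>\<partial>\<^sub>i\<^esub> \<partial>\<^sub>j = \<Gamma>\<^sup>k\<^sub>i\<^sub>j \<partial>\<^sub>k\<close>\<close>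

definition normal_laplacian ::
  "('a, 'm::finite) chart \<Rightarrow> ('a \<Rightarrow> 'b::euclidean_space) \<Rightarrow> ('a \<Rightarrow> 'b) \<Rightarrow> 'a \<Rightarrow> 'b" where
  "normal_laplacian c x \<nu> q =
     (\<Sum>i\<in>UNIV. \<Sum>j\<in>UNIV. inv_metric c x q $ i $ j *\<^sub>R
        (nconn c x i (nconn c x j \<nu>) q - (\<Sum>k\<in>UNIV. christoffel c x k i j q *\<^sub>R nconn c x k \<nu> q)))"


section \<open>Global notions\<close>

text \<open>
  Some chart around \<open>q\<close>; it is only used to evaluate quantities that do not depend on the chart.
\<close>

definition chart_at :: "('a, 'm) chart set \<Rightarrow> 'a \<Rightarrow> ('a, 'm) chart" where
  "chart_at \<A> q = (SOME c. c \<in> \<A> \<and> q \<in> chart_dom c)"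

text \<open>The Riemannian measure \<open>dV\<^sub>y\<close>: the Borel measure given by \<open>sqrt (det g) du\<close> in every chart.\<close>

definition volume_measure ::
  "('a::{t2_space, second_countable_topology}, 'm::finite) chart set \<Rightarrow> ('a \<Rightarrow> 'b::euclidean_space)
   \<Rightarrow> 'a measure" where
  "volume_measure \<A> y =
     (THE \<mu>. sets \<mu> = sets borel \<and>
        (\<forall>c\<in>\<A>. \<forall>A\<in>sets borel. A \<subseteq> chart_dom c \<longrightarrow>
           emeasure \<mu> A =
             (\<integral>\<^sup>+u. ennreal (vol_density c y (param c u)) * indicator (coord c ` A) u \<partial>lborel)))"

definition normal_field ::
  "('a, 'm::finite) chart set \<Rightarrow> ('a \<Rightarrow> 'b::euclidean_space) \<Rightarrow> ('a \<Rightarrow> 'b) \<Rightarrow> bool" where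
  "normal_field \<A> x \<nu> \<longleftrightarrow> smooth_map \<A> \<nu> \<and>
     (\<forall>c\<in>\<A>. \<forall>q\<in>chart_dom c. \<forall>v\<in>tangent_space c x q. orthogonal (\<nu> q) v)"

definition parallel_normal ::
  "('a, 'm::finite) chart set \<Rightarrow> ('a \<Rightarrow> 'b::euclidean_space) \<Rightarrow> ('a \<Rightarrow> 'b) \<Rightarrow> bool" where
  "parallel_normal \<A> x \<nu> \<longleftrightarrow> (\<forall>c\<in>\<A>. \<forall>q\<in>chart_dom c. \<forall>i. nconn c x i \<nu> q = 0)"

definition xi_submanifold ::
  "('a, 'm::finite) chart set \<Rightarrow> ('a \<Rightarrow> 'b::euclidean_space) \<Rightarrow> ('a \<Rightarrow> 'b) \<Rightarrow> bool" where
  "xi_submanifold \<A> \<xi> x \<longleftrightarrow>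
     immersion \<A> x \<and> normal_field \<A> x \<xi> \<and> parallel_normal \<A> x \<xi> \<and>
     (\<forall>c\<in>\<A>. \<forall>q\<in>chart_dom c. mean_curvature c x q + nor_part c x q (x q) = \<xi> q)"


section \<open>Variations\<close>

definition dt :: "('a \<Rightarrow> real \<Rightarrow> 'b::euclidean_space) \<Rightarrow> 'a \<Rightarrow> real \<Rightarrow> 'b" where
  "dt F q t = vector_derivative (F q) (at t)"

text \<open>Only the values \<open>F q t\<close> with \<open>\<bar>t\<bar> < \<epsilon>\<close> matter.\<close>

definition variation ::
  "('a, 'm::finite) chart set \<Rightarrow> ('a \<Rightarrow> 'b::euclidean_space) \<Rightarrow> real \<Rightarrow> ('a \<Rightarrow> real \<Rightarrow> 'b) \<Rightarrow> bool" where
  "variation \<A> x \<epsilon> F \<longleftrightarrow> 0 < \<epsilon> \<and>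
     (\<forall>c\<in>\<A>. smooth_on (coord_range c \<times> {-\<epsilon><..<\<epsilon>}) (\<lambda>(u, t). F (param c u) t)) \<and>
     (\<forall>q. F q 0 = x q) \<and>
     (\<forall>t\<in>{-\<epsilon><..<\<epsilon>}. immersion \<A> (\<lambda>q. F q t))"

definition compact_variation ::
  "('a::topological_space, 'm::finite) chart set \<Rightarrow> ('a \<Rightarrow> 'b::euclidean_space) \<Rightarrow> real
   \<Rightarrow> ('a \<Rightarrow> real \<Rightarrow> 'b) \<Rightarrow> bool" where
  "compact_variation \<A> x \<epsilon> F \<longleftrightarrow> variation \<A> x \<epsilon> F \<and>
     (\<exists>B. open B \<and> compact (closure B) \<and>
          (\<forall>t\<in>{-\<epsilon><..<\<epsilon>}. closure {q. dt F q t \<noteq> 0} \<subseteq> B))"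

definition normal_variation ::
  "('a, 'm::finite) chart set \<Rightarrow> ('a \<Rightarrow> 'b::euclidean_space) \<Rightarrow> real \<Rightarrow> ('a \<Rightarrow> real \<Rightarrow> 'b) \<Rightarrow> bool" where
  "normal_variation \<A> x \<epsilon> F \<longleftrightarrow> variation \<A> x \<epsilon> F \<and> normal_field \<A> x (\<lambda>q. dt F q 0)"


section \<open>The weighted volume functionals and their second variations\<close>

definition f_weight :: "('a \<Rightarrow> 'b::euclidean_space) \<Rightarrow> ('a \<Rightarrow> 'b) \<Rightarrow> 'a \<Rightarrow> real" where
  "f_weight \<xi> y q = (norm (y q - \<xi> q))\<^sup>2 / 2"

definition fbar_weight :: "('a \<Rightarrow> 'b::euclidean_space) \<Rightarrow> ('a \<Rightarrow> 'b) \<Rightarrow> 'a \<Rightarrow> real" where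
  "fbar_weight \<xi> y q = f_weight \<xi> y q - (norm (\<xi> q))\<^sup>2 / 2"

text \<open>
  The functional \<open>y \<mapsto> \<integral> e\<^sup>-\<^sup>\<psi> dV\<^sub>y\<close> for a weight \<open>\<psi>\<close> depending on the immersion \<open>y\<close>; \<open>V\<^sub>\<xi>\<close> is
  \<open>weighted_volume \<A> (f_weight \<xi>)\<close>, and similarly for the barred functional with \<open>fbar_weight\<close>.
  The value may be infinite.
\<close>

definition weighted_volume ::
  "('a::{t2_space, second_countable_topology}, 'm::finite) chart set
   \<Rightarrow> (('a \<Rightarrow> 'b::euclidean_space) \<Rightarrow> 'a \<Rightarrow> real) \<Rightarrow> ('a \<Rightarrow> 'b) \<Rightarrow> ennreal" where
  "weighted_volume \<A> \<psi> y = (\<integral>\<^sup>+q. ennreal (exp (- \<psi> y q)) \<partial>volume_measure \<A> y)"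

text \<open>
  The function \<open>t \<mapsto> e\<^sup>-\<^sup>\<psi> dV\<^sub>t / dV\<^sub>0\<close> at the point \<open>q\<close>, where \<open>dV\<^sub>t\<close> is the volume element of
  \<open>F(\<cdot>, t)\<close>; the quotient of the two densities does not depend on the chart.
\<close>

definition relative_density ::
  "('a, 'm::finite) chart set \<Rightarrow> (('a \<Rightarrow> 'b::euclidean_space) \<Rightarrow> 'a \<Rightarrow> real)
   \<Rightarrow> ('a \<Rightarrow> real \<Rightarrow> 'b) \<Rightarrow> 'a \<Rightarrow> real \<Rightarrow> real" where
  "relative_density \<A> \<psi> F q t =
     exp (- \<psi> (\<lambda>r. F r t) q) * (vol_density (chart_at \<A> q) (\<lambda>r. F r t) q
                                  / vol_density (chart_at \<A> q) (\<lambda>r. F r 0) q)"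

text \<open>
  \<open>L\<close> is the second derivative at \<open>t = 0\<close> of the functional along the variation: an honest second
  derivative if the functional is finite along the variation, and otherwise the derivative taken
  under the integral sign.
\<close>

definition has_second_variation ::
  "('a::{t2_space, second_countable_topology}, 'm::finite) chart set
   \<Rightarrow> (('a \<Rightarrow> 'b::euclidean_space) \<Rightarrow> 'a \<Rightarrow> real) \<Rightarrow> real \<Rightarrow> ('a \<Rightarrow> real \<Rightarrow> 'b) \<Rightarrow> real \<Rightarrow> bool" where
  "has_second_variation \<A> \<psi> \<epsilon> F L \<longleftrightarrow>
     (if \<forall>t\<in>{-\<epsilon><..<\<epsilon>}. weighted_volume \<A> \<psi> (\<lambda>q. F q t) < \<infinity>
      then \<exists>V'. (\<forall>\<^sub>F t in nhds 0.
                  ((\<lambda>s. enn2real (weighted_volume \<A> \<psi> (\<lambda>q. F q s))) has_real_derivative V' t) (at t))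
               \<and> (V' has_real_derivative L) (at 0)
      else has_bochner_integral (volume_measure \<A> (\<lambda>q. F q 0))
             (\<lambda>q. deriv (deriv (relative_density \<A> \<psi> F q)) 0) L)"

text \<open>The integrand of the second variation formulas, without the factor \<open>-e\<^sup>-\<^sup>\<psi>\<close>.\<close>

definition second_variation_integrand ::
  "('a, 'm::finite) chart set \<Rightarrow> ('a \<Rightarrow> 'b::euclidean_space) \<Rightarrow> ('a \<Rightarrow> 'b)
   \<Rightarrow> ('a \<Rightarrow> real \<Rightarrow> 'b) \<Rightarrow> 'a \<Rightarrow> real" where
  "second_variation_integrand \<A> \<xi> x F q =
     (let c = chart_at \<A> q;
          \<eta> = (\<lambda>r. dt F r 0);
          xtan = tan_part c x q (x q);
          g = inv_metric c x q
      in (normal_laplacian c x \<eta> q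
            - normal_connection c x (xtan + weingarten c x \<xi> q xtan) \<eta> q
            + (\<Sum>i\<in>UNIV. \<Sum>j\<in>UNIV. \<Sum>k\<in>UNIV. \<Sum>l\<in>UNIV.
                 (g $ i $ k * g $ j $ l * (sff c x i j q \<bullet> \<eta> q)) *\<^sub>R sff c x k l q)
            + \<eta> q) \<bullet> \<eta> q
         + gradient c x (\<lambda>r. x r \<bullet> \<xi> r) q \<bullet> vector_derivative (dt F q) (at 0))"

end

theory Submission
  imports Defs
begin

text \<open>
  Put \<open>w = e\<^sup>-\<^sup>f\<close> and \<open>Z = \<partial>\<^sub>t\<^sup>2 F\<close> at \<open>t = 0\<close>, and let \<open>\<rho>\<^sub>t\<close> be the density of the weighted volume of \<open>F(\<cdot>, t)\<close>
  with respect to \<open>dV\<close>, so that \<open>\<rho>\<^sub>0 = w\<close>.  The logarithmic derivative of \<open>\<rho>\<close> at \<open>t = 0\<close> is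
  \<open>- \<langle>H + x\<^sup>\<bottom> - \<xi>, \<eta>\<rangle> = 0\<close>, hence \<open>\<rho>'' = w \<partial>\<^sub>t\<^sup>2 log \<rho>\<close> there.  Since \<open>\<xi>\<close> is normal and parallel,
  \<open>|\<xi>|\<^sup>2\<close> is locally constant and \<open>\<partial>\<^sub>i w = - w (\<langle>x, \<partial>\<^sub>i x\<rangle> - \<langle>x, \<partial>\<^sub>i \<xi>\<rangle>)\<close>, for both weights of the theorem.
  With this, \<open>\<rho>''\<close> plus \<open>w\<close> times the integrand of the theorem is the divergence of
  \<open>w (Z + \<nabla> (|\<eta>|\<^sup>2 / 2))\<close>, where the divergence of a vector field \<open>X\<close> of the ambient space along \<open>x\<close> is
  \<open>\<langle>\<partial>\<^sub>i X, e\<^sup>i\<rangle> + \<langle>H, X\<rangle>\<close> for the dual frame \<open>e\<^sup>i\<close>.  The divergence theorem and differentiation under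
  the integral sign finish the proof.
\<close>

section \<open>Functions of class \<open>C\<^sup>k\<close>\<close>

text \<open>Normality constrains the variation only through its velocity at t = 0. The acceleration
  \<open>Z\<close> is an arbitrary ambient field, which is why the divergence is set up for ambient
  fields and carries the mean curvature term. The drift of the weighted divergence is explicit: for
  a parallel normal \<xi> the Weingarten operator sends the tangential part \<open>xtan\<close> of x
  to minus the gradient of \<langle>x, \<xi>\<rangle>, so that
  \<open>V = xtan + weingarten c x \<xi> q xtan\<close> is minus the logarithmic gradient of w.
  Paired with the gradient of \<open>|\<eta>|\<^sup>2 / 2\<close>, the field \<open>V\<close> gives
  the connection term of the theorem; paired with \<open>Z\<close>, it gives the term with the
  gradient of \<langle>x, \<xi>\<rangle>.

  The functionals may be infinite. Everything is therefore computed pointwise for the density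
  relative to the fixed measure dV. This density depends on t only over a compact set, so its time
  derivatives are integrable in all cases. No orientation or partition of unity is used: the measure
  is glued from disjoint Borel pieces of charts, and the divergence theorem is an induction over a
  finite cover, for which cut-off functions of class \<open>C\<^sup>1\<close> suffice.\<close>

lemma Ck_on_cong:
  assumes "open S" "\<And>u. u \<in> S \<Longrightarrow> f u = g u"
  shows "Ck_on k S f \<longleftrightarrow> Ck_on k S g"
  using assms(2)
proof (induction k arbitrary: f g)
  case 0
  then show ?case by (simp cong: continuous_on_cong)
next
  case (Suc k)
  have D: "(f has_derivative D) (at u) \<longleftrightarrow> (g has_derivative D) (at u)" if "u \<in> S" for u D
    using has_derivative_transform_within_open[OF _ assms(1) that, of f D UNIV g]
      has_derivative_transform_within_open[OF _ assms(1) that, of g D UNIV f] Suc.prems by auto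
  have diff: "f differentiable (at u) \<longleftrightarrow> g differentiable (at u)"
    and frechet: "frechet_derivative f (at u) = frechet_derivative g (at u)" if "u \<in> S" for u
    by (simp_all add: differentiable_def frechet_derivative_def D[OF that])
  show ?case
    using Suc.IH[of "\<lambda>u. frechet_derivative f (at u) v" "\<lambda>u. frechet_derivative g (at u) v" for v]
    by (simp add: diff frechet cong: ball_cong)
qed

text \<open>Derivatives are unique, so an explicitly known \<open>f'\<close> may stand in for
  \<open>frechet_derivative\<close>. All the closure rules below are proved through this
  form.\<close>

lemma Ck_on_SucI:
  assumes "open S" "\<And>u. u \<in> S \<Longrightarrow> (f has_derivative f' u) (at u)" "\<And>v. Ck_on k S (\<lambda>u. f' u v)"
  shows "Ck_on (Suc k) S f"
proof -
  have "frechet_derivative f (at u) = f' u" if "u \<in> S" for u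
    using frechet_derivative_at[OF assms(2)[OF that]] by simp
  then have "Ck_on k S (\<lambda>u. frechet_derivative f (at u) v)" for v
    using Ck_on_cong[OF assms(1), of "\<lambda>u. frechet_derivative f (at u) v" "\<lambda>u. f' u v"] assms(3) by simp
  then show ?thesis
    using assms(2) by (auto simp: differentiable_def)
qed

lemma Ck_on_SucD:
  assumes "Ck_on (Suc k) S f" "u \<in> S"
  shows "(f has_derivative frechet_derivative f (at u)) (at u)"
  using assms by (simp add: frechet_derivative_works)

lemma Ck_on_frechet: "Ck_on (Suc k) S f \<Longrightarrow> Ck_on k S (\<lambda>u. frechet_derivative f (at u) v)"
  by simp

lemma Ck_on_continuous_on: "Ck_on k S f \<Longrightarrow> continuous_on S f"
  by (cases k) (auto intro!: continuous_at_imp_continuous_on dest: differentiable_imp_continuous_within)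

lemma Ck_on_Suc_imp: "Ck_on (Suc k) S f \<Longrightarrow> Ck_on k S f"
proof (induction k arbitrary: f)
  case 0
  then show ?case using Ck_on_continuous_on[OF 0] by simp
qed simp

section \<open>Closure properties of \<open>C\<^sup>k\<close> functions\<close>

named_theorems Ck_intros

lemma Ck_on_const [Ck_intros]: "Ck_on k S (\<lambda>u. c)"
  by (induction k arbitrary: c) auto

lemma Ck_on_bounded_linear:
  assumes "bounded_linear f" "open S" shows "Ck_on k S f"
proof (cases k)
  case 0
  then show ?thesis using assms linear_continuous_on by auto
next
  case (Suc j)
  then show ?thesis
    using Ck_on_SucI[OF assms(2), of f "\<lambda>u. f"] bounded_linear_imp_has_derivative[OF assms(1)] Ck_on_const
    by blast
qed

lemma Ck_on_id [Ck_intros]: "open S \<Longrightarrow> Ck_on k S (\<lambda>u. u)"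
  by (rule Ck_on_bounded_linear[OF bounded_linear_ident])

lemma Ck_on_add [Ck_intros]:
  assumes "open S" "Ck_on k S f" "Ck_on k S g"
  shows "Ck_on k S (\<lambda>u. f u + g u)"
  using assms(2,3)
proof (induction k arbitrary: f g)
  case (Suc k)
  show ?case
    by (rule Ck_on_SucI[OF assms(1) has_derivative_add[OF Ck_on_SucD[OF Suc.prems(1)] Ck_on_SucD[OF Suc.prems(2)]]])
       (auto intro!: Suc.IH Ck_on_frechet Suc.prems simp del: Ck_on.simps)
qed (auto intro: continuous_intros)

text \<open>Both terms of the product rule are again values of \<open>B\<close> at functions of
  class \<open>C\<^sup>k\<close>, so a single induction with \<open>f\<close> and \<open>g\<close>
  arbitrary serves products, scalar multiples and inner products.\<close>

lemma Ck_on_bilinear: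
  assumes "bounded_bilinear B" "open S" "Ck_on k S f" "Ck_on k S g"
  shows "Ck_on k S (\<lambda>u. B (f u) (g u))"
  using assms(3,4)
proof (induction k arbitrary: f g)
  case 0
  then show ?case by (auto intro: bounded_bilinear.continuous_on[OF assms(1)])
next
  case (Suc k)
  have "Ck_on k S (\<lambda>u. B (f u) (frechet_derivative g (at u) v) + B (frechet_derivative f (at u) v) (g u))" for v
    using Suc.prems
    by (intro Ck_on_add[OF assms(2)] Suc.IH Ck_on_Suc_imp[of k] Ck_on_frechet)
  then show ?case
    using Ck_on_SucD[OF Suc.prems(1)] Ck_on_SucD[OF Suc.prems(2)]
    by (intro Ck_on_SucI[OF assms(2) bounded_bilinear.FDERIV[OF assms(1)]]) auto
qed

lemmas Ck_on_mult [Ck_intros] = Ck_on_bilinear[OF bounded_bilinear_mult]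
lemmas Ck_on_scaleR [Ck_intros] = Ck_on_bilinear[OF bounded_bilinear_scaleR]
lemmas Ck_on_inner [Ck_intros] = Ck_on_bilinear[OF bounded_bilinear_inner]

lemma Ck_on_minus [Ck_intros]:
  assumes "open S" "Ck_on k S f" shows "Ck_on k S (\<lambda>u. - f u)"
  using Ck_on_scaleR[OF assms(1) Ck_on_const assms(2), of "-1"] by simp

lemma Ck_on_diff [Ck_intros]:
  assumes "open S" "Ck_on k S f" "Ck_on k S g" shows "Ck_on k S (\<lambda>u. f u - g u)"
  using Ck_on_add[OF assms(1,2) Ck_on_minus[OF assms(1,3)]] by simp

lemma Ck_on_sum [Ck_intros]:
  assumes "open S" "\<And>i. i \<in> I \<Longrightarrow> Ck_on k S (f i)" shows "Ck_on k S (\<lambda>u. \<Sum>i\<in>I. f i u)"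
  using assms(2) by (induction I rule: infinite_finite_induct) (auto intro!: Ck_on_const Ck_on_add[OF assms(1)])

lemma Ck_on_prod [Ck_intros]:
  assumes "open S" "\<And>i. i \<in> I \<Longrightarrow> Ck_on k S (f i)" shows "Ck_on k S (\<lambda>u. \<Prod>i\<in>I. f i u :: real)"
  using assms(2) by (induction I rule: infinite_finite_induct) (auto intro!: Ck_on_const Ck_on_mult[OF assms(1)])

lemma Ck_on_compose:
  fixes f :: "'a::euclidean_space \<Rightarrow> 'b::euclidean_space" and g :: "'b \<Rightarrow> 'c::euclidean_space"
  assumes "open S" "Ck_on k S f" "Ck_on k T g" "f ` S \<subseteq> T"
  shows "Ck_on k S (\<lambda>u. g (f u))"
  using assms(2,3)
proof (induction k arbitrary: g)
  case 0
  then show ?case using continuous_on_compose2 assms(4) by auto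
next
  case (Suc k)
  \<comment> \<open>The chain rule evaluates the derivative of \<open>g\<close> in a direction that
    varies with \<open>u\<close>, whereas \<open>Ck_on\<close> controls fixed directions only.
    Expanding the direction in \<open>Basis\<close> leaves scalar factors and derivatives of
    \<open>g\<close> along basis vectors, composed with \<open>f\<close>.\<close>
  let ?D = "\<lambda>u v. \<Sum>b\<in>Basis. (frechet_derivative f (at u) v \<bullet> b) *\<^sub>R frechet_derivative g (at (f u)) b"
  have "((\<lambda>w. g (f w)) has_derivative ?D u) (at u)" if "u \<in> S" for u
  proof -
    have f: "(f has_derivative frechet_derivative f (at u)) (at u)"
      and g: "(g has_derivative frechet_derivative g (at (f u))) (at (f u))"
      using Ck_on_SucD[OF Suc.prems(1)] Ck_on_SucD[OF Suc.prems(2)] that assms(4) by auto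
    interpret g: linear "frechet_derivative g (at (f u))"
      by (rule has_derivative_linear[OF g])
    have "frechet_derivative g (at (f u)) (frechet_derivative f (at u) v) = ?D u v" for v
      by (subst euclidean_representation[symmetric, of "frechet_derivative f (at u) v"])
         (simp only: g.sum g.scaleR)
    then show ?thesis
      using diff_chain_at[OF f g] by (simp add: o_def)
  qed
  moreover have "Ck_on k S (\<lambda>u. ?D u v)" for v
    using Suc.prems assms(1)
    by (intro Ck_intros Ck_on_frechet Suc.IH) (auto intro: Ck_on_Suc_imp simp del: Ck_on.simps)
  ultimately show ?case by (rule Ck_on_SucI[OF assms(1)])
qed

lemma Ck_on_exp [Ck_intros]:
  assumes "open S" "Ck_on k S f" shows "Ck_on k S (\<lambda>u. exp (f u :: real))"
proof -
  have "Ck_on k UNIV (exp :: real \<Rightarrow> real)"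
  proof (induction k)
    case (Suc k)
    have "(exp has_derivative (\<lambda>h. exp u * h)) (at u)" for u :: real
      by (auto intro!: derivative_eq_intros)
    then show ?case
      by (intro Ck_on_SucI[where f' = "\<lambda>u h. exp u * h"])
         (auto intro!: Ck_intros Suc.IH simp del: Ck_on.simps)
  qed (simp add: continuous_on_exp)
  then show ?thesis using Ck_on_compose[OF assms] by blast
qed

text \<open>Writing the derivative through \<open>inverse\<close> itself closes the induction on the
  order; \<open>Ck_on_compose\<close> then passes from the function of one variable to
  \<open>f\<close>.\<close>

lemma Ck_on_inverse [Ck_intros]:
  assumes "open S" "Ck_on k S f" "\<And>u. u \<in> S \<Longrightarrow> f u \<noteq> 0" shows "Ck_on k S (\<lambda>u. inverse (f u :: real))"
proof -
  have "Ck_on k (- {0}) (inverse :: real \<Rightarrow> real)"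
  proof (induction k)
    case 0
    then show ?case by (auto intro!: continuous_intros)
  next
    case (Suc k)
    have "(inverse has_derivative (\<lambda>h. - (inverse u * h * inverse u))) (at u)" if "u \<noteq> 0" for u :: real
      using that by (auto intro!: derivative_eq_intros)
    then show ?case
      by (intro Ck_on_SucI[where f' = "\<lambda>u h. - (inverse u * h * inverse u)"])
         (auto intro!: Ck_intros Suc.IH simp del: Ck_on.simps)
  qed
  then show ?thesis using assms(3) by (intro Ck_on_compose[OF assms(1,2)]) auto
qed

lemma Ck_on_divide [Ck_intros]:
  assumes "open S" "Ck_on k S f" "Ck_on k S g" "\<And>u. u \<in> S \<Longrightarrow> g u \<noteq> 0"
  shows "Ck_on k S (\<lambda>u. f u / g u :: real)"
  unfolding divide_inverse using assms by (intro Ck_intros)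

lemma Ck_on_sqrt [Ck_intros]:
  assumes "open S" "Ck_on k S f" "\<And>u. u \<in> S \<Longrightarrow> f u > 0" shows "Ck_on k S (\<lambda>u. sqrt (f u))"
proof -
  have "Ck_on k {0<..} sqrt"
  proof (induction k)
    case 0
    then show ?case by (auto intro!: continuous_intros)
  next
    case (Suc k)
    have "(sqrt has_derivative (\<lambda>h. inverse (sqrt u) * h / 2)) (at u)" if "u > 0" for u :: real
      using that by (auto intro!: derivative_eq_intros simp: field_simps)
    then show ?case
      by (intro Ck_on_SucI[where f' = "\<lambda>u h. inverse (sqrt u) * h / 2"])
         (auto intro!: Ck_intros Suc.IH simp del: Ck_on.simps)
  qed
  then show ?thesis using assms(3) by (intro Ck_on_compose[OF assms(1,2)]) auto
qed

lemma Ck_on_Pair [Ck_intros]: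
  assumes "open S" "Ck_on k S f" "Ck_on k S g"
  shows "Ck_on k S (\<lambda>u. (f u, g u))"
  using assms(2,3)
proof (induction k arbitrary: f g)
  case (Suc k)
  show ?case
    by (rule Ck_on_SucI[OF assms(1) has_derivative_Pair[OF Ck_on_SucD[OF Suc.prems(1)] Ck_on_SucD[OF Suc.prems(2)]]])
       (auto intro!: Suc.IH Ck_on_frechet Suc.prems simp del: Ck_on.simps)
qed (auto intro: continuous_intros)

text \<open>Schwarz: both orders of differentiation are limits of the same second difference quotient.\<close>

lemma second_difference_mean_value:
  fixes f :: "'a::euclidean_space \<Rightarrow> real"
  assumes f: "Ck_on 2 S f" and h: "h > 0"
    and S: "\<And>s t. 0 \<le> s \<Longrightarrow> s \<le> h \<Longrightarrow> 0 \<le> t \<Longrightarrow> t \<le> h \<Longrightarrow> u + s *\<^sub>R v + t *\<^sub>R w \<in> S"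
  shows "\<exists>s\<in>{0..h}. \<exists>t\<in>{0..h}.
     f (u + h *\<^sub>R v + h *\<^sub>R w) - f (u + h *\<^sub>R v) - f (u + h *\<^sub>R w) + f u
      = h * h * frechet_derivative (\<lambda>z. frechet_derivative f (at z) v) (at (u + s *\<^sub>R v + t *\<^sub>R w)) w"
proof -
  have f2: "Ck_on (Suc (Suc 0)) S f" using f by (simp add: numeral_2_eq_2)
  let ?Dv = "\<lambda>z. frechet_derivative f (at z) v"
  let ?g = "\<lambda>s. f (u + s *\<^sub>R v + h *\<^sub>R w) - f (u + s *\<^sub>R v)"
  have D1: "((\<lambda>s. f (u + s *\<^sub>R v + t *\<^sub>R w)) has_real_derivative ?Dv (u + s *\<^sub>R v + t *\<^sub>R w)) (at s)"
    if "0 \<le> s" "s \<le> h" "0 \<le> t" "t \<le> h" for s t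
  proof -
    have "((\<lambda>s. u + s *\<^sub>R v + t *\<^sub>R w) has_derivative (\<lambda>r. r *\<^sub>R v)) (at s)"
      by (auto intro!: derivative_eq_intros)
    note diff_chain_at[OF this Ck_on_SucD[OF f2 S[OF that]]]
    moreover have "linear (frechet_derivative f (at (u + s *\<^sub>R v + t *\<^sub>R w)))"
      using has_derivative_linear[OF Ck_on_SucD[OF f2 S[OF that]]] .
    ultimately show ?thesis
      by (simp add: o_def has_field_derivative_def linear_scale mult.commute[of _ "frechet_derivative _ _ _"])
  qed
  have D2: "((\<lambda>t. ?Dv (u + s *\<^sub>R v + t *\<^sub>R w)) has_real_derivative
      frechet_derivative ?Dv (at (u + s *\<^sub>R v + t *\<^sub>R w)) w) (at t)"
    if "0 \<le> s" "s \<le> h" "0 \<le> t" "t \<le> h" for s t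
  proof -
    have "((\<lambda>t. u + s *\<^sub>R v + t *\<^sub>R w) has_derivative (\<lambda>r. r *\<^sub>R w)) (at t)"
      by (auto intro!: derivative_eq_intros)
    note diff_chain_at[OF this Ck_on_SucD[OF Ck_on_frechet[OF f2, of v] S[OF that]]]
    moreover have "linear (frechet_derivative ?Dv (at (u + s *\<^sub>R v + t *\<^sub>R w)))"
      using has_derivative_linear[OF Ck_on_SucD[OF Ck_on_frechet[OF f2, of v] S[OF that]]] .
    ultimately show ?thesis
      by (simp add: o_def has_field_derivative_def linear_scale mult.commute[of _ "frechet_derivative _ _ _"])
  qed
  \<comment> \<open>The second difference is the increment over \<open>[0, h]\<close> of
    \<open>?g\<close>, itself a difference in direction \<open>w\<close>. The mean value theorem is
    applied in direction \<open>v\<close> to \<open>?g\<close>, then in direction \<open>w\<close>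
    to the derivative along \<open>v\<close>.\<close>
  have "\<exists>s. 0 < s \<and> s < h \<and> ?g h - ?g 0 = (h - 0) * (?Dv (u + s *\<^sub>R v + h *\<^sub>R w) - ?Dv (u + s *\<^sub>R v))"
    using D1[of _ h] D1[of _ 0] h by (intro MVT2 derivative_intros) auto
  then obtain s where s: "0 < s" "s < h"
    and gs: "?g h - ?g 0 = h * (?Dv (u + s *\<^sub>R v + h *\<^sub>R w) - ?Dv (u + s *\<^sub>R v))"
    by auto
  have "\<exists>t. 0 < t \<and> t < h \<and> ?Dv (u + s *\<^sub>R v + h *\<^sub>R w) - ?Dv (u + s *\<^sub>R v + 0 *\<^sub>R w)
      = (h - 0) * frechet_derivative ?Dv (at (u + s *\<^sub>R v + t *\<^sub>R w)) w"
    using D2[of s] h s by (intro MVT2) auto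
  then obtain t where t: "0 < t" "t < h" and ht: "?Dv (u + s *\<^sub>R v + h *\<^sub>R w) - ?Dv (u + s *\<^sub>R v)
      = h * frechet_derivative ?Dv (at (u + s *\<^sub>R v + t *\<^sub>R w)) w"
    by auto
  have "f (u + h *\<^sub>R v + h *\<^sub>R w) - f (u + h *\<^sub>R v) - f (u + h *\<^sub>R w) + f u = ?g h - ?g 0"
    by simp
  also have "\<dots> = h * h * frechet_derivative ?Dv (at (u + s *\<^sub>R v + t *\<^sub>R w)) w"
    by (simp only: gs ht mult.assoc)
  finally show ?thesis
    using s t by (intro bexI[of _ s] bexI[of _ t]) auto
qed

lemma frechet_derivative_commute_real:
  fixes f :: "'a::euclidean_space \<Rightarrow> real"
  assumes f: "Ck_on 2 S f" and "open S" "u \<in> S"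
  shows "frechet_derivative (\<lambda>z. frechet_derivative f (at z) v) (at u) w
       = frechet_derivative (\<lambda>z. frechet_derivative f (at z) w) (at u) v"
proof (rule ccontr)
  let ?A = "\<lambda>z. frechet_derivative (\<lambda>z. frechet_derivative f (at z) v) (at z) w"
  let ?B = "\<lambda>z. frechet_derivative (\<lambda>z. frechet_derivative f (at z) w) (at z) v"
  assume ne: "?A u \<noteq> ?B u"
  \<comment> \<open>Half the supposed gap: two values within \<open>e\<close> of \<open>?A u\<close>
    and \<open>?B u\<close> respectively cannot coincide.\<close>
  define e where "e = \<bar>?A u - ?B u\<bar> / 2"
  have "e > 0" using ne by (simp add: e_def)
  have f2: "Ck_on (Suc (Suc 0)) S f" using f by (simp add: numeral_2_eq_2)
  have "continuous_on S ?A" "continuous_on S ?B"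
    using f2 by simp_all
  then have "\<forall>\<^sub>F z in nhds u. dist (?A z) (?A u) < e \<and> dist (?B z) (?B u) < e \<and> z \<in> S"
    using assms(2,3) \<open>e > 0\<close> by (intro eventually_conj)
      (auto simp: continuous_on_eq_continuous_at isCont_def tendsto_at_iff_tendsto_nhds[symmetric] eventually_nhds_in_open
        intro!: tendstoD tendsto_at_iff_tendsto_nhds[THEN iffD1])
  then obtain d where d: "d > 0"
    "\<And>z. dist z u < d \<Longrightarrow> dist (?A z) (?A u) < e \<and> dist (?B z) (?B u) < e \<and> z \<in> S"
    unfolding eventually_nhds_metric by blast
  \<comment> \<open>Keeps the whole parallelogram spanned by \<open>h *\<^sub>R v\<close> and
    \<open>h *\<^sub>R w\<close> within distance \<open>d / 2\<close> of \<open>u\<close>; the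
    summand 1 covers the case that both vectors vanish.\<close>
  define h where "h = d / (2 * (norm v + norm w + 1))"
  have N: "norm v + norm w + 1 > 0" by (simp add: add_nonneg_pos)
  then have "h > 0" using d by (simp add: h_def)
  have near: "dist (u + s *\<^sub>R v + t *\<^sub>R w) u < d" if "0 \<le> s" "s \<le> h" "0 \<le> t" "t \<le> h" for s t
  proof -
    have "dist (u + s *\<^sub>R v + t *\<^sub>R w) u = norm (s *\<^sub>R v + t *\<^sub>R w)" by (simp add: dist_norm add.assoc)
    also have "\<dots> \<le> s * norm v + t * norm w" using that norm_triangle_ineq[of "s *\<^sub>R v" "t *\<^sub>R w"] by simp
    also have "\<dots> \<le> h * norm v + h * norm w" using that by (intro add_mono mult_right_mono) auto
    also have "\<dots> \<le> h * (norm v + norm w + 1)" using \<open>h > 0\<close> by (simp add: algebra_simps)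
    also have "\<dots> = d / 2" using N unfolding h_def by (metis nonzero_divide_mult_cancel_right less_irrefl mult.commute times_divide_eq_left times_divide_eq_right divide_divide_eq_left nonzero_mult_div_cancel_right)
    finally show ?thesis using d by simp
  qed
  have S: "u + s *\<^sub>R v + t *\<^sub>R w \<in> S" if "0 \<le> s" "s \<le> h" "0 \<le> t" "t \<le> h" for s t
    using near[OF that] d(2) by blast
  obtain s t where st: "s \<in> {0..h}" "t \<in> {0..h}" and A:
     "f (u + h *\<^sub>R v + h *\<^sub>R w) - f (u + h *\<^sub>R v) - f (u + h *\<^sub>R w) + f u = h * h * ?A (u + s *\<^sub>R v + t *\<^sub>R w)"
    using second_difference_mean_value[OF f \<open>h > 0\<close> S] by blast
  have S': "u + s *\<^sub>R w + t *\<^sub>R v \<in> S" if "0 \<le> s" "s \<le> h" "0 \<le> t" "t \<le> h" for s t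
    using S[of t s] that by (simp add: algebra_simps)
  obtain s' t' where st': "s' \<in> {0..h}" "t' \<in> {0..h}" and B:
     "f (u + h *\<^sub>R w + h *\<^sub>R v) - f (u + h *\<^sub>R w) - f (u + h *\<^sub>R v) + f u = h * h * ?B (u + s' *\<^sub>R w + t' *\<^sub>R v)"
    using second_difference_mean_value[OF f \<open>h > 0\<close> S'] by blast
  \<comment> \<open>The second difference is symmetric in \<open>v\<close> and \<open>w\<close>, so
    both orders of differentiation, at different intermediate points, give the same number.\<close>
  have "h * h * ?A (u + s *\<^sub>R v + t *\<^sub>R w) = h * h * ?B (u + s' *\<^sub>R w + t' *\<^sub>R v)"
    using A B by (simp add: algebra_simps)
  then have eq: "?A (u + s *\<^sub>R v + t *\<^sub>R w) = ?B (u + t' *\<^sub>R v + s' *\<^sub>R w)"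
    using \<open>h > 0\<close> by (simp add: algebra_simps)
  have "dist (?A (u + s *\<^sub>R v + t *\<^sub>R w)) (?A u) < e" "dist (?B (u + t' *\<^sub>R v + s' *\<^sub>R w)) (?B u) < e"
    using d(2)[OF near] st st' by auto
  then have "\<bar>?A u - ?B u\<bar> < 2 * e" unfolding eq dist_real_def by linarith
  then show False by (simp add: e_def)
qed

lemma frechet_derivative_inner_left:
  assumes "f differentiable (at u)"
  shows "frechet_derivative (\<lambda>z. f z \<bullet> b) (at u) v = frechet_derivative f (at u) v \<bullet> b"
proof -
  have "((\<lambda>z. f z \<bullet> b) has_derivative (\<lambda>v. frechet_derivative f (at u) v \<bullet> b)) (at u)"
    using assms by (auto intro!: derivative_eq_intros simp: frechet_derivative_works)
  from frechet_derivative_at[OF this] show ?thesis by metis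
qed

text \<open>The mean value theorem needs real values; the vector case follows from the components
  \<open>f z \<bullet> b\<close>.\<close>

lemma frechet_derivative_commute:
  fixes f :: "'a::euclidean_space \<Rightarrow> 'b::euclidean_space"
  assumes f: "Ck_on 2 S f" and S: "open S" "u \<in> S"
  shows "frechet_derivative (\<lambda>z. frechet_derivative f (at z) v) (at u) w
       = frechet_derivative (\<lambda>z. frechet_derivative f (at z) w) (at u) v"
proof (rule euclidean_eqI)
  fix b :: 'b
  have f2: "Ck_on (Suc (Suc 0)) S f" using f by (simp add: numeral_2_eq_2)
  have fb: "Ck_on 2 S (\<lambda>z. f z \<bullet> b)"
    by (intro Ck_intros S f)
  have inner: "frechet_derivative (\<lambda>z. frechet_derivative (\<lambda>z. f z \<bullet> b) (at z) v) (at u) w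
     = frechet_derivative (\<lambda>z. frechet_derivative f (at z) v) (at u) w \<bullet> b" for v w
  proof -
    have D: "((\<lambda>z. frechet_derivative f (at z) v \<bullet> b) has_derivative
       (\<lambda>w. frechet_derivative (\<lambda>z. frechet_derivative f (at z) v) (at u) w \<bullet> b)) (at u)"
      using Ck_on_SucD[OF Ck_on_frechet[OF f2] S(2)] by (auto intro!: derivative_eq_intros)
    have eq: "frechet_derivative f (at z) v \<bullet> b = frechet_derivative (\<lambda>z. f z \<bullet> b) (at z) v" if "z \<in> S" for z
      using f2 that frechet_derivative_inner_left by (metis Ck_on.simps(2))
    from has_derivative_transform_within_open[OF D S eq]
    show ?thesis by (metis frechet_derivative_at)
  qed
  show "frechet_derivative (\<lambda>z. frechet_derivative f (at z) v) (at u) w \<bullet> b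
       = frechet_derivative (\<lambda>z. frechet_derivative f (at z) w) (at u) v \<bullet> b"
    using frechet_derivative_commute_real[OF fb S, of v w] by (simp add: inner)
qed

section \<open>Determinants and inverses of matrices depending on a parameter\<close>

lemma matrix_inv_inverse:
  fixes A :: "real^'m^'m"
  assumes "invertible A"
  shows "A ** matrix_inv A = mat 1" "matrix_inv A ** A = mat 1"
proof -
  have "\<exists>B. A ** B = mat 1 \<and> B ** A = mat 1"
    using assms by (simp add: invertible_def)
  from someI_ex[OF this] show "A ** matrix_inv A = mat 1" "matrix_inv A ** A = mat 1"
    by (simp_all add: matrix_inv_def)
qed

lemma sum_matrix_inv:
  fixes A :: "real^'m^'m"
  assumes "invertible A"
  shows "(\<Sum>k\<in>UNIV. A $ i $ k * matrix_inv A $ k $ j) = (if i = j then 1 else 0)"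
    "(\<Sum>k\<in>UNIV. matrix_inv A $ i $ k * A $ k $ j) = (if i = j then 1 else 0)"
  using matrix_inv_inverse[OF assms] by (simp_all add: vec_eq_iff matrix_matrix_mult_def mat_def)

text \<open>Jacobi's formula. The product rule in the Leibniz sum gives one determinant for each
  row, with that row replaced by its derivative. The new row is a combination of the rows of
  \<open>A u\<close>, and Cramer's rule extracts the coefficient that counts.\<close>

lemma has_derivative_det:
  fixes A :: "'z::real_normed_vector \<Rightarrow> real^'m^'m"
  assumes D: "\<And>i j. ((\<lambda>u. A u $ i $ j) has_derivative A' i j) (at u)" and inv: "invertible (A u)"
  shows "((\<lambda>u. det (A u)) has_derivative
    (\<lambda>h. det (A u) * (\<Sum>i\<in>UNIV. \<Sum>j\<in>UNIV. A' i j h * matrix_inv (A u) $ j $ i))) (at u)"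
proof -
  let ?R = "\<lambda>h i. (\<chi> k. if k = i then (\<chi> j. A' i j h) else A u $ k) :: real^'m^'m"
  have "((\<lambda>u. det (A u)) has_derivative
    (\<lambda>h. \<Sum>p | p permutes UNIV. of_int (sign p) *
        (\<Sum>i\<in>UNIV. A' i (p i) h * (\<Prod>k\<in>UNIV - {i}. A u $ k $ p k)))) (at u)"
    unfolding det_def
    by (intro has_derivative_sum has_derivative_mult_right has_derivative_prod D)
  moreover have "(\<Sum>p | p permutes UNIV. of_int (sign p) *
        (\<Sum>i\<in>UNIV. A' i (p i) h * (\<Prod>k\<in>UNIV - {i}. A u $ k $ p k)))
     = det (A u) * (\<Sum>i\<in>UNIV. \<Sum>j\<in>UNIV. A' i j h * matrix_inv (A u) $ j $ i)" for h
  proof -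
    have prod: "A' i (p i) h * (\<Prod>k\<in>UNIV - {i}. A u $ k $ p k) = (\<Prod>k\<in>UNIV. ?R h i $ k $ p k)" for i p
      by (subst prod.remove[of UNIV i]) auto
    have "(\<Sum>p | p permutes UNIV. of_int (sign p) *
        (\<Sum>i\<in>UNIV. A' i (p i) h * (\<Prod>k\<in>UNIV - {i}. A u $ k $ p k))) = (\<Sum>i\<in>UNIV. det (?R h i))"
      unfolding prod sum_distrib_left det_def by (rule sum.swap)
    moreover have "det (?R h i) = det (A u) * (\<Sum>j\<in>UNIV. A' i j h * matrix_inv (A u) $ j $ i)" for i
    proof -
      \<comment> \<open>The coefficients of the differentiated row \<open>i\<close> with respect to
        the rows of \<open>A u\<close>: multiply that row by the inverse matrix from the
        right.\<close>
      define x where "x = (\<chi> k. \<Sum>j\<in>UNIV. A' i j h * matrix_inv (A u) $ j $ k)"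
      have "(\<Sum>k\<in>UNIV. x $ k * A u $ k $ l) = A' i l h" for l
      proof -
        have "(\<Sum>k\<in>UNIV. x $ k * A u $ k $ l)
            = (\<Sum>j\<in>UNIV. A' i j h * (\<Sum>k\<in>UNIV. matrix_inv (A u) $ j $ k * A u $ k $ l))"
          by (simp add: x_def sum_distrib_left sum_distrib_right mult.assoc) (rule sum.swap)
        then show ?thesis
          by (simp add: sum_matrix_inv[OF inv] if_distrib[of "\<lambda>c. _ * c"] cong: if_cong)
      qed
      then have row: "(\<Sum>k\<in>UNIV. x $ k *s row k (A u)) = (\<chi> j. A' i j h)"
        by (simp add: vec_eq_iff row_def)
      have "?R h i = (\<chi> k. if k = i then \<Sum>k\<in>UNIV. x $ k *s row k (A u) else row k (A u))"
        unfolding row by (simp add: vec_eq_iff row_def)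
      then show ?thesis
        using cramer_lemma_transpose[of i x "A u"] by (simp add: x_def mult.commute)
    qed
    ultimately show ?thesis by (simp only: sum_distrib_left)
  qed
  ultimately show ?thesis by simp
qed

lemma Ck_on_det [Ck_intros]:
  fixes A :: "'z::euclidean_space \<Rightarrow> real^'m^'m"
  assumes "open S" "\<And>i j. Ck_on k S (\<lambda>u. A u $ i $ j)"
  shows "Ck_on k S (\<lambda>u. det (A u))"
  unfolding det_def by (intro Ck_intros assms)

lemma Ck_on_matrix_inv [Ck_intros]:
  fixes A :: "'z::euclidean_space \<Rightarrow> real^'m^'m"
  assumes S: "open S" and A: "\<And>i j. Ck_on k S (\<lambda>u. A u $ i $ j)" and inv: "\<And>u. u \<in> S \<Longrightarrow> invertible (A u)"
  shows "Ck_on k S (\<lambda>u. matrix_inv (A u) $ i $ j)"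
proof -
  \<comment> \<open>\<open>A u\<close> with column \<open>i\<close> replaced by the basis vector
    \<open>j\<close>, as Cramer's rule for column \<open>j\<close> of the inverse demands; its
    entries inherit the smoothness of \<open>A\<close>.\<close>
  let ?C = "\<lambda>u. (\<chi> a b. if b = i then axis j 1 $ a else A u $ a $ b) :: real^'m^'m"
  have "matrix_inv (A u) $ i $ j = det (?C u) / det (A u)" if "u \<in> S" for u
  proof -
    have "A u *v (matrix_inv (A u) *v axis j 1) = axis j 1"
      using matrix_inv_inverse[OF inv[OF that]] by (simp add: matrix_vector_mul_assoc)
    then have "matrix_inv (A u) *v axis j 1
        = (\<chi> i. det (\<chi> a b. if b = i then axis j 1 $ a else A u $ a $ b) / det (A u))"
      using cramer invertible_det_nz inv[OF that] by blast
    then show ?thesis by (simp add: vec_eq_iff matrix_vector_mult_basis column_def)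
  qed
  moreover have "Ck_on k S (\<lambda>u. ?C u $ a $ b)" for a b
    by (cases "b = i") (auto intro: A Ck_on_const)
  then have "Ck_on k S (\<lambda>u. det (?C u) / det (A u))"
    using inv by (intro Ck_on_divide Ck_on_det S A) (auto simp: invertible_det_nz)
  ultimately show ?thesis
    using Ck_on_cong[OF S] by (metis (no_types, lifting))
qed

section \<open>Frames and dual frames\<close>

definition gram :: "('m::finite \<Rightarrow> 'b::euclidean_space) \<Rightarrow> real^'m^'m" where
  "gram a = (\<chi> i j. a i \<bullet> a j)"

text \<open>Independence of the family, not of the set of its values: a repeated vector is
  excluded.\<close>

definition frame :: "('m::finite \<Rightarrow> 'b::euclidean_space) \<Rightarrow> bool" where
  "frame a \<longleftrightarrow> (\<forall>w. (\<Sum>i\<in>UNIV. w i *\<^sub>R a i) = 0 \<longrightarrow> (\<forall>i. w i = 0))"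

text \<open>The reciprocal basis \<open>g\<^sup>i\<^sup>j a\<^sub>j\<close>, taken inside the span
  of the frame. Raising an index becomes an inner product with it.\<close>

definition dual :: "('m::finite \<Rightarrow> 'b::euclidean_space) \<Rightarrow> 'm \<Rightarrow> 'b" where
  "dual a i = (\<Sum>j\<in>UNIV. matrix_inv (gram a) $ i $ j *\<^sub>R a j)"

definition proj :: "('m::finite \<Rightarrow> 'b::euclidean_space) \<Rightarrow> 'b \<Rightarrow> 'b" where
  "proj a v = (\<Sum>i\<in>UNIV. (v \<bullet> dual a i) *\<^sub>R a i)"

definition vol :: "('m::finite \<Rightarrow> 'b::euclidean_space) \<Rightarrow> real" where
  "vol a = sqrt (det (gram a))"

lemma gram_nth [simp]: "gram a $ i $ j = a i \<bullet> a j"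
  by (simp add: gram_def)

lemma inner_gram: "w \<bullet> (gram a *v w) = (norm (\<Sum>i\<in>UNIV. w $ i *\<^sub>R a i))\<^sup>2"
  by (simp add: inner_vec_def matrix_vector_mult_def power2_norm_eq_inner inner_sum_left inner_sum_right
      sum_distrib_left mult_ac inner_commute)

lemma frame_gram_pos: "frame a \<Longrightarrow> w \<noteq> 0 \<Longrightarrow> w \<bullet> (gram a *v w) > 0"
  unfolding inner_gram frame_def by (auto simp: vec_eq_iff)

lemma invertible_pos_def:
  fixes A :: "real^'m^'m"
  assumes "\<And>w. w \<noteq> 0 \<Longrightarrow> w \<bullet> (A *v w) > 0"
  shows "invertible A"
  using assms unfolding invertible_left_inverse matrix_left_invertible_ker
  by (metis inner_zero_right less_irrefl)

text \<open>The determinant does not vanish along the segment from the identity to \<open>A\<close>.\<close>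

lemma det_pos_def:
  fixes A :: "real^'m^'m"
  assumes "\<And>w. w \<noteq> 0 \<Longrightarrow> w \<bullet> (A *v w) > 0"
  shows "det A > 0"
proof (rule ccontr)
  define B where "B t = (\<chi> i j. (1 - t) * mat 1 $ i $ j + t * A $ i $ j)" for t :: real
  have B: "B t = (1 - t) *\<^sub>R mat 1 + t *\<^sub>R A" for t
    by (simp add: B_def vec_eq_iff)
  assume "\<not> det A > 0"
  then have "det (B 1) \<le> 0" by (simp add: B)
  moreover have "det (B 0) = 1" by (simp add: B)
  moreover have "continuous_on {0..1} (\<lambda>t. det (B t))"
    unfolding B_def det_def by (auto intro!: continuous_intros)
  ultimately obtain t where t: "0 \<le> t" "t \<le> 1" "det (B t) = 0"
    using IVT2'[of "\<lambda>t. det (B t)" 1 0 0] by auto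
  have "w \<bullet> (B t *v w) > 0" if "w \<noteq> 0" for w
  proof -
    have "w \<bullet> (B t *v w) = (1 - t) * (w \<bullet> w) + t * (w \<bullet> (A *v w))"
      by (simp add: B algebra_simps scaleR_matrix_vector_assoc[symmetric])
    moreover have "0 \<le> (1 - t) * (w \<bullet> w)" "0 \<le> t * (w \<bullet> (A *v w))" "0 < t * (w \<bullet> (A *v w)) \<or> 0 < (1 - t) * (w \<bullet> w)"
      using t assms[OF that] that by (auto simp: zero_less_mult_iff)
    ultimately show ?thesis by linarith
  qed
  then show False using invertible_pos_def[of "B t"] t(3) by (auto simp: invertible_det_nz)
qed

lemma det_gram_pos: "frame a \<Longrightarrow> det (gram a) > 0"
  and invertible_gram: "frame a \<Longrightarrow> invertible (gram a)"
  and vol_pos: "frame a \<Longrightarrow> vol a > 0"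
  by (auto intro!: det_pos_def invertible_pos_def simp: frame_gram_pos vol_def)

lemma inner_dual_frame:
  assumes "frame a" shows "dual a i \<bullet> a j = (if i = j then 1 else 0)"
  using sum_matrix_inv(2)[OF invertible_gram[OF assms], of i j] by (simp add: dual_def inner_sum_left)

lemma dual_in_span: "dual a i \<in> span (range a)"
  unfolding dual_def by (auto intro!: span_sum span_scale intro: span_base)

lemma span_range_finite:
  fixes a :: "'m::finite \<Rightarrow> 'b::real_vector"
  assumes "v \<in> span (range a)" obtains w where "v = (\<Sum>i\<in>UNIV. w i *\<^sub>R a i)"
proof -
  from assms have "\<exists>w. v = (\<Sum>i\<in>UNIV. w i *\<^sub>R a i)"
  proof (induction rule: span_induct_alt)
    case base
    show ?case by (rule exI[of _ "\<lambda>_. 0"]) simp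
  next
    case (step c x y)
    then obtain j w where "x = a j" "y = (\<Sum>i\<in>UNIV. w i *\<^sub>R a i)" by auto
    then have "c *\<^sub>R x + y = (\<Sum>i\<in>UNIV. (w i + (if i = j then c else 0)) *\<^sub>R a i)"
      by (simp add: algebra_simps sum.distrib if_distrib[of "\<lambda>c. c *\<^sub>R _"] cong: if_cong)
    then show ?case by (rule exI[of _ "\<lambda>i. w i + (if i = j then c else 0)"])
  qed
  then show ?thesis using that by blast
qed

lemma span_dual_expansion:
  assumes "frame a" "v \<in> span (range a)"
  shows "v = (\<Sum>i\<in>UNIV. (v \<bullet> dual a i) *\<^sub>R a i)"
proof -
  obtain w where w: "v = (\<Sum>i\<in>UNIV. w i *\<^sub>R a i)"
    using span_range_finite[OF assms(2)] by blast
  have "v \<bullet> dual a i = w i" for i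
    unfolding w by (subst inner_commute)
      (simp add: inner_sum_right inner_dual_frame[OF assms(1)] if_distrib[of "\<lambda>c. _ * c"] cong: if_cong)
  then show ?thesis using w by simp
qed

lemma span_eqI:
  assumes "frame a" "v \<in> span (range a)" "w \<in> span (range a)" "\<And>i. v \<bullet> a i = w \<bullet> a i"
  shows "v = w"
proof -
  have "v \<bullet> dual a i = w \<bullet> dual a i" for i
    using assms(4) by (simp add: dual_def inner_sum_right)
  then show ?thesis
    using span_dual_expansion[OF assms(1,2)] span_dual_expansion[OF assms(1,3)] by simp
qed

text \<open>Expand one of the two dual vectors and use the pairing of the frame with its dual. From
  here on inverse metrics are replaced by inner products of dual vectors, which are easier to
  differentiate.\<close>

lemma matrix_inv_gram:
  assumes "frame a" shows "matrix_inv (gram a) $ i $ j = dual a i \<bullet> dual a j"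
proof -
  have "dual a i \<bullet> dual a j = (\<Sum>k\<in>UNIV. matrix_inv (gram a) $ i $ k * (a k \<bullet> dual a j))"
    unfolding dual_def[of a i] by (simp add: inner_sum_left)
  then show ?thesis
    by (simp add: inner_commute[of "a _"] inner_dual_frame[OF assms] if_distrib[of "\<lambda>c. _ * c"] cong: if_cong)
qed

lemma dual_eq: "frame a \<Longrightarrow> dual a i = (\<Sum>j\<in>UNIV. (dual a i \<bullet> dual a j) *\<^sub>R a j)"
  by (rule span_dual_expansion[OF _ dual_in_span])

lemma span_frame_expansion:
  assumes "frame a" "v \<in> span (range a)"
  shows "v = (\<Sum>i\<in>UNIV. (v \<bullet> a i) *\<^sub>R dual a i)"
  using assms by (intro span_eqI[OF assms])
    (auto intro!: span_sum span_scale simp: dual_in_span inner_sum_left inner_dual_frame if_distrib[of "\<lambda>c. _ * c"] cong: if_cong)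

lemma proj_in_span: "proj a v \<in> span (range a)"
  unfolding proj_def by (auto intro!: span_sum span_scale intro: span_base)

lemma proj_inner_frame: "frame a \<Longrightarrow> proj a v \<bullet> a j = v \<bullet> a j"
proof -
  assume a: "frame a"
  have "proj a v \<bullet> a j = v \<bullet> (\<Sum>i\<in>UNIV. (a j \<bullet> a i) *\<^sub>R dual a i)"
    by (simp add: proj_def inner_sum_left inner_sum_right inner_commute mult.commute)
  also have "\<dots> = v \<bullet> a j"
    using span_frame_expansion[OF a, of "a j"] by (simp add: span_base)
  finally show ?thesis .
qed

lemma proj_inner_span:
  assumes "frame a" "w \<in> span (range a)" shows "proj a v \<bullet> w = v \<bullet> w"
  by (subst (1 2) span_dual_expansion[OF assms])
    (simp add: inner_sum_right proj_inner_frame[OF assms(1)])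

lemma proj_eq_dual: "frame a \<Longrightarrow> proj a v = (\<Sum>i\<in>UNIV. (v \<bullet> a i) *\<^sub>R dual a i)"
  using span_frame_expansion[OF _ proj_in_span, of a v] proj_inner_frame[of a v] by simp

text \<open>Evaluates the definite description behind \<open>tan_part\<close>;
  \<open>the_components\<close> does the same for \<open>tan_comp\<close>.\<close>

lemma proj_unique:
  assumes "frame a"
  shows "(THE w. w \<in> span (range a) \<and> (\<forall>z\<in>span (range a). orthogonal (v - w) z)) = proj a v"
proof (rule the_equality)
  show "proj a v \<in> span (range a) \<and> (\<forall>z\<in>span (range a). orthogonal (v - proj a v) z)"
    using proj_in_span proj_inner_span[OF assms] by (auto simp: orthogonal_def inner_diff_left)
  fix w assume w: "w \<in> span (range a) \<and> (\<forall>z\<in>span (range a). orthogonal (v - w) z)"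
  then have "w \<bullet> a i = proj a v \<bullet> a i" for i
    using proj_inner_frame[OF assms, of v i] span_base[of "a i" "range a"]
    by (auto simp: orthogonal_def inner_diff_left)
  then show "w = proj a v" using span_eqI[OF assms] w proj_in_span by blast
qed

lemma the_components:
  fixes a :: "'m::finite \<Rightarrow> 'b::euclidean_space"
  assumes "frame a" "v \<in> span (range a)"
  shows "(THE w::real^'m. (\<Sum>i\<in>UNIV. w $ i *\<^sub>R a i) = v) = (\<chi> i. v \<bullet> dual a i)"
proof (rule the_equality)
  show "(\<Sum>i\<in>UNIV. (\<chi> i. v \<bullet> dual a i) $ i *\<^sub>R a i) = v"
    using span_dual_expansion[OF assms] by simp
  fix w :: "real^'m" assume "(\<Sum>i\<in>UNIV. w $ i *\<^sub>R a i) = v"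
  then have "v \<bullet> dual a i = w $ i" for i
    by (auto simp: inner_sum_left inner_commute[of "a _"] inner_dual_frame[OF assms(1)] if_distrib[of "\<lambda>c. _ * c"] cong: if_cong)
  then show "w = (\<chi> i. v \<bullet> dual a i)" by (simp add: vec_eq_iff)
qed

lemma normal_dual: "(\<And>j. n \<bullet> a j = 0) \<Longrightarrow> n \<bullet> dual a i = 0"
  by (simp add: dual_def inner_sum_right)

section \<open>Derivatives of the volume and of the dual of a varying frame\<close>

text \<open>Jacobi's formula for the Gram matrix: by symmetry each derivative occurs twice, and this
  factor 2 cancels the 1/2 from the square root. It serves for space derivatives in the divergence
  and for time derivatives in the variation.\<close>

lemma has_derivative_vol:
  fixes a :: "'m::finite \<Rightarrow> 'z::real_normed_vector \<Rightarrow> 'b::euclidean_space"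
  assumes D: "\<And>i. (a i has_derivative a' i) (at u)" and fr: "frame (\<lambda>i. a i u)"
  shows "((\<lambda>u. vol (\<lambda>i. a i u)) has_derivative
     (\<lambda>h. vol (\<lambda>i. a i u) * (\<Sum>i\<in>UNIV. a' i h \<bullet> dual (\<lambda>i. a i u) i))) (at u)"
proof -
  let ?G = "\<lambda>u. gram (\<lambda>i. a i u)" let ?e = "dual (\<lambda>i. a i u)"
  have "((\<lambda>u. ?G u $ i $ j) has_derivative (\<lambda>h. a i u \<bullet> a' j h + a' i h \<bullet> a j u)) (at u)" for i j
    by (simp add: has_derivative_inner[OF D D])
  from has_derivative_det[OF this invertible_gram[OF fr]]
  have det: "((\<lambda>u. det (?G u)) has_derivative (\<lambda>h. det (?G u) * (\<Sum>i\<in>UNIV. \<Sum>j\<in>UNIV.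
       (a i u \<bullet> a' j h + a' i h \<bullet> a j u) * (?e j \<bullet> ?e i)))) (at u)"
    by (simp add: matrix_inv_gram[OF fr])
  have sums: "(\<Sum>i\<in>UNIV. \<Sum>j\<in>UNIV. (a i u \<bullet> a' j h + a' i h \<bullet> a j u) * (?e j \<bullet> ?e i))
     = 2 * (\<Sum>i\<in>UNIV. a' i h \<bullet> ?e i)" for h
  proof -
    have e: "v \<bullet> ?e i = (\<Sum>j\<in>UNIV. (v \<bullet> a j u) * (?e j \<bullet> ?e i))" for v i
      by (subst dual_eq[OF fr]) (simp add: inner_sum_right mult.commute inner_commute)
    have "(\<Sum>i\<in>UNIV. \<Sum>j\<in>UNIV. (a i u \<bullet> a' j h) * (?e j \<bullet> ?e i)) = (\<Sum>j\<in>UNIV. a' j h \<bullet> ?e j)"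
      by (subst sum.swap) (simp add: e[of "a' _ h"] inner_commute)
    then show ?thesis by (simp add: distrib_right sum.distrib e[of "a' _ h", symmetric])
  qed
  have pos: "det (?G u) > 0" by (rule det_gram_pos[OF fr])
  have "((\<lambda>u. sqrt (det (?G u))) has_derivative (\<lambda>h. (det (?G u) * (2 * (\<Sum>i\<in>UNIV. a' i h \<bullet> ?e i)))
      * (inverse (sqrt (det (?G u))) / 2))) (at u)"
    using DERIV_compose_FDERIV[OF DERIV_real_sqrt[OF pos] det[unfolded sums]] by simp
  moreover have "det (?G u) = sqrt (det (?G u)) * sqrt (det (?G u))" using pos by simp
  then have "(det (?G u) * (2 * s)) * (inverse (sqrt (det (?G u))) / 2) = sqrt (det (?G u)) * s" for s
    using pos by (simp add: field_simps)
  ultimately show ?thesis by (simp only: vol_def)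
qed

lemma Ck_on_vol [Ck_intros]:
  assumes "open S" "\<And>i. Ck_on k S (a i)" "\<And>u. u \<in> S \<Longrightarrow> frame (\<lambda>i. a i u)"
  shows "Ck_on k S (\<lambda>u. vol (\<lambda>i. a i u))"
  unfolding vol_def using assms
  by (intro Ck_on_sqrt Ck_on_det det_gram_pos) (auto intro: Ck_on_inner)

lemma Ck_on_dual [Ck_intros]:
  assumes "open S" "\<And>i. Ck_on k S (a i)" "\<And>u. u \<in> S \<Longrightarrow> frame (\<lambda>i. a i u)"
  shows "Ck_on k S (\<lambda>u. dual (\<lambda>i. a i u) i)"
  unfolding dual_def using assms
  by (intro Ck_on_sum Ck_on_scaleR Ck_on_matrix_inv invertible_gram) (auto intro: Ck_on_inner)

text \<open>Differentiate the pairing of the dual vector with \<open>a j\<close>, which is constant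
  on \<open>S\<close>.\<close>

lemma dual_derivative_tangent:
  assumes S: "open S" "u \<in> S" and fr: "\<And>u. u \<in> S \<Longrightarrow> frame (\<lambda>i. a i u)"
    and a: "(a j has_derivative a') (at u)" and e: "((\<lambda>u. dual (\<lambda>i. a i u) i) has_derivative e') (at u)"
  shows "e' h \<bullet> a j u = - (dual (\<lambda>i. a i u) i \<bullet> a' h)"
proof -
  have "((\<lambda>u. dual (\<lambda>i. a i u) i \<bullet> a j u) has_derivative
     (\<lambda>h. dual (\<lambda>i. a i u) i \<bullet> a' h + e' h \<bullet> a j u)) (at u)"
    by (rule has_derivative_inner[OF e a])
  moreover have "((\<lambda>u. dual (\<lambda>i. a i u) i \<bullet> a j u) has_derivative (\<lambda>h. 0)) (at u)"
    by (rule has_derivative_transform_within_open[OF has_derivative_const[of "if i = j then 1 else 0"] S])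
       (simp add: inner_dual_frame[OF fr])
  ultimately have "(\<lambda>h. dual (\<lambda>i. a i u) i \<bullet> a' h + e' h \<bullet> a j u) = (\<lambda>h. 0)"
    by (rule has_derivative_unique)
  then show ?thesis by (metis add.commute add_eq_0_iff2)
qed

text \<open>Differentiate the expansion \<open>e\<^sup>i = g\<^sup>i\<^sup>j a\<^sub>j\<close>. The
  derivatives of the coefficients stand in front of frame vectors and vanish against the normal
  vector \<open>n\<close>.\<close>

lemma dual_derivative_normal:
  fixes a :: "'m::finite \<Rightarrow> 'z::real_normed_vector \<Rightarrow> 'b::euclidean_space"
  assumes S: "open S" "u \<in> S" and fr: "\<And>u. u \<in> S \<Longrightarrow> frame (\<lambda>i. a i u)"
    and a: "\<And>j. (a j has_derivative a' j) (at u)"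
    and e: "\<And>i. ((\<lambda>u. dual (\<lambda>i. a i u) i) has_derivative e' i) (at u)"
    and n: "\<And>j. n \<bullet> a j u = 0"
  shows "e' i h \<bullet> n = (\<Sum>j\<in>UNIV. (dual (\<lambda>i. a i u) i \<bullet> dual (\<lambda>i. a i u) j) * (a' j h \<bullet> n))"
proof -
  let ?e = "\<lambda>i u. dual (\<lambda>i. a i u) i"
  let ?d = "\<lambda>h j. ?e i u \<bullet> e' j h + e' i h \<bullet> ?e j u"
  have "((\<lambda>u. \<Sum>j\<in>UNIV. (?e i u \<bullet> ?e j u) *\<^sub>R a j u) has_derivative
     (\<lambda>h. \<Sum>j\<in>UNIV. (?e i u \<bullet> ?e j u) *\<^sub>R a' j h + ?d h j *\<^sub>R a j u)) (at u)"
    by (intro has_derivative_sum has_derivative_scaleR has_derivative_inner a e)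
  from has_derivative_transform_within_open[OF this S, of "?e i"] dual_eq[OF fr, of _ i, symmetric]
  have "(?e i has_derivative (\<lambda>h. \<Sum>j\<in>UNIV. (?e i u \<bullet> ?e j u) *\<^sub>R a' j h + ?d h j *\<^sub>R a j u)) (at u)"
    by simp
  from has_derivative_unique[OF e[of i] this]
  have "e' i h = (\<Sum>j\<in>UNIV. (?e i u \<bullet> ?e j u) *\<^sub>R a' j h + ?d h j *\<^sub>R a j u)"
    by (rule fun_cong)
  then have "e' i h \<bullet> n = (\<Sum>j\<in>UNIV. (?e i u \<bullet> ?e j u) *\<^sub>R a' j h + ?d h j *\<^sub>R a j u) \<bullet> n"
    by (rule arg_cong)
  then show ?thesis
    using n by (simp add: inner_sum_left inner_add_left inner_commute[of "a _ u"])
qed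

section \<open>Change of frame\<close>

context
  fixes a b :: "'m::finite \<Rightarrow> 'b::euclidean_space" and J :: "real^'m^'m"
  assumes J: "invertible J" and b: "\<And>i. b i = (\<Sum>k\<in>UNIV. J $ k $ i *\<^sub>R a k)" and a: "frame a"
begin

lemma gram_change: "gram b = transpose J ** gram a ** J"
proof -
  have "b i \<bullet> b j = (\<Sum>l\<in>UNIV. (\<Sum>k\<in>UNIV. J $ k $ i * (a k \<bullet> a l)) * J $ l $ j)" for i j
    by (simp add: b inner_sum_left inner_sum_right sum_distrib_left sum_distrib_right mult_ac)
  then show ?thesis
    by (simp add: vec_eq_iff matrix_matrix_mult_def transpose_def)
qed

lemma vol_change: "vol b = \<bar>det J\<bar> * vol a"
proof -
  have "det (gram b) = (det J)\<^sup>2 * det (gram a)"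
    by (simp add: gram_change det_mul power2_eq_square)
  then show ?thesis by (simp add: vol_def real_sqrt_mult)
qed

lemma span_change: "span (range b) = span (range a)"
proof
  show "span (range b) \<subseteq> span (range a)"
    by (rule span_minimal) (auto simp: b intro!: span_sum span_scale intro: span_base)
  have "(\<Sum>i\<in>UNIV. matrix_inv J $ i $ k *\<^sub>R b i) = (\<Sum>l\<in>UNIV. (\<Sum>i\<in>UNIV. J $ l $ i * matrix_inv J $ i $ k) *\<^sub>R a l)" for k
    by (simp add: b scaleR_sum_right scaleR_sum_left mult.commute) (rule sum.swap)
  then have "a k = (\<Sum>i\<in>UNIV. matrix_inv J $ i $ k *\<^sub>R b i)" for k
    by (simp add: sum_matrix_inv[OF J] if_distrib[of "\<lambda>c. c *\<^sub>R _"] cong: if_cong)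
  then show "span (range a) \<subseteq> span (range b)"
    by (intro span_minimal) (auto intro!: span_sum span_scale intro: span_base)
qed

lemma frame_change: "frame b"
  unfolding frame_def
proof (intro allI impI)
  fix w i assume 0: "(\<Sum>i\<in>UNIV. w i *\<^sub>R b i) = 0"
  have "(\<Sum>i\<in>UNIV. w i *\<^sub>R b i) = (\<Sum>k\<in>UNIV. (\<Sum>i\<in>UNIV. J $ k $ i * w i) *\<^sub>R a k)"
    by (simp add: b scaleR_sum_right scaleR_sum_left mult.commute) (rule sum.swap)
  with 0 a have "J *v (\<chi> i. w i) = 0"
    by (auto simp: frame_def vec_eq_iff matrix_vector_mult_def)
  moreover have "\<exists>B. B ** J = mat 1" using matrix_inv_inverse(2)[OF J] by blast
  ultimately have "(\<chi> i. w i) = 0" using matrix_left_invertible_ker by blast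
  then show "w i = 0" by (simp add: vec_eq_iff)
qed

lemma dual_change: "dual b i = (\<Sum>k\<in>UNIV. matrix_inv J $ i $ k *\<^sub>R dual a k)"
proof (rule span_eqI[OF frame_change])
  show "dual b i \<in> span (range b)" by (rule dual_in_span)
  show "(\<Sum>k\<in>UNIV. matrix_inv J $ i $ k *\<^sub>R dual a k) \<in> span (range b)"
    unfolding span_change by (intro span_sum span_scale dual_in_span)
  have "dual a k \<bullet> b j = J $ k $ j" for k j
    by (simp add: b inner_sum_right inner_dual_frame[OF a] if_distrib[of "\<lambda>c. _ * c"] cong: if_cong)
  then show "dual b i \<bullet> b j = (\<Sum>k\<in>UNIV. matrix_inv J $ i $ k *\<^sub>R dual a k) \<bullet> b j" for j
    by (simp add: inner_dual_frame[OF frame_change] inner_sum_left sum_matrix_inv[OF J])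
qed

text \<open>The quantities \<open>z k\<close> transform with \<open>J\<close> and the dual frame
  with its inverse, so the contraction is independent of the frame. The general \<open>B\<close>
  covers the divergence (inner product) and the gradient (scalar multiplication).\<close>

lemma trace_change:
  assumes "bounded_bilinear (B :: 'c::real_normed_vector \<Rightarrow> 'b \<Rightarrow> 'd::real_normed_vector)"
  shows "(\<Sum>i\<in>UNIV. B (\<Sum>k\<in>UNIV. J $ k $ i *\<^sub>R z k) (dual b i)) = (\<Sum>k\<in>UNIV. B (z k) (dual a k))"
proof -
  interpret bounded_bilinear B by fact
  have "(\<Sum>i\<in>UNIV. B (\<Sum>k\<in>UNIV. J $ k $ i *\<^sub>R z k) (dual b i))
     = (\<Sum>i\<in>UNIV. \<Sum>k\<in>UNIV. \<Sum>l\<in>UNIV. (J $ k $ i * matrix_inv J $ i $ l) *\<^sub>R B (z k) (dual a l))"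
    by (simp add: dual_change sum_left sum_right scaleR_left scaleR_right scaleR_sum_right mult.commute)
       (intro sum.cong refl sum.swap)
  also have "\<dots> = (\<Sum>k\<in>UNIV. \<Sum>l\<in>UNIV. \<Sum>i\<in>UNIV. (J $ k $ i * matrix_inv J $ i $ l) *\<^sub>R B (z k) (dual a l))"
    by (subst sum.swap) (intro sum.cong refl sum.swap)
  also have "\<dots> = (\<Sum>k\<in>UNIV. B (z k) (dual a k))"
    by (simp add: scaleR_sum_left[symmetric] sum_matrix_inv[OF J] if_distrib[of "\<lambda>c. c *\<^sub>R _"] cong: if_cong)
  finally show ?thesis .
qed

end

section \<open>Charts\<close>

lemma matrix_nth_frechet: "matrix f $ k $ i = f (axis i 1) $ k"
  by (simp add: matrix_def)

locale atlas =
  fixes \<A> :: "('a::{t2_space, second_countable_topology}, 'm::finite) chart set"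
  assumes smooth_atlas: "smooth_atlas \<A>"
begin

lemma chart_open:
  assumes "c \<in> \<A>"
  shows "open (chart_dom c)" "open (coord_range c)" "homeomorphism (chart_dom c) (coord_range c) (coord c) (param c)"
  using smooth_atlas assms by (auto simp: smooth_atlas_def)

lemma param_coord [simp]: "c \<in> \<A> \<Longrightarrow> q \<in> chart_dom c \<Longrightarrow> param c (coord c q) = q"
  and coord_param [simp]: "c \<in> \<A> \<Longrightarrow> u \<in> coord_range c \<Longrightarrow> coord c (param c u) = u"
  and param_in_dom [simp]: "c \<in> \<A> \<Longrightarrow> u \<in> coord_range c \<Longrightarrow> param c u \<in> chart_dom c"
  and coord_continuous: "c \<in> \<A> \<Longrightarrow> continuous_on (chart_dom c) (coord c)"
  and param_continuous: "c \<in> \<A> \<Longrightarrow> continuous_on (coord_range c) (param c)"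
  using chart_open(3)[of c] by (auto simp: homeomorphism_def)

lemma chart_exists: obtains c where "c \<in> \<A>" "q \<in> chart_dom c"
proof -
  have "q \<in> (\<Union>c\<in>\<A>. chart_dom c)" using smooth_atlas by (simp add: smooth_atlas_def)
  then show ?thesis using that by blast
qed

lemma chart_at: "chart_at \<A> q \<in> \<A>" "q \<in> chart_dom (chart_at \<A> q)"
proof -
  have "\<exists>c. c \<in> \<A> \<and> q \<in> chart_dom c" using chart_exists[of q] by metis
  from someI_ex[OF this] show "chart_at \<A> q \<in> \<A>" "q \<in> chart_dom (chart_at \<A> q)"
    by (simp_all add: chart_at_def)
qed

lemma open_coord_image:
  assumes "c \<in> \<A>" "open W" "W \<subseteq> chart_dom c" shows "open (coord c ` W)"
proof -
  have "coord c ` W = coord_range c \<inter> param c -` W"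
    using assms by (force simp: image_iff)
  then show ?thesis
    using continuous_open_preimage[OF param_continuous chart_open(2) assms(2)] assms(1) by simp
qed

lemma open_overlap: "c \<in> \<A> \<Longrightarrow> d \<in> \<A> \<Longrightarrow> open (coord c ` (chart_dom c \<inter> chart_dom d))"
  by (intro open_coord_image) (auto intro!: open_Int chart_open)

lemma continuous_on_manifold:
  assumes "\<And>c. c \<in> \<A> \<Longrightarrow> continuous_on (coord_range c) (\<lambda>u. g (param c u))"
  shows "continuous_on UNIV g"
proof -
  have "continuous_on (chart_dom c) g" if c: "c \<in> \<A>" for c
    using continuous_on_compose2[OF assms[OF c] coord_continuous[OF c]] c
    by (auto cong: continuous_on_cong_simp)
  then have "continuous_on (\<Union>c\<in>\<A>. chart_dom c) g"
    using chart_open(1) by (intro continuous_on_open_UN) auto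
  moreover have "(\<Union>c\<in>\<A>. chart_dom c) = UNIV"
    using smooth_atlas by (simp add: smooth_atlas_def)
  ultimately show ?thesis by simp
qed

text \<open>The derivative of the coordinates of \<open>c\<close> with respect to those of
  \<open>d\<close>; column \<open>i\<close> holds the components in \<open>c\<close> of the
  coordinate field \<open>i\<close> of \<open>d\<close>.\<close>

definition jac :: "('a, 'm) chart \<Rightarrow> ('a, 'm) chart \<Rightarrow> 'a \<Rightarrow> real^'m^'m" where
  "jac c d q = matrix (frechet_derivative (coord c \<circ> param d) (at (coord d q)))"

lemma transition_Ck:
  "c \<in> \<A> \<Longrightarrow> d \<in> \<A> \<Longrightarrow> Ck_on k (coord d ` (chart_dom d \<inter> chart_dom c)) (coord c \<circ> param d)"
  using smooth_atlas by (auto simp: smooth_atlas_def smooth_on_def)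

lemma transition_derivative:
  assumes "c \<in> \<A>" "d \<in> \<A>" "q \<in> chart_dom c" "q \<in> chart_dom d"
  shows "((coord c \<circ> param d) has_derivative (*v) (jac c d q)) (at (coord d q))"
proof -
  have *: "((coord c \<circ> param d) has_derivative frechet_derivative (coord c \<circ> param d) (at (coord d q))) (at (coord d q))"
    using Ck_on_SucD[OF transition_Ck[OF assms(1,2), of "Suc 0"]] assms by blast
  from has_derivative_linear[OF this] have "(*v) (jac c d q) = frechet_derivative (coord c \<circ> param d) (at (coord d q))"
    by (simp add: jac_def fun_eq_iff matrix_works linear_matrix_vector_mul_eq)
  then show ?thesis using * by simp
qed

lemma has_derivative_chart_change:
  fixes f :: "'a \<Rightarrow> 'b::euclidean_space"
  assumes cd: "c \<in> \<A>" "d \<in> \<A>" and q: "q \<in> chart_dom c" "q \<in> chart_dom d"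
    and f: "((f \<circ> param c) has_derivative f') (at (coord c q))"
  shows "((f \<circ> param d) has_derivative (\<lambda>h. f' (jac c d q *v h))) (at (coord d q))"
proof -
  have "((f \<circ> param c) \<circ> (coord c \<circ> param d) has_derivative f' \<circ> (*v) (jac c d q)) (at (coord d q))"
    using cd q f by (intro diff_chain_at transition_derivative) auto
  then have "((f \<circ> param d) has_derivative f' \<circ> (*v) (jac c d q)) (at (coord d q))"
    by (rule has_derivative_transform_within_open[OF _ open_overlap[OF cd(2,1)]])
       (use cd q in auto)
  then show ?thesis by (simp add: o_def)
qed

text \<open>The chain rule for the identity of the coordinates of \<open>d\<close>, passed through
  \<open>c\<close>, yields a left inverse.\<close>

lemma invertible_jac:
  assumes "c \<in> \<A>" "d \<in> \<A>" "q \<in> chart_dom c" "q \<in> chart_dom d"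
  shows "invertible (jac c d q)"
proof -
  have "((coord d \<circ> param d) has_derivative (\<lambda>h. jac d c q *v (jac c d q *v h))) (at (coord d q))"
    by (rule has_derivative_chart_change[OF assms transition_derivative[OF assms(2,1,4,3)]])
  moreover have "((coord d \<circ> param d) has_derivative (\<lambda>h. h)) (at (coord d q))"
    by (rule has_derivative_transform_within_open[OF has_derivative_ident chart_open(2)[OF assms(2)]])
       (use assms in auto)
  ultimately have "(\<lambda>h. jac d c q *v (jac c d q *v h)) = (\<lambda>h. h)"
    by (rule has_derivative_unique)
  then have "jac d c q ** jac c d q = mat 1"
    by (simp add: matrix_eq matrix_vector_mul_assoc fun_eq_iff)
  then show ?thesis using invertible_left_inverse by blast
qed

lemma pd_chart_change:
  fixes f :: "'a \<Rightarrow> 'b::euclidean_space"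
  assumes "c \<in> \<A>" "d \<in> \<A>" "q \<in> chart_dom c" "q \<in> chart_dom d" "(f \<circ> param c) differentiable (at (coord c q))"
  shows "pd d i f q = (\<Sum>k\<in>UNIV. jac c d q $ k $ i *\<^sub>R pd c k f q)"
proof -
  let ?D = "frechet_derivative (f \<circ> param c) (at (coord c q))"
  have D: "((f \<circ> param c) has_derivative ?D) (at (coord c q))"
    using assms(5) by (simp add: frechet_derivative_works)
  interpret D: linear ?D by (rule has_derivative_linear[OF D])
  have "pd d i f q = ?D (jac c d q *v axis i 1)"
    unfolding pd_def frechet_derivative_at[OF has_derivative_chart_change[OF assms(1-4) D], symmetric] ..
  also have "jac c d q *v axis i 1 = (\<Sum>k\<in>UNIV. jac c d q $ k $ i *\<^sub>R axis k 1)"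
  proof -
    have "(\<Sum>k\<in>UNIV. jac c d q $ k $ i *\<^sub>R axis k 1) $ l = jac c d q $ l $ i" for l
      by (simp add: axis_def if_distrib cong: if_cong)
    then show ?thesis by (simp add: matrix_vector_mult_basis column_def vec_eq_iff)
  qed
  finally show ?thesis by (simp only: D.sum D.scaleR pd_def)
qed

lemma pd_param: "c \<in> \<A> \<Longrightarrow> u \<in> coord_range c \<Longrightarrow>
    pd c i f (param c u) = frechet_derivative (f \<circ> param c) (at u) (axis i 1)"
  by (simp add: pd_def)

lemma pdI:
  assumes "((f \<circ> param c) has_derivative D) (at (coord c q))" shows "pd c i f q = D (axis i 1)"
  unfolding pd_def by (simp add: frechet_derivative_at[OF assms, symmetric])

text \<open>Near \<open>q\<close> both functions admit the same derivatives, so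
  \<open>frechet_derivative\<close> makes the same choice for both, even at points where no
  derivative exists.\<close>

lemma pd_cong:
  assumes "c \<in> \<A>" "q \<in> W" "W \<subseteq> chart_dom c" "open W" "\<And>r. r \<in> W \<Longrightarrow> f r = g r"
  shows "pd c i f q = pd c i g q"
proof -
  have eq: "(f \<circ> param c) u = (g \<circ> param c) u" if "u \<in> coord c ` W" for u
    using that assms by auto
  have "coord c q \<in> coord c ` W" using assms(2) by blast
  note transform = has_derivative_transform_within_open[OF _ open_coord_image[OF assms(1,4,3)] this]
  have "((f \<circ> param c) has_derivative D) (at (coord c q)) = ((g \<circ> param c) has_derivative D) (at (coord c q))" for D
    using transform[of "f \<circ> param c" D UNIV "g \<circ> param c"] transform[of "g \<circ> param c" D UNIV "f \<circ> param c"] eq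
    by auto
  then show ?thesis by (simp add: pd_def frechet_derivative_def)
qed

lemma Ck_pd:
  assumes "c \<in> \<A>" "Ck_on (Suc k) (coord_range c) (f \<circ> param c)"
  shows "Ck_on k (coord_range c) (pd c i f \<circ> param c)"
  using Ck_on_frechet[OF assms(2)] Ck_on_cong[OF chart_open(2)[OF assms(1)], of "pd c i f \<circ> param c"
      "\<lambda>u. frechet_derivative (f \<circ> param c) (at u) (axis i 1)"] assms(1) pd_param by fastforce

lemma pd_commute:
  assumes "c \<in> \<A>" "q \<in> chart_dom c" "Ck_on 2 (coord_range c) (f \<circ> param c)"
  shows "pd c i (pd c j f) q = pd c j (pd c i f) q"
proof -
  have "pd c i (pd c j f) q = frechet_derivative (\<lambda>u. frechet_derivative (f \<circ> param c) (at u) (axis j 1)) (at (coord c q)) (axis i 1)" for i j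
  proof -
    have "((\<lambda>u. frechet_derivative (f \<circ> param c) (at u) (axis j 1)) has_derivative
      frechet_derivative (\<lambda>u. frechet_derivative (f \<circ> param c) (at u) (axis j 1)) (at (coord c q))) (at (coord c q))"
      using Ck_on_SucD[OF Ck_on_frechet, of 0 "coord_range c" "f \<circ> param c" "coord c q"] assms
      by (auto simp: numeral_2_eq_2)
    from has_derivative_transform_within_open[OF this chart_open(2)[OF assms(1)], of "pd c j f \<circ> param c"]
    have "((pd c j f \<circ> param c) has_derivative
      frechet_derivative (\<lambda>u. frechet_derivative (f \<circ> param c) (at u) (axis j 1)) (at (coord c q))) (at (coord c q))"
      using pd_param[OF assms(1), of _ j f] assms(2) by simp
    then show ?thesis by (rule pdI)
  qed
  then show ?thesis
    using frechet_derivative_commute[OF assms(3) chart_open(2)[OF assms(1)]] assms by auto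
qed

end

text \<open>
  With \<open>e\<^sup>i = g\<^sup>i\<^sup>j \<partial>\<^sub>j y\<close> the dual frame, the divergence of \<open>vol \<langle>Y, e\<^sup>i\<rangle>\<close> is read off by pairing
  \<open>\<Sum>\<^sub>i (\<Sum>\<^sub>k \<langle>\<partial>\<^sub>i\<partial>\<^sub>k y, e\<^sup>k\<rangle>) e\<^sup>i + \<partial>\<^sub>i e\<^sup>i\<close> with tangent and with normal vectors: the former
  vanish since \<open>\<langle>e\<^sup>i, \<partial>\<^sub>j y\<rangle>\<close> is constant, and the latter give the mean curvature.
\<close>

lemma divergence_identity:
  fixes y Y :: "real^'m::finite \<Rightarrow> 'b::euclidean_space"
  defines "a \<equiv> \<lambda>i u. frechet_derivative y (at u) (axis i 1)"
  defines "e \<equiv> \<lambda>i u. dual (\<lambda>i. a i u) i"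
  assumes U: "open U" "u \<in> U" and y: "Ck_on 2 U y" and Y: "(Y has_derivative Y') (at u)"
    and fr: "\<And>u. u \<in> U \<Longrightarrow> frame (\<lambda>i. a i u)"
    and Phi: "\<And>i. (Phi i has_derivative Phi' i) (at u)"
    "\<And>i u. u \<in> U \<Longrightarrow> Phi i u = vol (\<lambda>i. a i u) * (Y u \<bullet> e i u)"
  shows "(\<Sum>i\<in>UNIV. Phi' i (axis i 1)) = vol (\<lambda>i. a i u) *
     ((\<Sum>i\<in>UNIV. Y' (axis i 1) \<bullet> e i u) +
      (\<Sum>i\<in>UNIV. \<Sum>j\<in>UNIV. (e i u \<bullet> e j u) *\<^sub>R
         (frechet_derivative (a j) (at u) (axis i 1) - proj (\<lambda>i. a i u) (frechet_derivative (a j) (at u) (axis i 1)))) \<bullet> Y u)"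
proof -
  let ?a = "\<lambda>i. a i u" let ?v = "vol ?a" let ?P = "proj ?a"
  define T where "T i j = frechet_derivative (a j) (at u) (axis i 1)" for i j
  have y2: "Ck_on (Suc (Suc 0)) U y" using y by (simp add: numeral_2_eq_2)
  have a1: "Ck_on (Suc 0) U (a j)" for j
    unfolding a_def by (rule Ck_on_frechet[OF y2])
  have aD: "(a j has_derivative frechet_derivative (a j) (at u)) (at u)" for j
    by (rule Ck_on_SucD[OF a1 U(2)])
  have e1: "Ck_on (Suc 0) U (e i)" for i
    unfolding e_def by (rule Ck_on_dual[OF U(1) a1 fr])
  define e' where "e' i = frechet_derivative (e i) (at u)" for i
  have eD: "(e i has_derivative e' i) (at u)" for i
    unfolding e'_def by (rule Ck_on_SucD[OF e1 U(2)])
  have T_sym: "T i j = T j i" for i j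
    unfolding T_def a_def by (rule frechet_derivative_commute[OF y U])
  have fru: "frame ?a" by (rule fr[OF U(2)])
  have Phi'_eq: "Phi' i h = ?v * (Y u \<bullet> e' i h + Y' h \<bullet> e i u) +
      ?v * (\<Sum>k\<in>UNIV. frechet_derivative (a k) (at u) h \<bullet> e k u) * (Y u \<bullet> e i u)" for i h
  proof -
    have "((\<lambda>u. vol (\<lambda>i. a i u) * (Y u \<bullet> e i u)) has_derivative
       (\<lambda>h. ?v * (Y u \<bullet> e' i h + Y' h \<bullet> e i u) +
      ?v * (\<Sum>k\<in>UNIV. frechet_derivative (a k) (at u) h \<bullet> e k u) * (Y u \<bullet> e i u))) (at u)"
      unfolding e_def by (intro has_derivative_mult has_derivative_vol aD fru has_derivative_inner Y eD[unfolded e_def])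
    from has_derivative_transform_within_open[OF this U, of "Phi i"] Phi(2)
    have "(Phi i has_derivative (\<lambda>h. ?v * (Y u \<bullet> e' i h + Y' h \<bullet> e i u) +
      ?v * (\<Sum>k\<in>UNIV. frechet_derivative (a k) (at u) h \<bullet> e k u) * (Y u \<bullet> e i u))) (at u)"
      by simp
    from has_derivative_unique[OF Phi(1) this] show ?thesis by (rule fun_cong)
  qed
  define W where "W = (\<Sum>i\<in>UNIV. (\<Sum>k\<in>UNIV. T i k \<bullet> e k u) *\<^sub>R e i u + e' i (axis i 1))"
  have "(\<Sum>i\<in>UNIV. Phi' i (axis i 1)) = ?v * ((\<Sum>i\<in>UNIV. Y' (axis i 1) \<bullet> e i u) + W \<bullet> Y u)"
    unfolding Phi'_eq W_def T_def[symmetric]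
    by (simp add: inner_sum_left inner_add_left sum.distrib sum_distrib_left sum_distrib_right inner_sum_right inner_add_right algebra_simps inner_commute)
  moreover have "W \<bullet> Y u = (\<Sum>i\<in>UNIV. \<Sum>j\<in>UNIV. (e i u \<bullet> e j u) *\<^sub>R (T i j - ?P (T i j))) \<bullet> Y u"
  proof -
    define N where "N = Y u - ?P (Y u)"
    \<comment> \<open>Pairing with a frame vector turns the derivative of \<open>e i\<close> into
      minus a trace of \<open>T\<close>. After exchanging the two indices by \<open>T_sym\<close>
      this is exactly the trace from the derivative of the volume, and the two cancel.\<close>
    have Wa: "W \<bullet> ?a l = 0" for l
    proof -
      have "e i u \<bullet> ?a l = (if i = l then 1 else 0)" for i
        unfolding e_def by (rule inner_dual_frame[OF fru])
      moreover have "e' i (axis i 1) \<bullet> ?a l = - (e i u \<bullet> T i l)" for i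
        unfolding T_def unfolding e_def
        by (rule dual_derivative_tangent[OF U fr aD eD[unfolded e_def]])
      then have "e' i (axis i 1) \<bullet> ?a l = - (e i u \<bullet> T l i)" for i
        by (simp only: T_sym[of l i])
      ultimately show ?thesis
        by (simp add: W_def inner_sum_left inner_add_left sum.distrib sum_negf inner_commute[of "T _ _"]
            if_distrib[of "\<lambda>c. _ * c"] cong: if_cong)
    qed
    then have "W \<bullet> dual ?a l = 0" for l by (simp add: dual_def inner_sum_right)
    then have "W \<bullet> ?P (Y u) = 0" by (simp add: proj_def inner_sum_right Wa)
    then have "W \<bullet> Y u = W \<bullet> N" by (simp add: N_def inner_diff_right)
    have Na: "N \<bullet> ?a j = 0" for j
      by (simp add: N_def inner_diff_left proj_inner_frame[OF fru])
    have Ne: "e i u \<bullet> N = 0" for i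
      using normal_dual[of N ?a i] Na by (simp add: e_def inner_commute)
    have "e' i (axis i 1) \<bullet> N = (\<Sum>j\<in>UNIV. (e i u \<bullet> e j u) * (T i j \<bullet> N))" for i
      unfolding T_def unfolding e_def
      by (rule dual_derivative_normal[OF U fr aD eD[unfolded e_def] Na])
    then have "W \<bullet> N = (\<Sum>i\<in>UNIV. \<Sum>j\<in>UNIV. (e i u \<bullet> e j u) * (T i j \<bullet> N))"
      by (simp add: W_def inner_sum_left inner_add_left sum.distrib Ne)
    moreover have "T i j \<bullet> N = (T i j - ?P (T i j)) \<bullet> Y u" for i j
    proof -
      have "T i j \<bullet> ?P (Y u) = ?P (T i j) \<bullet> Y u"
        by (metis proj_inner_span[OF fru proj_in_span] inner_commute)
      then show ?thesis by (simp add: N_def inner_diff_left inner_diff_right)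
    qed
    ultimately show ?thesis
      using \<open>W \<bullet> Y u = W \<bullet> N\<close> by (simp add: inner_sum_left)
  qed
  ultimately show ?thesis by (simp add: T_def)
qed

section \<open>Change of variables\<close>

text \<open>
  The change of variables theorem of the library is about index types with a well-order.  A copy of
  an arbitrary finite type carries one.
\<close>

datatype 'a wo = Wo (unwo: 'a)

lemma range_Wo: "range Wo = UNIV"
  by (rule surjI[of _ unwo]) simp

lemma bij_Wo: "bij Wo"
  by (rule bijI[OF _ range_Wo], rule injI) simp

instance wo :: (finite) finite
proof
  show "finite (UNIV :: 'a wo set)" unfolding range_Wo[symmetric] by simp
qed

text \<open>An arbitrary injection; the order of the natural numbers is pulled back along
  it.\<close>

definition wo_index :: "'a::finite wo \<Rightarrow> nat" where
  "wo_index = (SOME f. inj f)"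

lemma inj_wo_index: "inj (wo_index :: 'a::finite wo \<Rightarrow> nat)"
proof -
  obtain f :: "'a wo \<Rightarrow> nat" where "inj f"
    using finite_imp_inj_to_nat_seg[of "UNIV :: ('a wo) set"] finite[of "UNIV :: ('a wo) set"] by metis
  then show ?thesis unfolding wo_index_def by (rule someI[of inj])
qed

instantiation wo :: (finite) wellorder
begin
definition "less_eq_wo x y \<longleftrightarrow> wo_index x \<le> wo_index y" for x y :: "'a wo"
definition "less_wo x y \<longleftrightarrow> wo_index x < wo_index y" for x y :: "'a wo"
instance
proof
  fix x y z :: "'a wo"
  show "x < y \<longleftrightarrow> x \<le> y \<and> \<not> y \<le> x" by (auto simp: less_eq_wo_def less_wo_def)
  show "x \<le> x" by (simp add: less_eq_wo_def)
  show "x \<le> y \<Longrightarrow> y \<le> z \<Longrightarrow> x \<le> z" by (simp add: less_eq_wo_def)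
  show "x \<le> y \<Longrightarrow> y \<le> x \<Longrightarrow> x = y"
    by (rule injD[OF inj_wo_index]) (simp add: less_eq_wo_def)
  show "x \<le> y \<or> y \<le> x" by (simp add: less_eq_wo_def linear)
next
  fix P :: "'a wo \<Rightarrow> bool" and a :: "'a wo"
  assume P: "\<And>x. (\<And>y. y < x \<Longrightarrow> P y) \<Longrightarrow> P x"
  have "\<forall>a. wo_index a = n \<longrightarrow> P a" for n
  proof (induction n rule: less_induct)
    case (less n)
    show ?case
    proof (intro allI impI)
      fix a :: "'a wo" assume "wo_index a = n"
      then show "P a" using less by - (rule P, auto simp: less_wo_def)
    qed
  qed
  then show "P a" by simp
qed
end

definition to_wo :: "real^'m::finite \<Rightarrow> real^'m wo" where "to_wo v = (\<chi> i. v $ unwo i)"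
definition of_wo :: "real^'m::finite wo \<Rightarrow> real^'m" where "of_wo v = (\<chi> i. v $ Wo i)"

lemma of_to_wo [simp]: "of_wo (to_wo v) = v" and to_of_wo [simp]: "to_wo (of_wo w) = w"
  by (simp_all add: to_wo_def of_wo_def vec_eq_iff)

lemma to_wo_linear: "bounded_linear to_wo" and of_wo_linear: "bounded_linear of_wo"
  unfolding linear_conv_bounded_linear[symmetric]
  by (rule linearI; simp add: to_wo_def of_wo_def vec_eq_iff)+

lemma measurable_to_wo [measurable]: "to_wo \<in> borel_measurable borel"
  and measurable_of_wo [measurable]: "of_wo \<in> borel_measurable borel"
  by (intro borel_measurable_continuous_onI linear_continuous_on to_wo_linear of_wo_linear)+

lemma prod_Basis_vec: "(\<Prod>b\<in>Basis. (v::real^'m) \<bullet> b) = (\<Prod>i\<in>UNIV. v $ i)"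
proof -
  have Basis: "(Basis :: (real^'m) set) = range (\<lambda>i. axis i 1)" by (auto simp: Basis_vec_def)
  have inj: "inj (\<lambda>i. axis i 1 :: real^'m)" by (auto simp: inj_on_def axis_eq_axis)
  show ?thesis unfolding Basis by (subst prod.reindex[OF inj]) (simp add: inner_axis)
qed

lemma of_wo_axis [simp]: "of_wo (axis j 1) = axis (unwo j) 1"
  by (auto simp: of_wo_def axis_def vec_eq_iff)

lemma distr_of_wo: "distr lborel borel (of_wo :: real^'m::finite wo \<Rightarrow> _) = lborel"
proof (rule lborel_eqI[symmetric])
  fix l u :: "real^'m" assume le: "\<And>b. b \<in> Basis \<Longrightarrow> l \<bullet> b \<le> u \<bullet> b"
  then have le': "l $ i \<le> u $ i" for i
    by (metis inner_axis axis_in_Basis_iff inner_real_def mult.right_neutral one_neq_zero Basis_real_def singletonI)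
  have "of_wo -` box l u = box (to_wo l) (to_wo u)"
    by (auto simp: mem_box_cart of_wo_def to_wo_def; metis wo.sel wo.collapse)
  moreover have "to_wo l \<bullet> b \<le> to_wo u \<bullet> b" if "b \<in> Basis" for b
    using that le' by (auto simp: Basis_vec_def inner_axis to_wo_def)
  moreover have "(\<Prod>b\<in>Basis. (to_wo u - to_wo l) \<bullet> b) = (\<Prod>b\<in>Basis. (u - l) \<bullet> b)"
    unfolding prod_Basis_vec
    by (rule prod.reindex_bij_witness[of _ Wo unwo]) (auto simp: to_wo_def)
  ultimately show "emeasure (distr lborel borel (of_wo :: real^'m wo \<Rightarrow> _)) (box l u) = (\<Prod>b\<in>Basis. (u - l) \<bullet> b)"
    by (simp add: emeasure_distr emeasure_lborel_box)
qed simp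

lemma nn_integral_of_wo:
  "f \<in> borel_measurable borel \<Longrightarrow> (\<integral>\<^sup>+u. f u \<partial>lborel) = (\<integral>\<^sup>+w. f (of_wo w) \<partial>lborel)"
  by (subst distr_of_wo[symmetric]) (simp add: nn_integral_distr)

lemma emeasure_of_wo:
  assumes "B \<in> sets borel" shows "emeasure lborel B = emeasure lborel (to_wo ` B)"
proof -
  have "of_wo -` B = to_wo ` B" by (auto simp: image_iff) (metis to_of_wo)
  then show ?thesis
    using assms by (subst distr_of_wo[symmetric]) (simp add: emeasure_distr)
qed

text \<open>Conjugation with the bijection reindexes the sum over permutations and preserves
  signs.\<close>

lemma det_wo:
  fixes A :: "real^'m::finite^'m"
  shows "det ((\<chi> i j. A $ unwo i $ unwo j) :: real^'m wo^'m wo) = det A"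
proof -
  have bij: "bij_betw Wo (UNIV :: 'm set) (UNIV :: 'm wo set)" using bij_Wo .
  have bij': "bij_betw unwo (UNIV :: 'm wo set) (UNIV :: 'm set)"
    by (rule bij_betw_byWitness[of _ Wo]) auto
  show ?thesis
    unfolding det_def
  proof (rule sum.reindex_bij_witness[of _ "map_permutation UNIV Wo" "map_permutation UNIV unwo"])
    fix p :: "'m wo \<Rightarrow> 'm wo" assume "p \<in> {p. p permutes UNIV}"
    then have p: "p permutes UNIV" by simp
    show "map_permutation UNIV Wo (map_permutation UNIV unwo p) = p"
      by (rule map_permutation_compose_inv[OF bij' p]) simp
    show "map_permutation UNIV unwo p \<in> {p. p permutes UNIV}"
      using map_permutation_permutes[OF bij' p] by simp
    have "map_permutation UNIV unwo p (unwo x) = unwo (p x)" for x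
      by (rule map_permutation_apply) (auto simp: wo.expand inj_on_def)
    then have *: "map_permutation UNIV unwo p i = unwo (p (Wo i))" for i
      by (metis wo.sel)
    have "sign (map_permutation UNIV unwo p) = sign p"
      using bij' p by (intro sign_map_permutation) (auto simp: bij_betw_def)
    moreover have "(\<Prod>i\<in>UNIV. A $ i $ unwo (p (Wo i))) = (\<Prod>i\<in>UNIV. A $ unwo i $ unwo (p i))"
      by (rule prod.reindex_bij_witness[of _ unwo Wo]) auto
    ultimately show "of_int (sign (map_permutation UNIV unwo p)) * (\<Prod>i\<in>UNIV. A $ i $ map_permutation UNIV unwo p i)
      = of_int (sign p) * (\<Prod>i\<in>UNIV. (\<chi> i j. A $ unwo i $ unwo j) $ i $ p i)"
      by (simp add: *)
  next
    fix p :: "'m \<Rightarrow> 'm" assume "p \<in> {p. p permutes UNIV}"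
    then have p: "p permutes UNIV" by simp
    show "map_permutation UNIV unwo (map_permutation UNIV Wo p) = p"
      by (rule map_permutation_compose_inv[OF bij p]) simp
    show "map_permutation UNIV Wo p \<in> {p. p permutes UNIV}"
      using map_permutation_permutes[OF bij p] by simp
  qed
qed

text \<open>\<open>has_measure_differentiable_image\<close> relates images of finite measure to
  gauge integrals. If the image has infinite measure, the integral must be infinite as well, since a
  finite one would make the integrand gauge integrable and the image finite.\<close>

lemma emeasure_differentiable_image_wellorder:
  fixes g :: "real^'m::{finite,wellorder} \<Rightarrow> real^'m::_"
  assumes T: "T \<in> sets borel" and gT: "g ` T \<in> sets borel"
    and g: "\<And>x. x \<in> T \<Longrightarrow> (g has_derivative g' x) (at x within T)" and inj: "inj_on g T"
    and meas: "(\<lambda>x. indicator T x * \<bar>det (matrix (g' x))\<bar>) \<in> borel_measurable borel"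
  shows "emeasure lborel (g ` T) = (\<integral>\<^sup>+x. ennreal (indicator T x * \<bar>det (matrix (g' x))\<bar>) \<partial>lborel)"
proof -
  let ?D = "\<lambda>x. indicator T x * \<bar>det (matrix (g' x))\<bar>"
  have TL: "T \<in> sets lebesgue" using T by (simp add: lborelD sets_completionI_sets)
  have restrict: "(?D has_integral m) UNIV \<longleftrightarrow> ((\<lambda>x. \<bar>det (matrix (g' x))\<bar>) has_integral m) T" for m
  proof -
    have "?D = (\<lambda>x. if x \<in> T then \<bar>det (matrix (g' x))\<bar> else 0)" by auto
    then show ?thesis using has_integral_restrict_UNIV[of T "\<lambda>x. \<bar>det (matrix (g' x))\<bar>" m] by simp
  qed
  have eqv: "g ` T \<in> lmeasurable \<and> measure lebesgue (g ` T) = m \<longleftrightarrow> (?D has_integral m) UNIV" for m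
    unfolding restrict by (rule has_measure_differentiable_image[OF TL g inj])
  show ?thesis
  proof (cases "g ` T \<in> lmeasurable")
    case True
    then have "(?D has_integral measure lebesgue (g ` T)) UNIV" using eqv by blast
    then have "(\<integral>\<^sup>+x. ennreal (?D x) \<partial>lborel) = ennreal (measure lebesgue (g ` T))"
      by (intro nn_integral_has_integral_lborel meas) auto
    also have "\<dots> = emeasure lebesgue (g ` T)"
      using True by (simp add: emeasure_eq_measure2)
    finally show ?thesis using gT by simp
  next
    case False
    have "\<not> (\<integral>\<^sup>+x. ennreal (?D x) \<partial>lborel) < \<infinity>"
    proof
      assume "(\<integral>\<^sup>+x. ennreal (?D x) \<partial>lborel) < \<infinity>"
      then have "?D integrable_on UNIV"
        by (intro nn_integral_integrable_on meas) auto
      then show False using eqv False by (auto simp: integrable_on_def)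
    qed
    moreover have "emeasure lborel (g ` T) = \<infinity>"
      using False gT by (auto simp: fmeasurable_def less_top[symmetric])
    ultimately show ?thesis by (simp add: less_top[symmetric])
  qed
qed

lemma emeasure_differentiable_image:
  fixes g :: "real^'m::finite \<Rightarrow> real^'m"
  assumes T: "T \<in> sets borel" and gT: "g ` T \<in> sets borel"
    and g: "\<And>x. x \<in> T \<Longrightarrow> (g has_derivative g' x) (at x)" and inj: "inj_on g T"
    and meas: "(\<lambda>x. indicator T x * \<bar>det (matrix (g' x))\<bar>) \<in> borel_measurable borel"
  shows "emeasure lborel (g ` T) = (\<integral>\<^sup>+x. ennreal (indicator T x * \<bar>det (matrix (g' x))\<bar>) \<partial>lborel)"
proof -
  let ?G = "\<lambda>w. to_wo (g (of_wo w))" let ?G' = "\<lambda>w h. to_wo (g' (of_wo w) (of_wo h))"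
  have det: "det (matrix (?G' w)) = det (matrix (g' (of_wo w)))" for w
  proof -
    have "matrix (?G' w) = (\<chi> i j. matrix (g' (of_wo w)) $ unwo i $ unwo j)"
      by (simp add: matrix_def vec_eq_iff to_wo_def)
    then show ?thesis by (simp add: det_wo)
  qed
  have image: "to_wo ` B = of_wo -` B" for B :: "(real^'m) set"
    by (auto simp: image_iff) (metis to_of_wo)
  have borel: "to_wo ` B \<in> sets borel" if "B \<in> sets borel" for B :: "(real^'m) set"
    unfolding image using measurable_sets[OF measurable_of_wo that] by simp
  have ind: "indicator (to_wo ` T) w = indicator T (of_wo w)" for w
    unfolding image by (simp add: indicator_def)
  have GT: "?G ` to_wo ` T = to_wo ` g ` T" by (auto simp: image_iff)
  have "emeasure lborel (g ` T) = emeasure lborel (?G ` to_wo ` T)"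
    unfolding GT by (rule emeasure_of_wo[OF gT])
  also have "\<dots> = (\<integral>\<^sup>+w. ennreal (indicator (to_wo ` T) w * \<bar>det (matrix (?G' w))\<bar>) \<partial>lborel)"
  proof (rule emeasure_differentiable_image_wellorder)
    show "to_wo ` T \<in> sets borel" "?G ` to_wo ` T \<in> sets borel"
      unfolding GT using borel T gT by auto
    show "(?G has_derivative ?G' w) (at w within to_wo ` T)" if "w \<in> to_wo ` T" for w
    proof -
      have "((\<lambda>w. g (of_wo w)) has_derivative (\<lambda>h. g' (of_wo w) (of_wo h))) (at w)"
        using diff_chain_at[OF bounded_linear_imp_has_derivative[OF of_wo_linear] g, of w] that
        by (auto simp: o_def)
      then have "(?G has_derivative ?G' w) (at w)"
        by (rule bounded_linear.has_derivative[OF to_wo_linear])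
      then show ?thesis by (rule has_derivative_at_withinI)
    qed
    show "inj_on ?G (to_wo ` T)"
      using inj by (auto simp: inj_on_def) (metis of_to_wo)
    show "(\<lambda>x. indicator (to_wo ` T) x * \<bar>det (matrix (?G' x))\<bar>) \<in> borel_measurable borel"
      unfolding det ind using measurable_compose[OF measurable_of_wo meas] .
  qed
  also have "\<dots> = (\<integral>\<^sup>+x. ennreal (indicator T x * \<bar>det (matrix (g' x))\<bar>) \<partial>lborel)"
    unfolding det ind
    by (subst (2) nn_integral_of_wo) (use meas in auto)
  finally show ?thesis .
qed

lemma nn_integral_change_of_variables:
  fixes g :: "real^'m::finite \<Rightarrow> real^'m"
  assumes T: "T \<in> sets borel" and gB: "\<And>B. B \<in> sets borel \<Longrightarrow> B \<subseteq> T \<Longrightarrow> g ` B \<in> sets borel"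
    and g: "\<And>x. x \<in> T \<Longrightarrow> (g has_derivative g' x) (at x)" and inj: "inj_on g T"
    and meas: "(\<lambda>x. indicator T x * \<bar>det (matrix (g' x))\<bar>) \<in> borel_measurable borel"
    and f: "(\<lambda>y. indicator (g ` T) y * f y) \<in> borel_measurable borel"
  shows "(\<integral>\<^sup>+y. ennreal (f y) * indicator (g ` T) y \<partial>lborel)
       = (\<integral>\<^sup>+x. ennreal (\<bar>det (matrix (g' x))\<bar> * f (g x)) * indicator T x \<partial>lborel)"
proof -
  \<comment> \<open>Extended by 0 outside \<open>T\<close> so as to be Borel on the whole space; the
    density vanishes there.\<close>
  define G where "G x = (if x \<in> T then g x else 0)" for x
  let ?D = "\<lambda>x. indicator T x * \<bar>det (matrix (g' x))\<bar>"
  have "continuous_on T g"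
    using g by (auto intro!: continuous_at_imp_continuous_on has_derivative_continuous)
  then have G[measurable]: "G \<in> borel_measurable borel"
    unfolding G_def by (intro borel_measurable_continuous_on_if T continuous_on_const)
  note [measurable] = T meas gB[OF T order.refl] f
  have distr: "distr (density lborel (\<lambda>x. ennreal (?D x))) borel G = density lborel (indicator (g ` T))"
  proof (rule measure_eqI)
    fix B assume "B \<in> sets (distr (density lborel (\<lambda>x. ennreal (?D x))) borel G)"
    then have B[measurable]: "B \<in> sets borel" by simp
    define TB where "TB = T \<inter> G -` B"
    have TB[measurable]: "TB \<in> sets borel" using measurable_sets[OF G B] by (simp add: TB_def)
    have "emeasure (distr (density lborel (\<lambda>x. ennreal (?D x))) borel G) B
        = (\<integral>\<^sup>+x. ennreal (?D x) * indicator (G -` B) x \<partial>lborel)"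
      using measurable_sets[OF G B] by (simp add: emeasure_distr emeasure_density)
    also have "\<dots> = (\<integral>\<^sup>+x. ennreal (indicator TB x * \<bar>det (matrix (g' x))\<bar>) \<partial>lborel)"
      by (intro nn_integral_cong) (auto simp: TB_def indicator_def)
    also have "\<dots> = emeasure lborel (g ` TB)"
    proof (rule emeasure_differentiable_image[symmetric])
      show "g ` TB \<in> sets borel" by (rule gB) (auto simp: TB_def)
      have "(\<lambda>x. indicator TB x * ?D x) \<in> borel_measurable borel" by measurable
      moreover have "indicator TB x * ?D x = indicator TB x * \<bar>det (matrix (g' x))\<bar>" for x
        by (auto simp: TB_def indicator_def)
      ultimately show "(\<lambda>x. indicator TB x * \<bar>det (matrix (g' x))\<bar>) \<in> borel_measurable borel" by simp
    qed (use inj g in \<open>auto simp: TB_def inj_on_def\<close>)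
    also have "g ` TB = g ` T \<inter> B" by (auto simp: TB_def G_def)
    also have "emeasure lborel (g ` T \<inter> B) = emeasure (density lborel (indicator (g ` T))) B"
    proof -
      have "emeasure lborel (g ` T \<inter> B) = (\<integral>\<^sup>+x. indicator (g ` T \<inter> B) x \<partial>lborel)" by simp
      also have "\<dots> = (\<integral>\<^sup>+x. indicator (g ` T) x * indicator B x \<partial>lborel)"
        by (simp only: indicator_inter_arith)
      also have "\<dots> = emeasure (density lborel (indicator (g ` T))) B"
        by (rule emeasure_density[symmetric]) measurable
      finally show ?thesis .
    qed
    finally show "emeasure (distr (density lborel (\<lambda>x. ennreal (?D x))) borel G) B
       = emeasure (density lborel (indicator (g ` T))) B" .
  qed simp
  let ?F = "\<lambda>y. ennreal (indicator (g ` T) y * f y)"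
  have "(\<integral>\<^sup>+y. ennreal (f y) * indicator (g ` T) y \<partial>lborel) = (\<integral>\<^sup>+y. ?F y \<partial>density lborel (indicator (g ` T)))"
    by (subst nn_integral_density, measurable) (auto intro!: nn_integral_cong simp: indicator_def)
  also have "\<dots> = (\<integral>\<^sup>+x. ?F (G x) \<partial>density lborel (\<lambda>x. ennreal (?D x)))"
    unfolding distr[symmetric] by (rule nn_integral_distr) measurable
  also have "\<dots> = (\<integral>\<^sup>+x. ennreal (?D x) * ?F (G x) \<partial>lborel)"
    by (rule nn_integral_density) measurable
  also have "\<dots> = (\<integral>\<^sup>+x. ennreal (\<bar>det (matrix (g' x))\<bar> * f (g x)) * indicator T x \<partial>lborel)"
    by (intro nn_integral_cong) (auto simp: indicator_def G_def ennreal_mult')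
  finally show ?thesis .
qed

section \<open>The Riemannian measure\<close>

lemma metric_gram: "metric c y q = gram (\<lambda>i. pd c i y q)"
  by (simp add: metric_def vec_eq_iff)

lemma vol_density_vol: "vol_density c y q = vol (\<lambda>i. pd c i y q)"
  by (simp add: vol_density_def vol_def metric_gram)

context atlas
begin

lemma smooth_map_Ck: "smooth_map \<A> f \<Longrightarrow> c \<in> \<A> \<Longrightarrow> Ck_on k (coord_range c) (f \<circ> param c)"
  by (auto simp: smooth_map_def smooth_on_def)

lemma immersion_Ck: "immersion \<A> y \<Longrightarrow> c \<in> \<A> \<Longrightarrow> Ck_on k (coord_range c) (y \<circ> param c)"
  by (auto simp: immersion_def smooth_map_Ck)

lemma differentiable_chart:
  "c \<in> \<A> \<Longrightarrow> q \<in> chart_dom c \<Longrightarrow> Ck_on (Suc k) (coord_range c) (f \<circ> param c) \<Longrightarrow>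
   (f \<circ> param c) differentiable (at (coord c q))"
  by simp

lemma immersion_frame:
  assumes y: "immersion \<A> y" and c: "c \<in> \<A>" "q \<in> chart_dom c"
  shows "frame (\<lambda>i. pd c i y q)"
  unfolding frame_def
proof (intro allI impI)
  fix w i assume 0: "(\<Sum>i\<in>UNIV. w i *\<^sub>R pd c i y q) = 0"
  let ?D = "frechet_derivative (y \<circ> param c) (at (coord c q))"
  have "((y \<circ> param c) has_derivative ?D) (at (coord c q))"
    using Ck_on_SucD[OF immersion_Ck[OF y c(1), of "Suc 0"]] c by blast
  from has_derivative_linear[OF this] interpret D: linear ?D .
  have "?D (\<chi> i. w i) = ?D (\<Sum>i\<in>UNIV. w i *\<^sub>R axis i 1)"
    using basis_expansion[of "\<chi> i. w i"] by (simp add: scalar_mult_eq_scaleR)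
  also have "\<dots> = ?D 0" using 0 by (simp only: D.sum D.scaleR pd_def D.zero)
  finally have "(\<chi> i. w i) = 0"
    using y c unfolding immersion_def by (meson injD)
  then show "w i = 0" by (simp add: vec_eq_iff)
qed

lemma immersion_frame_change:
  assumes "immersion \<A> y" "c \<in> \<A>" "d \<in> \<A>" "q \<in> chart_dom c" "q \<in> chart_dom d"
  shows "pd d i y q = (\<Sum>k\<in>UNIV. jac c d q $ k $ i *\<^sub>R pd c k y q)"
  using assms by (intro pd_chart_change differentiable_chart immersion_Ck)

lemma vol_density_change:
  assumes "immersion \<A> y" "c \<in> \<A>" "d \<in> \<A>" "q \<in> chart_dom c" "q \<in> chart_dom d"
  shows "vol_density d y q = \<bar>det (jac c d q)\<bar> * vol_density c y q"
  unfolding vol_density_vol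
  by (rule vol_change[OF invertible_jac immersion_frame_change immersion_frame]) (use assms in auto)

lemma vol_density_pos:
  "immersion \<A> y \<Longrightarrow> c \<in> \<A> \<Longrightarrow> q \<in> chart_dom c \<Longrightarrow> vol_density c y q > 0"
  unfolding vol_density_vol by (intro vol_pos immersion_frame)

lemma Ck_pd_immersion:
  "immersion \<A> y \<Longrightarrow> c \<in> \<A> \<Longrightarrow> Ck_on k (coord_range c) (\<lambda>u. pd c i y (param c u))"
  using Ck_pd[OF _ immersion_Ck, of c y k i] by (simp add: o_def del: Ck_on.simps)

lemma Ck_vol_density:
  assumes "immersion \<A> y" "c \<in> \<A>"
  shows "Ck_on k (coord_range c) (\<lambda>u. vol_density c y (param c u))"
  unfolding vol_density_vol using assms
  by (intro Ck_on_vol chart_open(2) Ck_pd_immersion immersion_frame) auto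

section \<open>Borel sets and the measure in a single chart\<close>

lemma mem_coord_image:
  assumes "c \<in> \<A>" "B \<subseteq> chart_dom c"
  shows "u \<in> coord c ` B \<longleftrightarrow> u \<in> coord_range c \<and> param c u \<in> B"
proof
  assume "u \<in> coord c ` B"
  then show "u \<in> coord_range c \<and> param c u \<in> B" using assms by auto
next
  assume *: "u \<in> coord_range c \<and> param c u \<in> B"
  then have "coord c (param c u) \<in> coord c ` B" by blast
  then show "u \<in> coord c ` B" using * assms(1) by simp
qed

text \<open>The image is a preimage under \<open>param c\<close>, and preimages keep Borel sets
  Borel. \<open>P\<close> extends \<open>param c\<close> by a constant, which is Borel because the
  coordinate range is open.\<close>

lemma borel_coord_image:
  assumes "c \<in> \<A>" "B \<in> sets borel" "B \<subseteq> chart_dom c" shows "coord c ` B \<in> sets borel"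
proof -
  define P where "P u = (if u \<in> coord_range c then param c u else undefined)" for u
  have [measurable]: "coord_range c \<in> sets borel" using chart_open(2)[OF assms(1)] by simp
  have "P \<in> borel_measurable borel"
    unfolding P_def using assms(1)
    by (intro borel_measurable_continuous_on_if param_continuous continuous_on_const) auto
  from measurable_sets[OF this assms(2)] have "P -` B \<inter> coord_range c \<in> sets borel" by simp
  moreover have "P -` B \<inter> coord_range c = coord c ` B"
    unfolding set_eq_iff mem_coord_image[OF assms(1,3)] by (auto simp: P_def)
  ultimately show ?thesis by simp
qed

text \<open>The measure \<open>sqrt (det g) du\<close> transported to the manifold. The default
  value outside the coordinate range carries no mass, since the density is 0 there.\<close>

definition chart_measure :: "('a, 'm) chart \<Rightarrow> ('a \<Rightarrow> 'b::euclidean_space) \<Rightarrow> 'a measure" where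
  "chart_measure c y = distr (density lborel (\<lambda>u. ennreal (vol_density c y (param c u)) * indicator (coord_range c) u))
     borel (\<lambda>u. if u \<in> coord_range c then param c u else undefined)"

lemma sets_chart_measure [simp, measurable_cong]: "sets (chart_measure c y) = sets borel"
  by (simp add: chart_measure_def)

lemma measurable_param:
  assumes "c \<in> \<A>"
  shows "(\<lambda>u. if u \<in> coord_range c then param c u else undefined) \<in> borel_measurable borel"
  using chart_open(2)[OF assms] assms
  by (intro borel_measurable_continuous_on_if param_continuous continuous_on_const) auto

lemma measurable_vol_density:
  assumes "immersion \<A> y" "c \<in> \<A>"
  shows "(\<lambda>u. ennreal (vol_density c y (param c u)) * indicator (coord_range c) u) \<in> borel_measurable borel"
proof -
  have "(\<lambda>u. indicator (coord_range c) u *\<^sub>R vol_density c y (param c u)) \<in> borel_measurable borel"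
    using Ck_on_continuous_on[OF Ck_vol_density[OF assms]] chart_open(2)[OF assms(2)]
    by (intro borel_measurable_continuous_on_indicator) auto
  then have "(\<lambda>u. ennreal (indicator (coord_range c) u *\<^sub>R vol_density c y (param c u))) \<in> borel_measurable borel"
    by simp
  moreover have "ennreal (indicator (coord_range c) u *\<^sub>R vol_density c y (param c u))
     = ennreal (vol_density c y (param c u)) * indicator (coord_range c) u" for u
    by (simp add: indicator_def)
  ultimately show ?thesis by simp
qed

lemma nn_integral_chart_measure:
  assumes "immersion \<A> y" "c \<in> \<A>" "f \<in> borel_measurable borel"
  shows "(\<integral>\<^sup>+q. f q \<partial>chart_measure c y)
       = (\<integral>\<^sup>+u. ennreal (vol_density c y (param c u)) * f (param c u) * indicator (coord_range c) u \<partial>lborel)"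
proof -
  note [measurable] = measurable_param[OF assms(2)] measurable_vol_density[OF assms(1,2)] assms(3)
  let ?P = "\<lambda>u. if u \<in> coord_range c then param c u else undefined"
  have "(\<integral>\<^sup>+q. f q \<partial>chart_measure c y) = (\<integral>\<^sup>+u. f (?P u)
      \<partial>density lborel (\<lambda>u. ennreal (vol_density c y (param c u)) * indicator (coord_range c) u))"
    unfolding chart_measure_def by (rule nn_integral_distr) measurable
  also have "\<dots> = (\<integral>\<^sup>+u. (ennreal (vol_density c y (param c u)) * indicator (coord_range c) u) * f (?P u) \<partial>lborel)"
    by (rule nn_integral_density) measurable
  also have "\<dots> = (\<integral>\<^sup>+u. ennreal (vol_density c y (param c u)) * f (param c u) * indicator (coord_range c) u \<partial>lborel)"
    by (intro nn_integral_cong) (auto simp: indicator_def)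
  finally show ?thesis .
qed

lemma emeasure_chart_measure:
  assumes "immersion \<A> y" "c \<in> \<A>" "B \<in> sets borel" "B \<subseteq> chart_dom c"
  shows "emeasure (chart_measure c y) B
       = (\<integral>\<^sup>+u. ennreal (vol_density c y (param c u)) * indicator (coord c ` B) u \<partial>lborel)"
proof -
  have "emeasure (chart_measure c y) B = (\<integral>\<^sup>+q. indicator B q \<partial>chart_measure c y)"
    using assms(3) by simp
  also have "\<dots> = (\<integral>\<^sup>+u. ennreal (vol_density c y (param c u)) * indicator B (param c u) * indicator (coord_range c) u \<partial>lborel)"
    by (rule nn_integral_chart_measure[OF assms(1,2)]) (use assms(3) in auto)
  also have "\<dots> = (\<integral>\<^sup>+u. ennreal (vol_density c y (param c u)) * indicator (coord c ` B) u \<partial>lborel)"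
  proof (intro nn_integral_cong)
    fix u
    have "u \<in> coord c ` B \<longleftrightarrow> u \<in> coord_range c \<and> param c u \<in> B"
      by (rule mem_coord_image[OF assms(2,4)])
    then show "ennreal (vol_density c y (param c u)) * indicator B (param c u) * indicator (coord_range c) u
      = ennreal (vol_density c y (param c u)) * indicator (coord c ` B) u"
      by (auto simp: indicator_def)
  qed
  finally show ?thesis .
qed

text \<open>Change of variables along the transition map: its Jacobian determinant is the factor by
  which the two volume densities differ.\<close>

lemma chart_measure_independent:
  assumes y: "immersion \<A> y" and cd: "c \<in> \<A>" "d \<in> \<A>"
    and B: "B \<in> sets borel" "B \<subseteq> chart_dom c" "B \<subseteq> chart_dom d"
  shows "emeasure (chart_measure c y) B = emeasure (chart_measure d y) B"
proof -
  let ?g = "coord c \<circ> param d" and ?T = "coord d ` B"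
  have T: "?T \<subseteq> coord d ` (chart_dom d \<inter> chart_dom c)" using B by blast
  have gT: "?g ` coord d ` B' = coord c ` B'" if "B' \<subseteq> chart_dom d" for B'
    unfolding image_comp
  proof (rule image_cong)
    fix q assume "q \<in> B'"
    then have "param d (coord d q) = q" using that cd(2) by (simp add: subsetD)
    then show "(?g \<circ> coord d) q = coord c q" by simp
  qed simp
  have "emeasure (chart_measure c y) B = (\<integral>\<^sup>+u. ennreal (vol_density c y (param c u)) * indicator (?g ` ?T) u \<partial>lborel)"
    unfolding gT[OF B(3)] by (rule emeasure_chart_measure[OF y cd(1) B(1,2)])
  also have "\<dots> = (\<integral>\<^sup>+u. ennreal (\<bar>det (matrix (frechet_derivative ?g (at u)))\<bar> * vol_density c y (param c (?g u))) * indicator ?T u \<partial>lborel)"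
  proof (rule nn_integral_change_of_variables)
    show Tb: "?T \<in> sets borel" by (rule borel_coord_image[OF cd(2) B(1,3)])
    show "?g ` B' \<in> sets borel" if B': "B' \<in> sets borel" "B' \<subseteq> ?T" for B'
    proof -
      \<comment> \<open>Go back to the manifold along \<open>param d\<close>, where the set is Borel
        as a preimage under the extended \<open>coord d\<close>, and then forward along
        \<open>coord c\<close>.\<close>
      have "B' \<subseteq> coord_range d" using B' B by blast
      have sub: "param d ` B' \<subseteq> B" using B' B cd by (auto simp: subset_iff)
      have "open (chart_dom d)" using chart_open(1)[OF cd(2)] .
      have "(\<lambda>q. if q \<in> chart_dom d then coord d q else undefined) \<in> borel_measurable borel"
        using cd(2) \<open>open (chart_dom d)\<close>
        by (intro borel_measurable_continuous_on_if coord_continuous continuous_on_const) auto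
      from measurable_sets[OF this B'(1)]
      have "(\<lambda>q. if q \<in> chart_dom d then coord d q else undefined) -` B' \<inter> chart_dom d \<in> sets borel"
        using \<open>open (chart_dom d)\<close> by simp
      moreover have "(\<lambda>q. if q \<in> chart_dom d then coord d q else undefined) -` B' \<inter> chart_dom d = param d ` B'"
      proof (intro set_eqI iffI)
        fix q assume "q \<in> (\<lambda>q. if q \<in> chart_dom d then coord d q else undefined) -` B' \<inter> chart_dom d"
        then have "coord d q \<in> B'" "param d (coord d q) = q" using cd(2) by auto
        then show "q \<in> param d ` B'" by (metis imageI)
      next
        fix q assume "q \<in> param d ` B'"
        then obtain u where "u \<in> B'" "q = param d u" by blast
        then show "q \<in> (\<lambda>q. if q \<in> chart_dom d then coord d q else undefined) -` B' \<inter> chart_dom d"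
          using \<open>B' \<subseteq> coord_range d\<close> cd(2) by (simp add: subsetD)
      qed
      ultimately have "param d ` B' \<in> sets borel" by simp
      then have "coord c ` (param d ` B') \<in> sets borel"
        using sub B by (intro borel_coord_image[OF cd(1)]) auto
      then show ?thesis by (simp add: image_comp)
    qed
    show "(?g has_derivative frechet_derivative ?g (at u)) (at u)" if "u \<in> ?T" for u
      by (rule Ck_on_SucD[OF transition_Ck[OF cd, of "Suc 0"] subsetD[OF T that]])
    show "inj_on ?g ?T"
    proof (rule inj_onI)
      fix u v assume uv: "u \<in> ?T" "v \<in> ?T" "?g u = ?g v"
      have bk: "coord d (param c (?g w)) = w" if w: "w \<in> ?T" for w
      proof -
        obtain p where p: "p \<in> B" "w = coord d p" using w by blast
        then have "param d w = p" "param c (coord c p) = p" using B cd by (simp_all add: subsetD)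
        then show ?thesis using p by simp
      qed
      show "u = v" using bk[OF uv(1)] bk[OF uv(2)] unfolding uv(3) by (rule trans[OF sym])
    qed
    show "(\<lambda>u. indicator ?T u * \<bar>det (matrix (frechet_derivative ?g (at u)))\<bar>) \<in> borel_measurable borel"
    proof -
      have "Ck_on 0 (coord d ` (chart_dom d \<inter> chart_dom c)) (\<lambda>u. matrix (frechet_derivative ?g (at u)) $ i $ j)" for i j
        using Ck_on_inner[OF open_overlap[OF cd(2,1)] Ck_on_frechet[OF transition_Ck[OF cd, of "Suc 0"]]
            Ck_on_const[of _ _ "axis i 1"]]
        by (simp add: matrix_nth_frechet inner_axis)
      then have "Ck_on 0 (coord d ` (chart_dom d \<inter> chart_dom c)) (\<lambda>u. det (matrix (frechet_derivative ?g (at u))))"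
        by (rule Ck_on_det[OF open_overlap[OF cd(2,1)]])
      then have "continuous_on ?T (\<lambda>u. \<bar>det (matrix (frechet_derivative ?g (at u)))\<bar>)"
        using continuous_on_subset[OF _ T] by (intro continuous_on_rabs) auto
      from borel_measurable_continuous_on_indicator[OF Tb this] show ?thesis by simp
    qed
    show "(\<lambda>u. indicator (?g ` ?T) u * vol_density c y (param c u)) \<in> borel_measurable borel"
    proof -
      have "continuous_on (coord c ` B) (\<lambda>u. vol_density c y (param c u))"
        using Ck_on_continuous_on[OF Ck_vol_density[OF y cd(1)]] by (rule continuous_on_subset[OF _ image_mono[OF B(2)]])
      from borel_measurable_continuous_on_indicator[OF borel_coord_image[OF cd(1) B(1,2)] this]
      show ?thesis unfolding gT[OF B(3)] by simp
    qed
  qed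
  also have "\<dots> = (\<integral>\<^sup>+u. ennreal (vol_density d y (param d u)) * indicator ?T u \<partial>lborel)"
  proof (intro nn_integral_cong)
    fix u
    have "\<bar>det (matrix (frechet_derivative ?g (at u)))\<bar> * vol_density c y (param c (?g u)) = vol_density d y (param d u)"
      if u: "u \<in> ?T"
    proof -
      obtain q where q: "q \<in> B" "u = coord d q" using u by auto
      then have "vol_density d y q = \<bar>det (jac c d q)\<bar> * vol_density c y q"
        using B by (intro vol_density_change y cd) auto
      moreover have "param d u = q" "param c (?g u) = q" using q B cd by (simp_all add: subsetD)
      ultimately show ?thesis using q by (simp add: jac_def)
    qed
    then show "ennreal (\<bar>det (matrix (frechet_derivative ?g (at u)))\<bar> * vol_density c y (param c (?g u))) * indicator ?T u
       = ennreal (vol_density d y (param d u)) * indicator ?T u"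
      by (cases "u \<in> ?T") auto
  qed
  also have "\<dots> = emeasure (chart_measure d y) B"
    by (rule emeasure_chart_measure[OF y cd(2) B(1,3), symmetric])
  finally show ?thesis .
qed

section \<open>Gluing the measures of the charts\<close>

lemma countable_chart_cover:
  obtains C :: "nat \<Rightarrow> ('a, 'm) chart" where "\<And>n. C n \<in> \<A>" "(\<Union>n. chart_dom (C n)) = UNIV"
proof -
  have op: "open S" if S: "S \<in> chart_dom ` \<A>" for S using S chart_open(1) by auto
  obtain F where F: "F \<subseteq> chart_dom ` \<A>" "countable F" "\<Union>F = \<Union>(chart_dom ` \<A>)"
    by (rule Lindelof[OF op, of "chart_dom ` \<A>"])
  have U: "\<Union>(chart_dom ` \<A>) = UNIV" using smooth_atlas by (simp add: smooth_atlas_def)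
  then have ne: "F \<noteq> {}" using F(3) by force
  define C where "C n = (SOME c. c \<in> \<A> \<and> chart_dom c = from_nat_into F n)" for n
  have "C n \<in> \<A> \<and> chart_dom (C n) = from_nat_into F n" for n
  proof -
    have "from_nat_into F n \<in> chart_dom ` \<A>" using from_nat_into[OF ne, of n] F(1) by blast
    then have "\<exists>c. c \<in> \<A> \<and> chart_dom c = from_nat_into F n" by force
    from someI_ex[OF this] show ?thesis unfolding C_def .
  qed
  moreover have "(\<Union>n. from_nat_into F n) = UNIV"
    using F(3) U range_from_nat_into[OF ne F(2)] by simp
  ultimately show ?thesis using that[of C] by simp
qed

text \<open>Borel pieces, each inside one chart, let a measure be assembled and compared by
  countable additivity alone.\<close>

lemma disjoint_chart_cover:
  obtains C :: "nat \<Rightarrow> ('a, 'm) chart" and D where "\<And>n. C n \<in> \<A>" "\<And>n. D n \<in> sets borel"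
    "\<And>n. D n \<subseteq> chart_dom (C n)" "disjoint_family D" "(\<Union>n. D n) = UNIV"
proof -
  obtain C :: "nat \<Rightarrow> ('a, 'm) chart" where C: "\<And>n. C n \<in> \<A>" "(\<Union>n. chart_dom (C n)) = UNIV"
    by (rule countable_chart_cover) blast
  have "range (\<lambda>n. chart_dom (C n)) \<subseteq> sets borel" using borel_open[OF chart_open(1)[OF C(1)]] by auto
  from sets.range_disjointed_sets[OF this]
  have "disjointed (\<lambda>n. chart_dom (C n)) n \<in> sets borel" for n by auto
  then show ?thesis
    by (rule that[OF C(1) _ disjointed_subset disjoint_family_disjointed])
      (use UN_disjointed_eq[of "\<lambda>n. chart_dom (C n)"] C(2) in simp)
qed

lemma volume_measure_eqI:
  assumes "sets M = sets borel" "sets N = sets borel"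
    and "\<And>c B. c \<in> \<A> \<Longrightarrow> B \<in> sets borel \<Longrightarrow> B \<subseteq> chart_dom c \<Longrightarrow> emeasure M B = emeasure N B"
  shows "M = N"
proof -
  obtain C :: "nat \<Rightarrow> ('a, 'm) chart" and D where C: "\<And>n. C n \<in> \<A>" and D: "\<And>n. D n \<in> sets borel"
    "\<And>n. D n \<subseteq> chart_dom (C n)" "disjoint_family D" "(\<Union>n. D n) = UNIV"
    by (rule disjoint_chart_cover) blast
  show ?thesis
  proof (rule measure_eqI)
    show "sets M = sets N" using assms by simp
    fix B assume "B \<in> sets M"
    then have B: "B \<in> sets borel" using assms by simp
    have "emeasure K B = (\<Sum>n. emeasure K (B \<inter> D n))" if K: "sets K = sets borel" for K
    proof -
      have "disjoint_family (\<lambda>n. B \<inter> D n)"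
        using D(3) by (auto simp: disjoint_family_on_def)
      moreover have "(\<Union>n. B \<inter> D n) = B"
        using D(4) by auto
      moreover have "range (\<lambda>n. B \<inter> D n) \<subseteq> sets K" using B D(1) K by auto
      ultimately show ?thesis
        using suminf_emeasure[of "\<lambda>n. B \<inter> D n" K] by simp
    qed
    moreover have "emeasure M (B \<inter> D n) = emeasure N (B \<inter> D n)" for n
      using B D by (intro assms(3)[OF C]) auto
    ultimately show "emeasure M B = emeasure N B" using assms by simp
  qed
qed

lemma volume_measure_exists:
  assumes y: "immersion \<A> y"
  obtains M where "sets M = sets borel"
    "\<And>c B. c \<in> \<A> \<Longrightarrow> B \<in> sets borel \<Longrightarrow> B \<subseteq> chart_dom c \<Longrightarrow> emeasure M B = emeasure (chart_measure c y) B"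
proof -
  obtain C :: "nat \<Rightarrow> ('a, 'm) chart" and D where C: "\<And>n. C n \<in> \<A>" and D: "\<And>n. D n \<in> sets borel"
    "\<And>n. D n \<subseteq> chart_dom (C n)" "disjoint_family D" "(\<Union>n. D n) = UNIV"
    by (rule disjoint_chart_cover) blast
  define m where "m B = (\<Sum>n. emeasure (chart_measure (C n) y) (B \<inter> D n))" for B
  define M where "M = measure_of UNIV (sets borel) m"
  have emeasure_M: "emeasure M B = m B" if "B \<in> sets borel" for B
    unfolding M_def
  proof (rule emeasure_measure_of_sigma)
    show "sigma_algebra UNIV (sets (borel :: 'a measure))"
      using sets.sigma_algebra_axioms[of "borel :: 'a measure"] by simp
    show "positive (sets borel) m" by (simp add: positive_def m_def)
    show "countably_additive (sets borel) m"
    proof (rule countably_additiveI)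
      fix E :: "nat \<Rightarrow> 'a set" assume E: "range E \<subseteq> sets borel" "disjoint_family E"
      let ?e = "\<lambda>i n. emeasure (chart_measure (C n) y) (E i \<inter> D n)"
      \<comment> \<open>One of the two sums is written as an integral over counting measure, so that
        their order may be exchanged.\<close>
      have "(\<Sum>i. m (E i)) = (\<Sum>i. \<integral>\<^sup>+n. ?e i n \<partial>count_space UNIV)"
        unfolding m_def by (simp add: nn_integral_count_space_nat)
      also have "\<dots> = (\<integral>\<^sup>+n. (\<Sum>i. ?e i n) \<partial>count_space UNIV)"
        by (rule nn_integral_suminf[symmetric]) simp
      also have "\<dots> = (\<Sum>n. \<Sum>i. ?e i n)"
        by (rule nn_integral_count_space_nat)
      also have "\<dots> = m (\<Union>i. E i)"
      proof -
        have "(\<Sum>i. emeasure (chart_measure (C n) y) (E i \<inter> D n)) = emeasure (chart_measure (C n) y) (\<Union>i. E i \<inter> D n)" for n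
          using E D by (intro suminf_emeasure) (auto simp: disjoint_family_on_def)
        then show ?thesis by (simp add: m_def)
      qed
      finally show "(\<Sum>i. m (E i)) = m (\<Union>i. E i)" .
    qed
  qed fact
  have sets_M: "sets M = sets borel"
    unfolding M_def using sets.space_closed[of "borel :: 'a measure"] sets.sigma_sets_eq[of "borel :: 'a measure"]
    by simp
  moreover have "emeasure M B = emeasure (chart_measure c y) B"
    if c: "c \<in> \<A>" and B: "B \<in> sets borel" "B \<subseteq> chart_dom c" for c B
  proof -
    \<comment> \<open>Each piece lies both in \<open>c\<close> and in \<open>C n\<close> and may be
      measured in \<open>c\<close>; the pieces then add up within a single measure.\<close>
    have "emeasure M B = (\<Sum>n. emeasure (chart_measure c y) (B \<inter> D n))"
      unfolding emeasure_M[OF B(1)] m_def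
      using B D by (intro suminf_cong chart_measure_independent y C c) auto
    also have "\<dots> = emeasure (chart_measure c y) (\<Union>n. B \<inter> D n)"
    proof (rule suminf_emeasure)
      show "disjoint_family (\<lambda>n. B \<inter> D n)" using D(3) by (auto simp: disjoint_family_on_def)
    qed (use B D(1) in auto)
    also have "(\<Union>n. B \<inter> D n) = B"
      using D(4) by auto
    finally show ?thesis .
  qed
  ultimately show ?thesis by (rule that)
qed

text \<open>Existence by gluing and uniqueness by cutting along charts evaluate the definite
  description of \<open>volume_measure\<close>.\<close>

lemma volume_measure:
  assumes y: "immersion \<A> y"
  shows sets_volume_measure: "sets (volume_measure \<A> y) = sets borel"
    and emeasure_volume_measure: "\<And>c B. c \<in> \<A> \<Longrightarrow> B \<in> sets borel \<Longrightarrow> B \<subseteq> chart_dom c \<Longrightarrow>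
      emeasure (volume_measure \<A> y) B = emeasure (chart_measure c y) B"
proof -
  let ?Q = "\<lambda>M. sets M = sets borel \<and>
        (\<forall>c\<in>\<A>. \<forall>A\<in>sets borel. A \<subseteq> chart_dom c \<longrightarrow>
           emeasure M A = (\<integral>\<^sup>+u. ennreal (vol_density c y (param c u)) * indicator (coord c ` A) u \<partial>lborel))"
  obtain M where M: "sets M = sets borel"
    "\<And>c B. c \<in> \<A> \<Longrightarrow> B \<in> sets borel \<Longrightarrow> B \<subseteq> chart_dom c \<Longrightarrow> emeasure M B = emeasure (chart_measure c y) B"
    using volume_measure_exists[OF y] by blast
  have "?Q M" using M emeasure_chart_measure[OF y] by simp
  moreover have "N = M" if "?Q N" for N
    using that M emeasure_chart_measure[OF y] by (intro volume_measure_eqI) auto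
  ultimately have "volume_measure \<A> y = M"
    unfolding volume_measure_def by (rule the_equality)
  with M show "sets (volume_measure \<A> y) = sets borel"
    "\<And>c B. c \<in> \<A> \<Longrightarrow> B \<in> sets borel \<Longrightarrow> B \<subseteq> chart_dom c \<Longrightarrow>
      emeasure (volume_measure \<A> y) B = emeasure (chart_measure c y) B"
    by auto
qed

end

lemma Ck_on_Un:
  assumes "open S" "open T" "Ck_on k S f" "Ck_on k T f"
  shows "Ck_on k (S \<union> T) f"
  using assms(3,4)
proof (induction k arbitrary: f)
  case 0
  then show ?case using continuous_on_open_Un[OF assms(1,2)] by simp
next
  case (Suc k)
  have "Ck_on k (S \<union> T) (\<lambda>u. frechet_derivative f (at u) v)" for v
    by (rule Suc.IH[OF Ck_on_frechet[OF Suc.prems(1)] Ck_on_frechet[OF Suc.prems(2)]])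
  then show ?case using Suc.prems by auto
qed

section \<open>Bump functions\<close>

text \<open>The building block of the cut-off functions: it vanishes on the negative half-line and
  has the continuous derivative \<open>2 * max 0 z\<close>, and one derivative is all that the
  divergence theorem takes.\<close>

definition pos_square :: "real \<Rightarrow> real" where "pos_square z = (max 0 z)\<^sup>2"

lemma DERIV_pos_square: "(pos_square has_real_derivative 2 * max 0 z) (at z)"
proof -
  consider "z > 0" | "z < 0" | "z = 0" by linarith
  then show ?thesis
  proof cases
    case 1
    have "((\<lambda>z. z\<^sup>2) has_real_derivative 2 * max 0 z) (at z)"
      using 1 by (auto intro!: derivative_eq_intros)
    then show ?thesis
      by (rule has_field_derivative_transform_within_open[of _ _ _ "{0<..}"]) (use 1 in \<open>auto simp: pos_square_def\<close>)
  next
    case 2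
    have "((\<lambda>z. 0) has_real_derivative 2 * max 0 z) (at z)"
      using 2 by (auto intro!: derivative_eq_intros)
    then show ?thesis
      by (rule has_field_derivative_transform_within_open[of _ _ _ "{..<0}"]) (use 2 in \<open>auto simp: pos_square_def\<close>)
  next
    case 3
    have "((\<lambda>h::real. max 0 h) \<longlongrightarrow> max 0 0) (at 0)" by (intro tendsto_intros)
    moreover have "(pos_square h - pos_square 0) / (h - 0) = max 0 h" if "h \<noteq> 0" for h
      using that by (auto simp: pos_square_def max_def power2_eq_square)
    ultimately have "((\<lambda>h. (pos_square h - pos_square 0) / (h - 0)) \<longlongrightarrow> 0) (at 0)"
      by (subst tendsto_cong[where g = "\<lambda>h. max 0 h"]) (auto simp: eventually_at_filter)
    then show ?thesis using 3 by (simp add: has_field_derivative_iff)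
  qed
qed

lemma C1_pos_square: "Ck_on (Suc 0) UNIV pos_square"
proof (rule Ck_on_SucI[where f' = "\<lambda>z h. 2 * max 0 z * h"])
  show "(pos_square has_derivative (\<lambda>h. 2 * max 0 z * h)) (at z)" for z
    using DERIV_pos_square[of z] by (simp add: has_field_derivative_def)
  show "Ck_on 0 UNIV (\<lambda>z. 2 * max 0 z * v)" for v :: real
    by (auto intro!: continuous_intros)
qed simp

text \<open>For \<open>norm (u - u0) \<le> r\<close> the inner \<open>pos_square\<close> is 0 and
  the value is 1. Once the squared distance reaches \<open>2 * r\<^sup>2\<close> the inner value is
  at least 1 and the outer one 0; the ball of radius \<open>2 * r\<close> is a convenient bound for
  the support.\<close>

definition bump :: "real^'m::finite \<Rightarrow> real \<Rightarrow> real^'m \<Rightarrow> real" where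
  "bump u0 r u = pos_square (1 - pos_square ((u - u0) \<bullet> (u - u0) / r\<^sup>2 - 1))"

lemma C1_bump: "Ck_on (Suc 0) UNIV (bump u0 r)"
proof -
  have 1: "Ck_on (Suc 0) UNIV (\<lambda>u. (u - u0) \<bullet> (u - u0) / r\<^sup>2 - 1)"
    unfolding divide_inverse
    by (intro Ck_on_diff Ck_on_mult Ck_on_inner Ck_on_const Ck_on_id open_UNIV)
  have 2: "Ck_on (Suc 0) UNIV (\<lambda>u. 1 - pos_square ((u - u0) \<bullet> (u - u0) / r\<^sup>2 - 1))"
    by (rule Ck_on_diff[OF open_UNIV Ck_on_const Ck_on_compose[OF open_UNIV 1 C1_pos_square]]) simp
  show ?thesis
    unfolding bump_def by (rule Ck_on_compose[OF open_UNIV 2 C1_pos_square]) simp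
qed

lemma bump_eq_1: assumes "r > 0" "u \<in> ball u0 r" shows "bump u0 r u = 1"
proof -
  have "norm (u - u0) < r" using assms(2) by (simp add: dist_norm norm_minus_commute)
  then have "(u - u0) \<bullet> (u - u0) \<le> r\<^sup>2"
    using power_mono[of "norm (u - u0)" r 2] by (simp add: power2_norm_eq_inner)
  then have "(u - u0) \<bullet> (u - u0) / r\<^sup>2 - 1 \<le> 0" using assms(1) by (simp add: divide_le_eq)
  then show ?thesis by (simp add: bump_def pos_square_def max_absorb1)
qed

lemma bump_eq_0: assumes "r > 0" "u \<notin> cball u0 (2 * r)" shows "bump u0 r u = 0"
proof -
  have "2 * r < norm (u - u0)" using assms(2) by (simp add: dist_norm norm_minus_commute)
  then have "(2 * r)\<^sup>2 \<le> (u - u0) \<bullet> (u - u0)"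
    using assms(1) power_mono[of "2 * r" "norm (u - u0)" 2] by (simp add: power2_norm_eq_inner)
  moreover have "2 * r\<^sup>2 \<le> (2 * r)\<^sup>2" by (simp add: power2_eq_square)
  ultimately have "2 * r\<^sup>2 \<le> (u - u0) \<bullet> (u - u0)" by linarith
  then have "1 \<le> (u - u0) \<bullet> (u - u0) / r\<^sup>2 - 1" using assms(1) by (simp add: le_divide_eq)
  then have "1 \<le> (max 0 ((u - u0) \<bullet> (u - u0) / r\<^sup>2 - 1))\<^sup>2"
    using power_mono[of 1 "max 0 ((u - u0) \<bullet> (u - u0) / r\<^sup>2 - 1)" 2] by simp
  then show ?thesis by (simp add: bump_def pos_square_def)
qed

section \<open>Integrals of derivatives of compactly supported functions\<close>

lemma continuous_compact_support_bounded:
  fixes f :: "'a::topological_space \<Rightarrow> real"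
  assumes "compact K" "continuous_on K f" "\<And>u. u \<notin> K \<Longrightarrow> f u = 0"
  obtains M where "M \<ge> 0" "\<And>u. \<bar>f u\<bar> \<le> M"
proof -
  have "bounded (f ` K)" using compact_continuous_image[OF assms(2,1)] compact_imp_bounded by blast
  then obtain M where M: "\<And>u. u \<in> K \<Longrightarrow> \<bar>f u\<bar> \<le> M" by (auto simp: bounded_iff)
  have "\<bar>f u\<bar> \<le> max 0 M" for u using M[of u] assms(3)[of u] by (cases "u \<in> K") auto
  then show ?thesis using that[of "max 0 M"] by simp
qed

text \<open>The difference quotients have integral zero by translation invariance.\<close>

lemma integral_directional_derivative_zero:
  fixes f D :: "'e::euclidean_space \<Rightarrow> real"
  assumes K: "compact K" and f0: "\<And>u. u \<notin> K \<Longrightarrow> f u = 0"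
    and f: "continuous_on UNIV f" and D: "continuous_on UNIV D"
    and der: "\<And>u. ((\<lambda>s. f (u + s *\<^sub>R v)) has_real_derivative D u) (at 0)"
  shows "integrable lborel D" "(LINT u|lborel. D u) = 0"
proof -
  have D0: "D u = 0" if "u \<notin> K" for u
  proof -
    have "open (- K)" using K compact_imp_closed by blast
    then have "open ((\<lambda>s. u + s *\<^sub>R v) -` (- K))"
      by (intro open_vimage) (auto intro!: continuous_intros)
    moreover have "((\<lambda>s::real. 0::real) has_real_derivative 0) (at 0)" by simp
    ultimately have "((\<lambda>s. f (u + s *\<^sub>R v)) has_real_derivative 0) (at 0)"
      using has_field_derivative_transform_within_open[of "\<lambda>s. 0" 0 0 "(\<lambda>s. u + s *\<^sub>R v) -` (- K)"] that f0 by simp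
    then show ?thesis by (rule DERIV_unique[OF der])
  qed
  obtain M where M: "M \<ge> 0" "\<And>u. \<bar>D u\<bar> \<le> M"
    using continuous_compact_support_bounded[OF K continuous_on_subset[OF D] D0] by auto
  have int: "integrable lborel g" if "continuous_on UNIV g" "\<And>u. u \<notin> K \<Longrightarrow> g u = 0" for g :: "'e \<Rightarrow> real"
  proof -
    have "integrable lborel (\<lambda>u. indicator K u *\<^sub>R g u)"
      by (rule borel_integrable_compact[OF K continuous_on_subset[OF that(1)]]) simp
    moreover have "(\<lambda>u. indicator K u *\<^sub>R g u) = g"
      by (rule ext) (use that(2) in \<open>auto simp: indicator_def\<close>)
    ultimately show ?thesis by simp
  qed
  show "integrable lborel D" by (rule int[OF D D0])
  \<comment> \<open>Steps of length at most 1 keep the supports of all the difference quotients in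
    the single ball \<open>?C\<close>.\<close>
  define h where "h n = 1 / real (Suc n)" for n
  have h: "0 < h n" "h n \<le> 1" for n by (auto simp: h_def)
  have h0: "h \<longlonglongrightarrow> 0" unfolding h_def by (rule LIMSEQ_inverse_real_of_nat[unfolded inverse_eq_divide])
  let ?q = "\<lambda>n u. (f (u + h n *\<^sub>R v) - f u) / h n"
  have shift: "continuous_on UNIV (\<lambda>u. f (u + c))" for c
    by (rule continuous_on_compose2[OF f]) (auto intro!: continuous_intros)
  have intf: "integrable lborel f" by (rule int[OF f f0])
  have f_meas[measurable]: "f \<in> borel_measurable borel" "(\<lambda>u. f (u + c)) \<in> borel_measurable borel" for c
    by (intro borel_measurable_continuous_onI f shift)+
  have trans: "integrable lborel (\<lambda>u. f (u + c))" "(LINT u|lborel. f (u + c)) = (LINT u|lborel. f u)" for c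
  proof -
    have *: "distr lborel borel ((+) c) = (lborel :: 'e measure)" by (rule lborel_distr_plus)
    show "integrable lborel (\<lambda>u. f (u + c))"
      using intf integrable_distr_eq[of "(+) c" lborel borel f] * by (simp add: add.commute)
    show "(LINT u|lborel. f (u + c)) = (LINT u|lborel. f u)"
      using integral_distr[of "(+) c" lborel borel f] * by (simp add: add.commute)
  qed
  have der': "((\<lambda>s. f (u + s *\<^sub>R v)) has_real_derivative D (u + s *\<^sub>R v)) (at s)" for u s
  proof -
    have "((\<lambda>r. f ((u + s *\<^sub>R v) + r *\<^sub>R v)) has_real_derivative D (u + s *\<^sub>R v)) (at (s - s))"
      using der[of "u + s *\<^sub>R v"] by simp
    moreover have "((\<lambda>r. r - s) has_real_derivative 1) (at s)" by (auto intro!: derivative_eq_intros)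
    ultimately have "((\<lambda>r. f ((u + s *\<^sub>R v) + (r - s) *\<^sub>R v)) has_real_derivative D (u + s *\<^sub>R v) * 1) (at s)"
      by (rule DERIV_chain2)
    then show ?thesis by (simp add: algebra_simps)
  qed
  \<comment> \<open>By the mean value theorem a quotient is a value of \<open>D\<close>, so the
    bound \<open>M\<close> of \<open>D\<close> dominates all of them.\<close>
  have q_bound: "\<bar>?q n u\<bar> \<le> M" for n u
  proof -
    have "\<exists>z. 0 < z \<and> z < h n \<and> f (u + h n *\<^sub>R v) - f (u + 0 *\<^sub>R v) = (h n - 0) * D (u + z *\<^sub>R v)"
      by (rule MVT2) (use h der' in auto)
    then obtain z where "f (u + h n *\<^sub>R v) - f u = h n * D (u + z *\<^sub>R v)" by auto
    then have "?q n u = D (u + z *\<^sub>R v)" using h[of n] by simp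
    then show ?thesis using M(2)[of "u + z *\<^sub>R v"] by simp
  qed
  obtain R where R: "\<And>w. w \<in> K \<Longrightarrow> norm w \<le> R"
    using compact_imp_bounded[OF K] unfolding bounded_iff by blast
  let ?C = "cball (0::'e) (R + norm v)"
  have q_supp: "?q n u = 0" if "u \<notin> ?C" for n u
  proof -
    have nu: "norm u > R + norm v" using that by simp
    have "norm u \<le> norm (u + h n *\<^sub>R v) + norm (h n *\<^sub>R v)"
      using norm_triangle_ineq4[of "u + h n *\<^sub>R v" "h n *\<^sub>R v"] by simp
    moreover have "norm (h n *\<^sub>R v) \<le> norm v" using h[of n] by (simp add: mult_left_le_one_le)
    ultimately have "norm (u + h n *\<^sub>R v) > R" using nu by linarith
    moreover have "norm u > R" using nu norm_ge_zero[of v] by linarith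
    moreover have "w \<notin> K" if "norm w > R" for w using R[of w] that by auto
    ultimately have "u + h n *\<^sub>R v \<notin> K" "u \<notin> K" by blast+
    then show ?thesis using f0 by simp
  qed
  have "(\<lambda>n. LINT u|lborel. ?q n u) \<longlonglongrightarrow> (LINT u|lborel. D u)"
  proof (rule integral_dominated_convergence)
    show "integrable lborel (\<lambda>u. indicator ?C u *\<^sub>R M)"
      by (rule borel_integrable_compact) auto
    show "AE u in lborel. (\<lambda>n. ?q n u) \<longlonglongrightarrow> D u"
    proof (rule AE_I2)
      fix u
      have "((\<lambda>s. (f (u + s *\<^sub>R v) - f u) / s) \<longlongrightarrow> D u) (at 0)"
        using der[of u] by (simp add: has_field_derivative_iff)
      moreover have "filterlim h (at 0) sequentially"
      proof -
        have "h n \<noteq> 0" for n using h(1)[of n] by simp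
        then show ?thesis by (simp add: filterlim_at h0)
      qed
      ultimately show "(\<lambda>n. ?q n u) \<longlonglongrightarrow> D u"
        by (rule filterlim_compose)
    qed
    show "AE u in lborel. norm (?q n u) \<le> indicator ?C u *\<^sub>R M" for n
    proof (rule AE_I2)
      fix u show "norm (?q n u) \<le> indicator ?C u *\<^sub>R M"
        using q_bound[of u n] q_supp[of u n] by (cases "u \<in> ?C") auto
    qed
    show "D \<in> borel_measurable lborel" using borel_measurable_continuous_onI[OF D] by simp
    show "?q n \<in> borel_measurable lborel" for n by measurable
  qed
  moreover have "(LINT u|lborel. ?q n u) = 0" for n
    using trans[of "h n *\<^sub>R v"] intf by simp
  ultimately have "(\<lambda>n. 0) \<longlonglongrightarrow> (LINT u|lborel. D u)" by (simp only:)
  from LIMSEQ_unique[OF this tendsto_const] show "(LINT u|lborel. D u) = 0" .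
qed

section \<open>Integration against the Riemannian measure\<close>

context atlas
begin

lemma chart_measure_eq_density:
  assumes y: "immersion \<A> y" and c: "c \<in> \<A>"
  shows "density (volume_measure \<A> y) (\<lambda>q. ennreal (indicator (chart_dom c) q)) = chart_measure c y"
proof (rule measure_eqI)
  note [measurable_cong] = sets_volume_measure[OF y]
  have dom[measurable]: "chart_dom c \<in> sets borel" using chart_open(1)[OF c] by simp
  show "sets (density (volume_measure \<A> y) (\<lambda>q. ennreal (indicator (chart_dom c) q))) = sets (chart_measure c y)"
    using sets_volume_measure[OF y] by simp
  fix B assume "B \<in> sets (density (volume_measure \<A> y) (\<lambda>q. ennreal (indicator (chart_dom c) q)))"
  then have B[measurable]: "B \<in> sets borel" using sets_volume_measure[OF y] by simp
  have "emeasure (density (volume_measure \<A> y) (\<lambda>q. ennreal (indicator (chart_dom c) q))) B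
     = (\<integral>\<^sup>+q. ennreal (indicator (chart_dom c) q) * indicator B q \<partial>volume_measure \<A> y)"
    by (rule emeasure_density) measurable
  also have "\<dots> = (\<integral>\<^sup>+q. indicator (B \<inter> chart_dom c) q \<partial>volume_measure \<A> y)"
    by (intro nn_integral_cong) (auto simp: indicator_def)
  also have "\<dots> = emeasure (volume_measure \<A> y) (B \<inter> chart_dom c)" by simp
  also have "\<dots> = emeasure (chart_measure c y) (B \<inter> chart_dom c)"
    by (rule emeasure_volume_measure[OF y c]) auto
  also have "\<dots> = (\<integral>\<^sup>+q. indicator (B \<inter> chart_dom c) q \<partial>chart_measure c y)" by simp
  also have "\<dots> = (\<integral>\<^sup>+u. ennreal (vol_density c y (param c u)) * indicator (B \<inter> chart_dom c) (param c u) * indicator (coord_range c) u \<partial>lborel)"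
    by (rule nn_integral_chart_measure[OF y c]) measurable
  also have "\<dots> = (\<integral>\<^sup>+u. ennreal (vol_density c y (param c u)) * indicator B (param c u) * indicator (coord_range c) u \<partial>lborel)"
    using c by (intro nn_integral_cong) (auto simp: indicator_def)
  also have "\<dots> = (\<integral>\<^sup>+q. indicator B q \<partial>chart_measure c y)"
    by (rule nn_integral_chart_measure[OF y c, symmetric]) measurable
  also have "\<dots> = emeasure (chart_measure c y) B" by simp
  finally show "emeasure (density (volume_measure \<A> y) (\<lambda>q. ennreal (indicator (chart_dom c) q))) B
    = emeasure (chart_measure c y) B" .
qed

lemma integral_volume_chart:
  fixes f :: "'a \<Rightarrow> real"
  assumes y: "immersion \<A> y" and c: "c \<in> \<A>" and f[measurable]: "f \<in> borel_measurable borel"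
    and f0: "\<And>q. q \<notin> chart_dom c \<Longrightarrow> f q = 0"
  shows "(LINT q|volume_measure \<A> y. f q)
       = (LINT u|lborel. indicator (coord_range c) u * (vol_density c y (param c u) * f (param c u)))"
proof -
  note [measurable_cong] = sets_volume_measure[OF y]
  have [measurable]: "chart_dom c \<in> sets borel" using chart_open(1)[OF c] by simp
  let ?P = "\<lambda>u. if u \<in> coord_range c then param c u else undefined"
  let ?w = "\<lambda>u. indicator (coord_range c) u *\<^sub>R vol_density c y (param c u)"
  have w[measurable]: "?w \<in> borel_measurable borel"
    using Ck_on_continuous_on[OF Ck_vol_density[OF y c]] chart_open(2)[OF c]
    by (intro borel_measurable_continuous_on_indicator) auto
  have w_nonneg: "0 \<le> ?w u" for u
    using vol_density_pos[OF y c param_in_dom[OF c]] by (auto simp: indicator_def less_imp_le)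
  note [measurable] = measurable_param[OF c]
  have cm: "chart_measure c y = distr (density lborel (\<lambda>u. ennreal (?w u))) borel ?P"
    unfolding chart_measure_def by (intro arg_cong[of _ _ "\<lambda>w. distr (density lborel w) borel ?P"]) (auto simp: indicator_def)
  have "(LINT q|volume_measure \<A> y. f q) = (LINT q|volume_measure \<A> y. indicator (chart_dom c) q *\<^sub>R f q)"
    using f0 by (intro Bochner_Integration.integral_cong) (auto simp: indicator_def)
  also have "\<dots> = (LINT q|density (volume_measure \<A> y) (\<lambda>q. ennreal (indicator (chart_dom c) q)). f q)"
    by (rule integral_density[symmetric]) auto
  also have "\<dots> = (LINT q|chart_measure c y. f q)"
    unfolding chart_measure_eq_density[OF y c] ..
  also have "\<dots> = (LINT u|density lborel (\<lambda>u. ennreal (?w u)). f (?P u))"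
    unfolding cm by (rule integral_distr) measurable
  also have "\<dots> = (LINT u|lborel. ?w u *\<^sub>R f (?P u))"
  proof (rule integral_density)
    show "(\<lambda>u. f (?P u)) \<in> borel_measurable lborel" by measurable
    show "?w \<in> borel_measurable lborel" using w by simp
    show "AE u in lborel. 0 \<le> ?w u" by (rule AE_I2) (rule w_nonneg)
  qed
  also have "\<dots> = (LINT u|lborel. indicator (coord_range c) u * (vol_density c y (param c u) * f (param c u)))"
    by (intro Bochner_Integration.integral_cong) (auto simp: indicator_def)
  finally show ?thesis .
qed

lemma compact_param_image:
  assumes "c \<in> \<A>" "compact C" "C \<subseteq> coord_range c" shows "compact (param c ` C)"
  by (rule compact_continuous_image[OF continuous_on_subset[OF param_continuous[OF assms(1)] assms(3)] assms(2)])

lemma open_param_image: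
  assumes "c \<in> \<A>" "open W" "W \<subseteq> coord_range c" shows "open (param c ` W)"
proof -
  have "q \<in> param c ` W \<longleftrightarrow> q \<in> chart_dom c \<and> coord c q \<in> W" for q
  proof
    assume "q \<in> param c ` W" then show "q \<in> chart_dom c \<and> coord c q \<in> W" using assms by auto
  next
    assume *: "q \<in> chart_dom c \<and> coord c q \<in> W"
    then have "param c (coord c q) \<in> param c ` W" by blast
    then show "q \<in> param c ` W" using * assms(1) by simp
  qed
  then have "param c ` W = chart_dom c \<inter> coord c -` W" by auto
  then show ?thesis
    using continuous_open_preimage[OF coord_continuous[OF assms(1)] chart_open(1)[OF assms(1)] assms(2)] by simp
qed

lemma chart_ball:
  obtains c r where "c \<in> \<A>" "q \<in> chart_dom c" "r > 0" "cball (coord c q) (2 * r) \<subseteq> coord_range c"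
proof -
  obtain c where c: "c \<in> \<A>" "q \<in> chart_dom c" by (rule chart_exists)
  then have "coord c q \<in> coord_range c" by blast
  then obtain e where "e > 0" "cball (coord c q) e \<subseteq> coord_range c"
    using chart_open(2)[OF c(1)] by (meson open_contains_cball)
  then show ?thesis using that[of c "e / 2"] c by simp
qed

text \<open>The density is bounded on a closed coordinate ball, so every point has an open
  neighbourhood of finite measure; finitely many of them cover \<open>K\<close>.\<close>

lemma emeasure_volume_compact:
  assumes y: "immersion \<A> y" and K: "compact K"
  shows "emeasure (volume_measure \<A> y) K < \<infinity>"
proof -
  note [measurable_cong] = sets_volume_measure[OF y]
  have "\<exists>N. open N \<and> q \<in> N \<and> emeasure (volume_measure \<A> y) N < \<infinity>" for q
  proof -
    obtain c r where c: "c \<in> \<A>" "q \<in> chart_dom c" and r: "r > 0" "cball (coord c q) (2 * r) \<subseteq> coord_range c"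
      by (rule chart_ball)
    let ?b = "ball (coord c q) r" let ?cb = "cball (coord c q) (2 * r)"
    have b: "?b \<subseteq> ?cb" "?b \<subseteq> coord_range c" using r by auto
    let ?N = "param c ` ?b"
    have N: "open ?N" by (rule open_param_image[OF c(1) open_ball b(2)])
    have "coord c q \<in> ?b" using r by simp
    then have "param c (coord c q) \<in> ?N" by blast
    then have "q \<in> ?N" using c by simp
    have "continuous_on ?cb (\<lambda>u. vol_density c y (param c u))"
      by (rule continuous_on_subset[OF Ck_on_continuous_on[OF Ck_vol_density[OF y c(1)]] r(2)])
    then have "bounded ((\<lambda>u. vol_density c y (param c u)) ` ?cb)"
      by (intro compact_imp_bounded compact_continuous_image) auto
    then obtain M where "\<forall>v\<in>(\<lambda>u. vol_density c y (param c u)) ` ?cb. norm v \<le> M"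
      unfolding bounded_iff by blast
    then have M: "vol_density c y (param c u) \<le> M" if "u \<in> ?cb" for u using that by (auto simp: abs_le_iff)
    have sub: "?N \<subseteq> chart_dom c" using b c by auto
    have "emeasure (volume_measure \<A> y) ?N = emeasure (chart_measure c y) ?N"
      by (rule emeasure_volume_measure[OF y c(1) borel_open[OF N] sub])
    also have "\<dots> = (\<integral>\<^sup>+u. ennreal (vol_density c y (param c u)) * indicator (coord c ` ?N) u \<partial>lborel)"
      by (rule emeasure_chart_measure[OF y c(1) borel_open[OF N] sub])
    also have "\<dots> \<le> (\<integral>\<^sup>+u. ennreal M * indicator ?cb u \<partial>lborel)"
    proof (rule nn_integral_mono)
      fix u
      have "u \<in> ?cb" if u: "u \<in> coord c ` ?N"
      proof -
        obtain w where w: "w \<in> ?b" "u = coord c (param c w)" using u by blast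
        then have "w \<in> coord_range c" using b by blast
        then show ?thesis using w b c by auto
      qed
      then show "ennreal (vol_density c y (param c u)) * indicator (coord c ` ?N) u \<le> ennreal M * indicator ?cb u"
        using M[of u] by (cases "u \<in> coord c ` ?N") (auto intro: ennreal_leI)
    qed
    also have "\<dots> = ennreal M * emeasure lborel ?cb" by (rule nn_integral_cmult_indicator) simp
    also have "\<dots> < \<infinity>"
      using emeasure_bounded_finite[of ?cb] by (simp add: ennreal_mult_less_top)
    finally show ?thesis using N \<open>q \<in> ?N\<close> by blast
  qed
  then obtain N where N: "\<And>q. open (N q)" "\<And>q. q \<in> N q" "\<And>q. emeasure (volume_measure \<A> y) (N q) < \<infinity>"
    by metis
  have cover: "K \<subseteq> (\<Union>q\<in>K. N q)" using N(2) by blast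
  obtain F where F: "F \<subseteq> K" "finite F" "K \<subseteq> (\<Union>q\<in>F. N q)"
    by (rule compactE_image[OF K N(1) cover])
  have "emeasure (volume_measure \<A> y) K \<le> emeasure (volume_measure \<A> y) (\<Union>q\<in>F. N q)"
    using N(1) by (intro emeasure_mono F(3)) (simp add: sets_volume_measure[OF y] borel_open open_UN)
  also have "\<dots> \<le> (\<Sum>q\<in>F. emeasure (volume_measure \<A> y) (N q))"
    using N(1) F(2) by (intro emeasure_subadditive_finite) (auto simp: sets_volume_measure[OF y] intro: borel_open)
  also have "\<dots> < \<infinity>" using N(3) F(2) by (simp add: less_top)
  finally show ?thesis .
qed

lemma integrable_volume_compact_support:
  fixes f :: "'a \<Rightarrow> real"
  assumes y: "immersion \<A> y" and K: "compact K" and f: "continuous_on UNIV f" "\<And>q. q \<notin> K \<Longrightarrow> f q = 0"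
  shows "integrable (volume_measure \<A> y) f"
proof -
  note [measurable_cong] = sets_volume_measure[OF y]
  obtain M where M: "M \<ge> 0" "\<And>u. \<bar>f u\<bar> \<le> M"
    using continuous_compact_support_bounded[OF K continuous_on_subset[OF f(1)] f(2)] by auto
  have "f \<in> borel_measurable borel" by (rule borel_measurable_continuous_onI[OF f(1)])
  then have "f \<in> borel_measurable (volume_measure \<A> y)" by simp
  moreover have "K \<in> sets (volume_measure \<A> y)"
    unfolding sets_volume_measure[OF y] by (rule borel_closed[OF compact_imp_closed[OF K]])
  ultimately show ?thesis
    using emeasure_volume_compact[OF y K] M(2) f(2)
    by (intro integrableI_bounded_set[where A = K and B = M]) auto
qed

text \<open>Turns the moving measures of a variation into densities over one fixed measure, so that
  only an integrand depends on time.\<close>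

lemma volume_measure_ratio:
  fixes y z :: "'a \<Rightarrow> 'b::euclidean_space"
  assumes y: "immersion \<A> y" and z: "immersion \<A> z"
    and r: "r \<in> borel_measurable borel" "\<And>c q. c \<in> \<A> \<Longrightarrow> q \<in> chart_dom c \<Longrightarrow> vol_density c z q = r q * vol_density c y q"
  shows "volume_measure \<A> z = density (volume_measure \<A> y) (\<lambda>q. ennreal (r q))"
proof (rule volume_measure_eqI)
  note [measurable_cong] = sets_volume_measure[OF y]
  note [measurable] = r(1)
  show "sets (volume_measure \<A> z) = sets borel" by (rule sets_volume_measure[OF z])
  show "sets (density (volume_measure \<A> y) (\<lambda>q. ennreal (r q))) = sets borel"
    using sets_volume_measure[OF y] by simp
  fix c B assume c: "c \<in> \<A>" and B[measurable]: "B \<in> sets borel" and sub: "B \<subseteq> chart_dom c"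
  have dom[measurable]: "chart_dom c \<in> sets borel" using chart_open(1)[OF c] by simp
  have rpos: "0 \<le> r q" if "q \<in> chart_dom c" for q
  proof -
    have "0 < r q * vol_density c y q" using vol_density_pos[OF z c that] r(2)[OF c that] by simp
    then show ?thesis using vol_density_pos[OF y c that] by (simp add: zero_less_mult_iff)
  qed
  have "emeasure (density (volume_measure \<A> y) (\<lambda>q. ennreal (r q))) B
     = (\<integral>\<^sup>+q. ennreal (r q) * indicator B q \<partial>volume_measure \<A> y)"
    by (rule emeasure_density) measurable
  also have "\<dots> = (\<integral>\<^sup>+q. ennreal (indicator (chart_dom c) q) * (ennreal (r q) * indicator B q) \<partial>volume_measure \<A> y)"
    using sub by (intro nn_integral_cong) (auto simp: indicator_def)
  also have "\<dots> = (\<integral>\<^sup>+q. ennreal (r q) * indicator B q \<partial>density (volume_measure \<A> y) (\<lambda>q. ennreal (indicator (chart_dom c) q)))"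
    by (rule nn_integral_density[symmetric]) measurable
  also have "\<dots> = (\<integral>\<^sup>+q. ennreal (r q) * indicator B q \<partial>chart_measure c y)"
    unfolding chart_measure_eq_density[OF y c] ..
  also have "\<dots> = (\<integral>\<^sup>+u. ennreal (vol_density c y (param c u)) * (ennreal (r (param c u)) * indicator B (param c u)) * indicator (coord_range c) u \<partial>lborel)"
    by (rule nn_integral_chart_measure[OF y c]) measurable
  also have "\<dots> = (\<integral>\<^sup>+u. ennreal (vol_density c z (param c u)) * indicator B (param c u) * indicator (coord_range c) u \<partial>lborel)"
  proof (rule nn_integral_cong)
    fix u
    have "ennreal (vol_density c y (param c u)) * ennreal (r (param c u)) = ennreal (vol_density c z (param c u))"
      if "u \<in> coord_range c"
      using r(2)[OF c param_in_dom[OF c that]] rpos[OF param_in_dom[OF c that]] vol_density_pos[OF y c param_in_dom[OF c that]]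
      by (simp add: ennreal_mult[symmetric] mult.commute)
    then show "ennreal (vol_density c y (param c u)) * (ennreal (r (param c u)) * indicator B (param c u)) * indicator (coord_range c) u
      = ennreal (vol_density c z (param c u)) * indicator B (param c u) * indicator (coord_range c) u"
      by (cases "u \<in> coord_range c") (auto simp: mult.assoc[symmetric])
  qed
  also have "\<dots> = (\<integral>\<^sup>+q. indicator B q \<partial>chart_measure c z)"
    by (rule nn_integral_chart_measure[OF z c, symmetric]) measurable
  also have "\<dots> = emeasure (volume_measure \<A> z) B"
    using emeasure_volume_measure[OF z c B sub] by simp
  finally show "emeasure (volume_measure \<A> z) B = emeasure (density (volume_measure \<A> y) (\<lambda>q. ennreal (r q))) B" ..
qed

end

section \<open>The divergence theorem on an immersed manifold\<close>

lemma integral_frechet_derivative_zero: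
  fixes f :: "'e::euclidean_space \<Rightarrow> real"
  assumes f: "Ck_on (Suc 0) UNIV f" and K: "compact K" and f0: "\<And>u. u \<notin> K \<Longrightarrow> f u = 0"
  shows "integrable lborel (\<lambda>u. frechet_derivative f (at u) v)" "(LINT u|lborel. frechet_derivative f (at u) v) = 0"
proof -
  have cont: "continuous_on UNIV f" by (rule Ck_on_continuous_on[OF f])
  have contD: "continuous_on UNIV (\<lambda>u. frechet_derivative f (at u) v)"
    by (rule Ck_on_continuous_on[OF Ck_on_frechet[OF f]])
  have "((\<lambda>s. f (u + s *\<^sub>R v)) has_real_derivative frechet_derivative f (at u) v) (at 0)" for u
  proof -
    have line: "((\<lambda>s. u + s *\<^sub>R v) has_derivative (\<lambda>s. s *\<^sub>R v)) (at 0)"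
      by (auto intro!: derivative_eq_intros)
    have fD: "(f has_derivative frechet_derivative f (at u)) (at (u + 0 *\<^sub>R v))"
      using Ck_on_SucD[OF f, of u] by simp
    have "((\<lambda>s. f (u + s *\<^sub>R v)) has_derivative (\<lambda>s. frechet_derivative f (at u) (s *\<^sub>R v))) (at 0)"
      using diff_chain_at[OF line fD] by (simp add: o_def)
    moreover have "frechet_derivative f (at u) (s *\<^sub>R v) = frechet_derivative f (at u) v * s" for s
      using linear_scale[OF has_derivative_linear[OF fD], of s v] by simp
    ultimately show ?thesis by (simp add: has_field_derivative_def)
  qed
  from integral_directional_derivative_zero[OF K f0 cont contD this]
  show "integrable lborel (\<lambda>u. frechet_derivative f (at u) v)" "(LINT u|lborel. frechet_derivative f (at u) v) = 0"
    by auto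
qed

context atlas
begin

lemma pd_zero_off_support:
  assumes "c \<in> \<A>" "q \<in> chart_dom c" "closed K" "q \<notin> K" "\<And>r. r \<notin> K \<Longrightarrow> f r = 0"
  shows "pd c i f q = 0"
proof -
  have "pd c i f q = pd c i (\<lambda>r. 0) q"
    by (rule pd_cong[OF assms(1), where W = "chart_dom c - K"])
      (use assms chart_open(1)[OF assms(1)] in \<open>auto intro: open_Diff\<close>)
  also have "\<dots> = 0" by (simp add: pd_def o_def)
  finally show ?thesis .
qed

lemma pd_add:
  assumes "c \<in> \<A>" "q \<in> chart_dom c" "Ck_on (Suc 0) (coord_range c) (f \<circ> param c)" "Ck_on (Suc 0) (coord_range c) (g \<circ> param c)"
  shows "pd c i (\<lambda>q. f q + g q) q = pd c i f q + pd c i g q"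
proof -
  have u: "coord c q \<in> coord_range c" using assms(2) by blast
  have "((\<lambda>q. f q + g q) \<circ> param c has_derivative
     (\<lambda>h. frechet_derivative (f \<circ> param c) (at (coord c q)) h + frechet_derivative (g \<circ> param c) (at (coord c q)) h)) (at (coord c q))"
    using has_derivative_add[OF Ck_on_SucD[OF assms(3) u] Ck_on_SucD[OF assms(4) u]] by (simp add: o_def)
  from pdI[OF this] show ?thesis by (simp add: pd_def)
qed

lemma chart_bump:
  obtains c \<beta> N K where "c \<in> \<A>" "open N" "q \<in> N" "compact K" "K \<subseteq> chart_dom c"
    "\<And>p. p \<in> N \<Longrightarrow> \<beta> p = (1::real)" "\<And>p. p \<notin> K \<Longrightarrow> \<beta> p = 0"
    "\<And>d. d \<in> \<A> \<Longrightarrow> Ck_on (Suc 0) (coord_range d) (\<beta> \<circ> param d)"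
proof -
  obtain c r where c: "c \<in> \<A>" "q \<in> chart_dom c" and r: "r > 0" "cball (coord c q) (2 * r) \<subseteq> coord_range c"
    by (rule chart_ball)
  let ?b = "ball (coord c q) r" let ?cb = "cball (coord c q) (2 * r)"
  define \<beta> where "\<beta> p = (if p \<in> chart_dom c then bump (coord c q) r (coord c p) else 0)" for p
  define N where "N = param c ` ?b"
  define K where "K = param c ` ?cb"
  have b: "?b \<subseteq> coord_range c" using r by auto
  have N: "open N" unfolding N_def by (rule open_param_image[OF c(1) open_ball b])
  have K: "compact K" unfolding K_def by (rule compact_param_image[OF c(1) compact_cball r(2)])
  have "coord c q \<in> ?b" using r by simp
  then have "param c (coord c q) \<in> N" unfolding N_def by blast
  then have q: "q \<in> N" using c by simp
  have Kdom: "K \<subseteq> chart_dom c"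
  proof
    fix p assume "p \<in> K"
    then obtain u where "u \<in> ?cb" "p = param c u" unfolding K_def by blast
    then show "p \<in> chart_dom c" using param_in_dom[OF c(1)] subsetD[OF r(2)] by simp
  qed
  have \<beta>1: "\<beta> p = 1" if pN: "p \<in> N" for p
  proof -
    obtain u where u: "u \<in> ?b" "p = param c u" using pN unfolding N_def by blast
    then have "u \<in> coord_range c" using b by blast
    then have "p \<in> chart_dom c" "coord c p = u" using u c(1) by auto
    then show ?thesis using bump_eq_1[OF r(1) u(1)] by (simp add: \<beta>_def)
  qed
  have \<beta>0: "\<beta> p = 0" if pK: "p \<notin> K" for p
  proof (cases "p \<in> chart_dom c")
    case True
    have "coord c p \<notin> ?cb"
    proof
      assume "coord c p \<in> ?cb"
      then have "param c (coord c p) \<in> K" unfolding K_def by (rule imageI)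
      then show False using pK True c(1) by simp
    qed
    then show ?thesis using True bump_eq_0[OF r(1)] by (simp add: \<beta>_def)
  qed (simp add: \<beta>_def)
  have "Ck_on (Suc 0) (coord_range d) (\<beta> \<circ> param d)" if d: "d \<in> \<A>" for d
  proof -
    \<comment> \<open>On \<open>?S\<close> the function is a composition with the transition map,
      and on \<open>?T\<close> it is 0. Since \<open>K\<close> is compact in a Hausdorff space and
      lies in the domain of \<open>c\<close>, both sets are open and cover the coordinate range of
      \<open>d\<close>.\<close>
    let ?S = "coord d ` (chart_dom d \<inter> chart_dom c)" let ?T = "coord_range d \<inter> param d -` (- K)"
    have S: "open ?S" by (rule open_overlap[OF d c(1)])
    have T: "open ?T"
      by (rule continuous_open_preimage[OF param_continuous[OF d] chart_open(2)[OF d]])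
        (simp add: K compact_imp_closed open_Compl)
    have "Ck_on (Suc 0) ?S (\<lambda>u. bump (coord c q) r ((coord c \<circ> param d) u))"
      by (rule Ck_on_compose[OF S transition_Ck[OF c(1) d] C1_bump]) simp
    moreover have "(\<beta> \<circ> param d) u = bump (coord c q) r ((coord c \<circ> param d) u)" if u: "u \<in> ?S" for u
    proof -
      obtain p where p: "p \<in> chart_dom d" "p \<in> chart_dom c" "u = coord d p" using u by blast
      then have "param d u = p" using d by simp
      then show ?thesis using p by (simp add: \<beta>_def)
    qed
    ultimately have 1: "Ck_on (Suc 0) ?S (\<beta> \<circ> param d)"
      using Ck_on_cong[OF S, of "\<beta> \<circ> param d" "\<lambda>u. bump (coord c q) r ((coord c \<circ> param d) u)"] by blast
    have "(\<beta> \<circ> param d) u = 0" if "u \<in> ?T" for u using that \<beta>0 by simp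
    then have 2: "Ck_on (Suc 0) ?T (\<beta> \<circ> param d)"
      using Ck_on_cong[OF T, of "\<beta> \<circ> param d" "\<lambda>u. 0"] Ck_on_const by blast
    have "?S \<union> ?T = coord_range d"
    proof
      show "coord_range d \<subseteq> ?S \<union> ?T"
      proof
        fix u assume u: "u \<in> coord_range d"
        then obtain p where p: "p \<in> chart_dom d" "u = coord d p" by blast
        then have "param d u = p" using d by simp
        then show "u \<in> ?S \<union> ?T" using p u Kdom by (cases "p \<in> K") auto
      qed
    qed auto
    then show ?thesis using Ck_on_Un[OF S T 1 2] by simp
  qed
  from that[OF c(1) N q K Kdom \<beta>1 \<beta>0 this] show ?thesis by simp
qed

end

text \<open>\<open>H\<close> is a field that agrees with the mean curvature computed in any chart,
  so that chart independence is part of the assumptions. For a \<xi>-submanifold the defining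
  equation supplies such a field, namely \<xi> minus the normal part of x.\<close>

locale immersed = atlas \<A> for \<A> :: "('a::{t2_space, second_countable_topology}, 'm::finite) chart set" +
  fixes x :: "'a \<Rightarrow> 'b::euclidean_space" and H :: "'a \<Rightarrow> 'b"
  assumes x: "immersion \<A> x"
    and H: "\<And>c q. c \<in> \<A> \<Longrightarrow> q \<in> chart_dom c \<Longrightarrow> mean_curvature c x q = H q"
begin

abbreviation fr :: "('a, 'm) chart \<Rightarrow> 'a \<Rightarrow> 'm \<Rightarrow> 'b" where
  "fr c q i \<equiv> pd c i x q"

abbreviation cofr :: "('a, 'm) chart \<Rightarrow> 'a \<Rightarrow> 'm \<Rightarrow> 'b" where
  "cofr c q \<equiv> dual (fr c q)"

text \<open>The class in which the divergence theorem is proved: it contains the products of smooth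
  fields with the cut-off functions.\<close>

definition C1 :: "('a \<Rightarrow> 'c::euclidean_space) \<Rightarrow> bool" where
  "C1 X \<longleftrightarrow> (\<forall>c\<in>\<A>. Ck_on (Suc 0) (coord_range c) (X \<circ> param c))"

text \<open>
  The divergence of an ambient vector field along the immersion.  The summand \<open>\<langle>H, X\<rangle>\<close> removes the
  contribution of the normal part of \<open>X\<close>.
\<close>

definition divg :: "('a, 'm) chart \<Rightarrow> ('a \<Rightarrow> 'b) \<Rightarrow> 'a \<Rightarrow> real" where
  "divg c X q = (\<Sum>i\<in>UNIV. pd c i X q \<bullet> cofr c q i) + H q \<bullet> X q"

lemma C1D: "C1 X \<Longrightarrow> c \<in> \<A> \<Longrightarrow> Ck_on (Suc 0) (coord_range c) (X \<circ> param c)"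
  unfolding C1_def by blast

lemma frame_x: "c \<in> \<A> \<Longrightarrow> q \<in> chart_dom c \<Longrightarrow> frame (fr c q)"
  by (rule immersion_frame[OF x])

lemma Ck_fr: "c \<in> \<A> \<Longrightarrow> Ck_on k (coord_range c) (\<lambda>u. fr c (param c u) i)"
  by (rule Ck_pd_immersion[OF x])

lemma Ck_cofr: "c \<in> \<A> \<Longrightarrow> Ck_on k (coord_range c) (\<lambda>u. cofr c (param c u) i)"
  by (rule Ck_on_dual[OF chart_open(2) Ck_fr]) (simp_all add: frame_x)

lemma tan_part_eq: "c \<in> \<A> \<Longrightarrow> q \<in> chart_dom c \<Longrightarrow> tan_part c x q v = proj (fr c q) v"
  unfolding tan_part_def tangent_space_def by (rule proj_unique[OF frame_x])

lemma inv_metric_eq: "c \<in> \<A> \<Longrightarrow> q \<in> chart_dom c \<Longrightarrow> inv_metric c x q $ i $ j = cofr c q i \<bullet> cofr c q j"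
  unfolding inv_metric_def metric_gram by (rule matrix_inv_gram[OF frame_x])

lemma sff_eq:
  "c \<in> \<A> \<Longrightarrow> q \<in> chart_dom c \<Longrightarrow> sff c x i j q = pd c i (pd c j x) q - proj (fr c q) (pd c i (pd c j x) q)"
  by (simp add: sff_def nor_part_def tan_part_eq)

lemma H_eq:
  "c \<in> \<A> \<Longrightarrow> q \<in> chart_dom c \<Longrightarrow> H q = (\<Sum>i\<in>UNIV. \<Sum>j\<in>UNIV. (cofr c q i \<bullet> cofr c q j) *\<^sub>R
     (pd c i (pd c j x) q - proj (fr c q) (pd c i (pd c j x) q)))"
  by (simp add: H[symmetric] mean_curvature_def inv_metric_eq sff_eq)

lemma Ck_pd_pd:
  assumes "c \<in> \<A>" shows "Ck_on k (coord_range c) (\<lambda>u. pd c i (pd c j x) (param c u))"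
proof -
  have "Ck_on (Suc k) (coord_range c) (pd c j x \<circ> param c)"
    using Ck_fr[OF assms, of "Suc k" j] by (simp only: o_def)
  from Ck_pd[OF assms this] show ?thesis by (simp only: o_def)
qed

lemma Ck_H:
  assumes c: "c \<in> \<A>" shows "Ck_on k (coord_range c) (\<lambda>u. H (param c u))"
proof -
  note op = chart_open(2)[OF c]
  let ?F = "\<lambda>u. \<Sum>i\<in>UNIV. \<Sum>j\<in>UNIV. (cofr c (param c u) i \<bullet> cofr c (param c u) j) *\<^sub>R
     (pd c i (pd c j x) (param c u) - proj (fr c (param c u)) (pd c i (pd c j x) (param c u)))"
  have "Ck_on k (coord_range c) ?F"
    unfolding proj_def
    by (intro Ck_on_sum Ck_on_scaleR Ck_on_inner Ck_on_diff op Ck_cofr[OF c] Ck_fr[OF c] Ck_pd_pd[OF c])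
  moreover have "H (param c u) = ?F u" if "u \<in> coord_range c" for u
    by (rule H_eq[OF c param_in_dom[OF c that]])
  ultimately show ?thesis
    using Ck_on_cong[OF op, of "\<lambda>u. H (param c u)" ?F] by blast
qed

lemma divg_chart_change:
  assumes X: "C1 X" and cd: "c \<in> \<A>" "d \<in> \<A>" and q: "q \<in> chart_dom c" "q \<in> chart_dom d"
  shows "divg d X q = divg c X q"
proof -
  have pdX: "pd d i X q = (\<Sum>k\<in>UNIV. jac c d q $ k $ i *\<^sub>R pd c k X q)" for i
    by (rule pd_chart_change[OF cd q differentiable_chart[OF cd(1) q(1) C1D[OF X cd(1)]]])
  have "(\<Sum>i\<in>UNIV. pd d i X q \<bullet> cofr d q i) = (\<Sum>k\<in>UNIV. pd c k X q \<bullet> cofr c q k)"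
    unfolding pdX
    by (rule trace_change[OF invertible_jac[OF cd q] immersion_frame_change[OF x cd q] frame_x[OF cd(1) q(1)] bounded_bilinear_inner])
  then show ?thesis by (simp add: divg_def)
qed

definition dvg :: "('a \<Rightarrow> 'b) \<Rightarrow> 'a \<Rightarrow> real" where
  "dvg X q = divg (chart_at \<A> q) X q"

lemma dvg_eq: "C1 X \<Longrightarrow> c \<in> \<A> \<Longrightarrow> q \<in> chart_dom c \<Longrightarrow> dvg X q = divg c X q"
  unfolding dvg_def by (rule divg_chart_change[OF _ _ chart_at(1) _ chart_at(2)])

lemma continuous_dvg: assumes X: "C1 X" shows "continuous_on UNIV (dvg X)"
proof (rule continuous_on_manifold)
  fix c assume c: "c \<in> \<A>"
  note op = chart_open(2)[OF c]
  have X0: "Ck_on 0 (coord_range c) (\<lambda>u. X (param c u))"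
    using Ck_on_Suc_imp[OF C1D[OF X c]] by (simp only: o_def)
  have X1: "Ck_on 0 (coord_range c) (\<lambda>u. pd c i X (param c u))" for i
    using Ck_pd[OF c C1D[OF X c]] by (simp only: o_def)
  have "Ck_on 0 (coord_range c) (\<lambda>u. divg c X (param c u))"
    unfolding divg_def
    by (intro Ck_on_add Ck_on_sum Ck_on_inner op X0 X1 Ck_cofr[OF c] Ck_H[OF c])
  then have "continuous_on (coord_range c) (\<lambda>u. divg c X (param c u))"
    by (rule Ck_on_continuous_on)
  moreover have "dvg X (param c u) = divg c X (param c u)" if "u \<in> coord_range c" for u
    by (rule dvg_eq[OF X c param_in_dom[OF c that]])
  ultimately show "continuous_on (coord_range c) (\<lambda>u. dvg X (param c u))"
    by (simp cong: continuous_on_cong)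
qed

lemma dvg_zero_off_support:
  assumes "closed K" "\<And>r. r \<notin> K \<Longrightarrow> X r = 0" "q \<notin> K"
  shows "dvg X q = 0"
proof -
  have "pd (chart_at \<A> q) i X q = 0" for i
    by (rule pd_zero_off_support[OF chart_at assms(1,3,2)])
  then show ?thesis using assms(2,3) by (simp add: dvg_def divg_def)
qed

lemma dvg_add:
  assumes "C1 X" "C1 Y" shows "dvg (\<lambda>q. X q + Y q) q = dvg X q + dvg Y q"
  unfolding dvg_def divg_def
  by (simp add: pd_add[OF chart_at C1D[OF assms(1) chart_at(1)] C1D[OF assms(2) chart_at(1)]]
      inner_add_left inner_add_right sum.distrib)

lemma C1_scaleR:
  assumes "C1 \<beta>" "C1 X" shows "C1 (\<lambda>q. \<beta> q *\<^sub>R X q)"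
  unfolding C1_def
proof
  fix c assume c: "c \<in> \<A>"
  show "Ck_on (Suc 0) (coord_range c) ((\<lambda>q. \<beta> q *\<^sub>R X q) \<circ> param c)"
    using Ck_on_scaleR[OF chart_open(2)[OF c] C1D[OF assms(1) c] C1D[OF assms(2) c]] by (simp only: o_def)
qed

lemma integrable_dvg:
  assumes "C1 X" "compact K" "\<And>q. q \<notin> K \<Longrightarrow> X q = 0"
  shows "integrable (volume_measure \<A> x) (dvg X)"
  by (rule integrable_volume_compact_support[OF x assms(2) continuous_dvg[OF assms(1)]])
    (rule dvg_zero_off_support[OF compact_imp_closed[OF assms(2)] assms(3)])

text \<open>The classical coordinate formula for the divergence. The fluxes \<open>Phi i\<close> are
  prescribed on the coordinate range only, because they will be extended by 0 to the whole
  coordinate space.\<close>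

lemma divg_coordinates:
  assumes c: "c \<in> \<A>" and X: "C1 X" and u: "u \<in> coord_range c"
    and Phi: "\<And>i. (Phi i has_derivative Phi' i) (at u)"
    "\<And>i u. u \<in> coord_range c \<Longrightarrow> Phi i u = vol_density c x (param c u) * (X (param c u) \<bullet> cofr c (param c u) i)"
  shows "(\<Sum>i\<in>UNIV. Phi' i (axis i 1)) = vol_density c x (param c u) * divg c X (param c u)"
proof -
  note op = chart_open(2)[OF c]
  let ?y = "x \<circ> param c" let ?Y = "X \<circ> param c"
  let ?a = "\<lambda>i u. frechet_derivative ?y (at u) (axis i 1)"
  have a: "?a i w = fr c (param c w) i" if "w \<in> coord_range c" for i w
    by (rule pd_param[OF c that, symmetric])
  have fra: "frame (\<lambda>i. ?a i w)" if "w \<in> coord_range c" for w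
    using frame_x[OF c param_in_dom[OF c that]] by (simp only: a[OF that])
  have Phi2: "Phi i w = vol (\<lambda>i. ?a i w) * (?Y w \<bullet> dual (\<lambda>i. ?a i w) i)" if "w \<in> coord_range c" for i w
    using Phi(2)[OF that, of i] by (simp only: a[OF that] vol_density_vol comp_apply)
  have da: "frechet_derivative (?a j) (at u) (axis i 1) = pd c i (pd c j x) (param c u)" for i j
  proof -
    have "Ck_on (Suc 0) (coord_range c) (pd c j x \<circ> param c)"
      using Ck_fr[OF c, of "Suc 0" j] by (simp only: o_def)
    from Ck_on_SucD[OF this u]
    have "(?a j has_derivative frechet_derivative (pd c j x \<circ> param c) (at u)) (at u)"
      by (rule has_derivative_transform_within_open[OF _ op u]) (simp add: a del: o_apply, simp)
    from frechet_derivative_at[OF this] show ?thesis by (simp add: pd_param[OF c u])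
  qed
  have "(\<Sum>i\<in>UNIV. Phi' i (axis i 1)) = vol (\<lambda>i. ?a i u) *
     ((\<Sum>i\<in>UNIV. frechet_derivative ?Y (at u) (axis i 1) \<bullet> dual (\<lambda>i. ?a i u) i) +
      (\<Sum>i\<in>UNIV. \<Sum>j\<in>UNIV. (dual (\<lambda>i. ?a i u) i \<bullet> dual (\<lambda>i. ?a i u) j) *\<^sub>R
         (frechet_derivative (?a j) (at u) (axis i 1) - proj (\<lambda>i. ?a i u) (frechet_derivative (?a j) (at u) (axis i 1)))) \<bullet> ?Y u)"
    by (rule divergence_identity[OF op u immersion_Ck[OF x c] Ck_on_SucD[OF C1D[OF X c] u] fra Phi(1) Phi2])
  also have "\<dots> = vol_density c x (param c u) * divg c X (param c u)"
    unfolding da a[OF u]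
    by (simp add: divg_def vol_density_vol H_eq[OF c param_in_dom[OF c u]] pd_param[OF c u])
  finally show ?thesis .
qed

text \<open>The support lies in one chart, so the coordinate fluxes extended by 0 are
  \<open>C\<^sup>1\<close> with compact support on the whole coordinate space, and each of their
  partial derivatives integrates to 0.\<close>

lemma divergence_theorem_chart:
  assumes X: "C1 X" and K: "compact K" "K \<subseteq> chart_dom c" "\<And>q. q \<notin> K \<Longrightarrow> X q = 0" and c: "c \<in> \<A>"
  shows "(LINT q|volume_measure \<A> x. dvg X q) = 0"
proof -
  note op = chart_open(2)[OF c]
  let ?K = "coord c ` K"
  have K': "compact ?K"
    by (rule compact_continuous_image[OF continuous_on_subset[OF coord_continuous[OF c] K(2)] K(1)])
  have KR: "?K \<subseteq> coord_range c" using K(2) by blast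
  define Psi where "Psi i u = vol_density c x (param c u) * (X (param c u) \<bullet> cofr c (param c u) i)" for i u
  define Phi where "Phi i u = (if u \<in> coord_range c then Psi i u else 0)" for i u
  have Phi0: "Phi i u = 0" if u: "u \<notin> ?K" for i u
  proof (cases "u \<in> coord_range c")
    case True
    have "param c u \<notin> K"
    proof
      assume "param c u \<in> K"
      then have "coord c (param c u) \<in> ?K" by (rule imageI)
      then show False using u True c by simp
    qed
    then show ?thesis using K(3) by (simp add: Phi_def Psi_def)
  qed (simp add: Phi_def)
  have T: "open (- ?K)" using compact_imp_closed[OF K'] by (rule open_Compl)
  have cov: "coord_range c \<union> - ?K = UNIV" using KR by blast
  have X1: "Ck_on (Suc 0) (coord_range c) (\<lambda>u. X (param c u))"
    using C1D[OF X c] by (simp only: o_def)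
  have "Ck_on (Suc 0) (coord_range c) (Psi i)" for i
    unfolding Psi_def[abs_def]
    by (intro Ck_on_mult Ck_on_inner op X1 Ck_cofr[OF c] Ck_vol_density[OF x c])
  then have 1: "Ck_on (Suc 0) (coord_range c) (Phi i)" for i
    using Ck_on_cong[OF op, of "Phi i" "Psi i"] Phi_def by simp
  have 2: "Ck_on (Suc 0) (- ?K) (Phi i)" for i
    using Ck_on_cong[OF T, of "Phi i" "\<lambda>u. 0"] Phi0 Ck_on_const by blast
  have Phi1: "Ck_on (Suc 0) UNIV (Phi i)" for i
    using Ck_on_Un[OF op T 1 2] unfolding cov .
  have sum: "(\<Sum>i\<in>UNIV. frechet_derivative (Phi i) (at u) (axis i 1))
      = indicator (coord_range c) u * (vol_density c x (param c u) * dvg X (param c u))" for u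
  proof (cases "u \<in> coord_range c")
    case True
    have "(\<Sum>i\<in>UNIV. frechet_derivative (Phi i) (at u) (axis i 1)) = vol_density c x (param c u) * divg c X (param c u)"
      by (rule divg_coordinates[OF c X True Ck_on_SucD[OF Phi1 UNIV_I]]) (simp add: Phi_def Psi_def)
    then show ?thesis using True by (simp add: dvg_eq[OF X c param_in_dom[OF c True]])
  next
    case False
    then have u: "u \<in> - ?K" using KR by blast
    have "frechet_derivative (Phi i) (at u) (axis i 1) = 0" for i
    proof -
      have "(Phi i has_derivative (\<lambda>h. 0)) (at u)"
        by (rule has_derivative_transform_within_open[OF has_derivative_const T u]) (simp add: Phi0)
      from frechet_derivative_at[OF this] show ?thesis by metis
    qed
    then show ?thesis using False by simp
  qed
  have "(LINT q|volume_measure \<A> x. dvg X q)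
      = (LINT u|lborel. indicator (coord_range c) u * (vol_density c x (param c u) * dvg X (param c u)))"
  proof (rule integral_volume_chart[OF x c borel_measurable_continuous_onI[OF continuous_dvg[OF X]]])
    fix q assume "q \<notin> chart_dom c"
    then have "q \<notin> K" using K(2) by blast
    from dvg_zero_off_support[OF compact_imp_closed[OF K(1)] K(3) this] show "dvg X q = 0" by simp
  qed
  also have "\<dots> = (LINT u|lborel. (\<Sum>i\<in>UNIV. frechet_derivative (Phi i) (at u) (axis i 1)))"
    by (simp only: sum)
  also have "\<dots> = (\<Sum>i\<in>UNIV. (LINT u|lborel. frechet_derivative (Phi i) (at u) (axis i 1)))"
    by (rule Bochner_Integration.integral_sum) (rule integral_frechet_derivative_zero(1)[OF Phi1 K' Phi0])
  also have "\<dots> = 0"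
    by (simp add: integral_frechet_derivative_zero(2)[OF Phi1 K' Phi0])
  finally show ?thesis .
qed

text \<open>Induction over a finite cover in place of a partition of unity. Split \<open>X\<close>
  as \<open>\<beta> X + (1 - \<beta>) X\<close>: the first part lives in one chart, and the second
  vanishes on the neighbourhood where \<open>\<beta>\<close> is 1, so its support is covered by the
  remaining neighbourhoods.\<close>

theorem divergence_theorem:
  assumes X: "C1 X" and K: "compact K" "\<And>q. q \<notin> K \<Longrightarrow> X q = 0"
  shows "(LINT q|volume_measure \<A> x. dvg X q) = 0"
proof -
  \<comment> \<open>Bundles the neighbourhood with its cut-off function, so that both are chosen
    together for every point.\<close>
  define good where "good q t \<longleftrightarrow> (case t of (N, \<beta>) \<Rightarrow> open N \<and> q \<in> N \<and> C1 \<beta> \<and> (\<forall>p\<in>N. \<beta> p = 1) \<and>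
     (\<exists>c\<in>\<A>. \<exists>C. compact C \<and> C \<subseteq> chart_dom c \<and> (\<forall>p. p \<notin> C \<longrightarrow> \<beta> p = 0)))"
    for q and t :: "'a set \<times> ('a \<Rightarrow> real)"
  have "\<exists>t. good q t" for q
  proof -
    obtain c \<beta> N C where t: "c \<in> \<A>" "open N" "q \<in> N" "compact C" "C \<subseteq> chart_dom c"
      "\<And>p. p \<in> N \<Longrightarrow> \<beta> p = (1::real)" "\<And>p. p \<notin> C \<Longrightarrow> \<beta> p = 0"
      "\<And>d. d \<in> \<A> \<Longrightarrow> Ck_on (Suc 0) (coord_range d) (\<beta> \<circ> param d)"
      by (rule chart_bump[of q]) blast
    have "C1 \<beta>" unfolding C1_def using t(8) by blast
    then have "good q (N, \<beta>)" unfolding good_def using t by auto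
    then show ?thesis by (rule exI)
  qed
  then obtain t where t: "\<And>q. good q (t q)" by metis
  define N where "N q = fst (t q)" for q
  define \<beta> where "\<beta> q = snd (t q)" for q
  have N: "open (N q)" "q \<in> N q" and \<beta>: "C1 (\<beta> q)" "\<And>p. p \<in> N q \<Longrightarrow> \<beta> q p = 1"
    and C: "\<exists>c\<in>\<A>. \<exists>C. compact C \<and> C \<subseteq> chart_dom c \<and> (\<forall>p. p \<notin> C \<longrightarrow> \<beta> q p = 0)" for q
    using t[of q] unfolding good_def N_def \<beta>_def by (auto simp: case_prod_unfold)
  have cover: "K \<subseteq> (\<Union>q\<in>K. N q)" using N(2) by blast
  obtain J where J: "J \<subseteq> K" "finite J" "K \<subseteq> (\<Union>q\<in>J. N q)"
    by (rule compactE_image[OF K(1) N(1) cover])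
  \<comment> \<open>Stated for all fields and compact sets, because the induction replaces
    \<open>X\<close> by \<open>(1 - \<beta>) X\<close> and \<open>K\<close> by
    \<open>K - N j\<close>.\<close>
  have "(LINT q|volume_measure \<A> x. dvg X q) = 0"
    if "finite J" "C1 X" "compact K" "\<forall>q. q \<notin> K \<longrightarrow> X q = 0" "K \<subseteq> (\<Union>q\<in>J. N q)" for J X K
    using that
  proof (induction J arbitrary: X K rule: finite_induct)
    case empty
    then have "X q = 0" for q by simp
    then have "dvg X q = 0" for q by (intro dvg_zero_off_support[of "{}"]) auto
    then show ?case by simp
  next
    case (insert j J)
    have X0: "X q = 0" if "q \<notin> K" for q using insert.prems(3) that by blast
    let ?Y = "\<lambda>q. \<beta> j q *\<^sub>R X q" let ?Z = "\<lambda>q. (1 - \<beta> j q) *\<^sub>R X q"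
    have Y: "C1 ?Y" by (rule C1_scaleR[OF \<beta>(1) insert.prems(1)])
    have "C1 (\<lambda>q. 1 - \<beta> j q)"
      unfolding C1_def
    proof
      fix c assume c: "c \<in> \<A>"
      show "Ck_on (Suc 0) (coord_range c) ((\<lambda>q. 1 - \<beta> j q) \<circ> param c)"
        using Ck_on_diff[OF chart_open(2)[OF c] Ck_on_const C1D[OF \<beta>(1) c]] by (simp only: o_def)
    qed
    then have Z: "C1 ?Z" by (rule C1_scaleR[OF _ insert.prems(1)])
    have Y0: "?Y q = 0" and Z0: "?Z q = 0" if "q \<notin> K" for q using X0[OF that] by simp_all
    obtain c C' where c: "c \<in> \<A>" "compact C'" "C' \<subseteq> chart_dom c" "\<And>p. p \<notin> C' \<Longrightarrow> \<beta> j p = 0"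
      using C[of j] by blast
    have intY: "(LINT q|volume_measure \<A> x. dvg ?Y q) = 0"
      by (rule divergence_theorem_chart[OF Y c(2,3) _ c(1)]) (simp add: c(4))
    have intZ: "(LINT q|volume_measure \<A> x. dvg ?Z q) = 0"
    proof (rule insert.IH[OF Z])
      show "compact (K - N j)" using insert.prems(2) N(1) by (rule compact_diff)
      show "\<forall>q. q \<notin> K - N j \<longrightarrow> ?Z q = 0"
      proof (intro allI impI)
        fix q assume "q \<notin> K - N j"
        then show "?Z q = 0" using Z0[of q] \<beta>(2)[of q j] by (cases "q \<in> N j") auto
      qed
      show "K - N j \<subseteq> (\<Union>q\<in>J. N q)" using insert.prems(4) by auto
    qed
    have "dvg X q = dvg ?Y q + dvg ?Z q" for q
    proof -
      have "X = (\<lambda>q. ?Y q + ?Z q)" by (rule ext) (simp add: scaleR_add_left[symmetric])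
      then have "dvg X q = dvg (\<lambda>q. ?Y q + ?Z q) q" by (rule arg_cong[of _ _ "\<lambda>X. dvg X q"])
      then show ?thesis by (simp only: dvg_add[OF Y Z])
    qed
    then have "(LINT q|volume_measure \<A> x. dvg X q) = (LINT q|volume_measure \<A> x. dvg ?Y q + dvg ?Z q)"
      by simp
    also have "\<dots> = 0"
      using integrable_dvg[OF Y insert.prems(2) Y0] integrable_dvg[OF Z insert.prems(2) Z0] intY intZ
      by (simp add: Bochner_Integration.integral_add)
    finally show ?case .
  qed
  from this[OF J(2) X K(1) _ J(3)] K(2) show ?thesis by blast
qed

end

context atlas
begin

lemma pd_bilinear:
  assumes B: "bounded_bilinear B" and c: "c \<in> \<A>" "q \<in> chart_dom c"
    and f: "Ck_on (Suc 0) (coord_range c) (f \<circ> param c)" and g: "Ck_on (Suc 0) (coord_range c) (g \<circ> param c)"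
  shows "pd c i (\<lambda>r. B (f r) (g r)) q = B (f q) (pd c i g q) + B (pd c i f q) (g q)"
proof -
  have u: "coord c q \<in> coord_range c" using c(2) by blast
  from bounded_bilinear.FDERIV[OF B Ck_on_SucD[OF f u] Ck_on_SucD[OF g u]]
  have "((\<lambda>r. B (f r) (g r)) \<circ> param c has_derivative
     (\<lambda>h. B ((f \<circ> param c) (coord c q)) (frechet_derivative (g \<circ> param c) (at (coord c q)) h) +
          B (frechet_derivative (f \<circ> param c) (at (coord c q)) h) ((g \<circ> param c) (coord c q)))) (at (coord c q))"
    by (simp add: o_def)
  from pdI[OF this] show ?thesis using c by (simp add: pd_def)
qed

lemmas pd_inner = pd_bilinear[OF bounded_bilinear_inner]
lemmas pd_scaleR = pd_bilinear[OF bounded_bilinear_scaleR]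

lemma pd_cong_dom:
  assumes "c \<in> \<A>" "q \<in> chart_dom c" "\<And>r. r \<in> chart_dom c \<Longrightarrow> f r = g r"
  shows "pd c i f q = pd c i g q"
  by (rule pd_cong[OF assms(1,2) order.refl chart_open(1)[OF assms(1)] assms(3)])

lemma pd_const: "pd c i (\<lambda>r. k) q = 0"
  by (simp add: pd_def o_def)

end

section \<open>The geometry of a \<open>\<xi>\<close>-submanifold\<close>

text \<open>For \<open>d i\<close> the derivative of a normal field along the coordinate field
  \<open>i\<close>, the numbers \<open>d i \<bullet> a j\<close> are minus the components of the
  second fundamental form in the direction of that field. The left side is the term of the theorem,
  the right side the trace of the squared shape operator that comes out of the second derivative of
  the volume.\<close>

lemma normal_second_form_square:
  fixes a :: "'m::finite \<Rightarrow> 'b::euclidean_space"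
  assumes a: "frame a" and sym: "\<And>i j. d i \<bullet> a j = d j \<bullet> a i"
  shows "(\<Sum>i\<in>UNIV. \<Sum>j\<in>UNIV. \<Sum>k\<in>UNIV. \<Sum>l\<in>UNIV.
      (dual a i \<bullet> dual a k) * (dual a j \<bullet> dual a l) * ((d i \<bullet> a j) * (d k \<bullet> a l)))
    = (\<Sum>i\<in>UNIV. \<Sum>j\<in>UNIV. (d i \<bullet> dual a j) * (d j \<bullet> dual a i))"
proof -
  let ?g = "\<lambda>i j. dual a i \<bullet> dual a j" let ?h = "\<lambda>i j. d i \<bullet> a j"
  have ex: "d i \<bullet> dual a j = (\<Sum>l\<in>UNIV. ?g j l * ?h i l)" for i j
    by (subst dual_eq[OF a, of j]) (simp add: inner_sum_right)
  have "(\<Sum>i\<in>UNIV. \<Sum>j\<in>UNIV. (d i \<bullet> dual a j) * (d j \<bullet> dual a i))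
      = (\<Sum>i\<in>UNIV. \<Sum>j\<in>UNIV. \<Sum>l\<in>UNIV. \<Sum>k\<in>UNIV. ?g j l * ?h i l * (?g i k * ?h j k))"
    unfolding ex by (simp add: sum_product)
  also have "\<dots> = (\<Sum>i\<in>UNIV. \<Sum>l\<in>UNIV. \<Sum>j\<in>UNIV. \<Sum>k\<in>UNIV. ?g j l * ?h i l * (?g i k * ?h j k))"
    by (rule sum.cong[OF refl]) (rule sum.swap)
  also have "\<dots> = (\<Sum>i\<in>UNIV. \<Sum>l\<in>UNIV. \<Sum>k\<in>UNIV. \<Sum>j\<in>UNIV. ?g j l * ?h i l * (?g i k * ?h j k))"
    by (rule sum.cong[OF refl], rule sum.cong[OF refl]) (rule sum.swap)
  also have "\<dots> = (\<Sum>i\<in>UNIV. \<Sum>j\<in>UNIV. \<Sum>k\<in>UNIV. \<Sum>l\<in>UNIV. ?g i k * ?g j l * (?h i j * ?h k l))"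
  proof (intro sum.cong refl)
    fix i j k l :: 'm
    show "?g l j * ?h i j * (?g i k * ?h l k) = ?g i k * ?g j l * (?h i j * ?h k l)"
      using sym[of l k] by (simp add: inner_commute[of "dual a l" "dual a j"])
  qed
  finally show ?thesis ..
qed

locale xi_immersion = atlas \<A> for \<A> :: "('a::{t2_space, second_countable_topology}, 'm::finite) chart set" +
  fixes \<xi> x :: "'a \<Rightarrow> 'b::euclidean_space"
  assumes xi: "xi_submanifold \<A> \<xi> x"
begin

lemma immersion_x: "immersion \<A> x"
  using xi by (simp add: xi_submanifold_def)

lemma tan_part_chart:
  assumes "c \<in> \<A>" "d \<in> \<A>" "q \<in> chart_dom c" "q \<in> chart_dom d"
  shows "tan_part d x q v = tan_part c x q v"
proof -
  have "tangent_space d x q = tangent_space c x q"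
    unfolding tangent_space_def
    by (rule span_change[OF invertible_jac[OF assms] immersion_frame_change[OF immersion_x assms]
        immersion_frame[OF immersion_x assms(1,3)]])
  then show ?thesis by (simp add: tan_part_def)
qed

definition xtan :: "'a \<Rightarrow> 'b" where "xtan q = tan_part (chart_at \<A> q) x q (x q)"

lemma xtan: "c \<in> \<A> \<Longrightarrow> q \<in> chart_dom c \<Longrightarrow> tan_part c x q (x q) = xtan q"
  unfolding xtan_def by (rule tan_part_chart[OF chart_at(1) _ chart_at(2)])

sublocale immersed \<A> x "\<lambda>q. \<xi> q - (x q - xtan q)"
proof
  fix c q assume c: "c \<in> \<A>" "q \<in> chart_dom c"
  have "mean_curvature c x q + nor_part c x q (x q) = \<xi> q"
    using xi c unfolding xi_submanifold_def by blast
  then show "mean_curvature c x q = \<xi> q - (x q - xtan q)"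
    by (simp add: nor_part_def xtan[OF c] algebra_simps)
qed (rule immersion_x)

lemma normal_fieldD:
  "normal_field \<A> x \<nu> \<Longrightarrow> c \<in> \<A> \<Longrightarrow> q \<in> chart_dom c \<Longrightarrow> \<nu> q \<bullet> fr c q i = 0"
  unfolding normal_field_def tangent_space_def orthogonal_def using span_base[of "fr c q i" "range (fr c q)"] by blast

lemma normal_field_Ck: "normal_field \<A> x \<nu> \<Longrightarrow> c \<in> \<A> \<Longrightarrow> Ck_on k (coord_range c) (\<nu> \<circ> param c)"
  unfolding normal_field_def by (auto intro: smooth_map_Ck)

lemma Ck_fr': "c \<in> \<A> \<Longrightarrow> Ck_on k (coord_range c) (pd c j x \<circ> param c)"
  using Ck_fr[of c k j] by (simp only: o_def)

lemma pd_pd_commute: "c \<in> \<A> \<Longrightarrow> q \<in> chart_dom c \<Longrightarrow> pd c i (pd c j x) q = pd c j (pd c i x) q"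
  by (rule pd_commute[OF _ _ immersion_Ck[OF x]])

text \<open>Differentiate the vanishing product of the normal field with a coordinate field: the
  Weingarten equation.\<close>

lemma normal_derivative:
  assumes nu: "normal_field \<A> x \<nu>" and c: "c \<in> \<A>" "q \<in> chart_dom c"
  shows "pd c i \<nu> q \<bullet> fr c q j = - (pd c i (pd c j x) q \<bullet> \<nu> q)"
proof -
  have "0 = pd c i (\<lambda>r. \<nu> r \<bullet> fr c r j) q"
    using pd_cong_dom[OF c, of "\<lambda>r. \<nu> r \<bullet> fr c r j" "\<lambda>r. 0" i] normal_fieldD[OF nu c(1)] by (simp add: pd_const)
  also have "\<dots> = \<nu> q \<bullet> pd c i (pd c j x) q + pd c i \<nu> q \<bullet> fr c q j"
    by (rule pd_inner[OF c normal_field_Ck[OF nu c(1)] Ck_fr'[OF c(1)]])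
  finally show ?thesis by (simp add: inner_commute)
qed

lemma normal_derivative_sym:
  assumes nu: "normal_field \<A> x \<nu>" and c: "c \<in> \<A>" "q \<in> chart_dom c"
  shows "pd c i \<nu> q \<bullet> fr c q j = pd c j \<nu> q \<bullet> fr c q i"
  by (simp only: normal_derivative[OF assms] pd_pd_commute[OF c, of i j])

lemma normal_proj:
  assumes "normal_field \<A> x \<nu>" "c \<in> \<A>" "q \<in> chart_dom c"
  shows "proj (fr c q) v \<bullet> \<nu> q = 0"
  by (simp add: proj_def inner_sum_left inner_commute[of "pd _ _ _ _"] normal_fieldD[OF assms])

lemma sff_normal:
  assumes nu: "normal_field \<A> x \<nu>" and c: "c \<in> \<A>" "q \<in> chart_dom c"
  shows "sff c x i j q \<bullet> \<nu> q = - (pd c i \<nu> q \<bullet> fr c q j)"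
  by (simp add: sff_eq[OF c] inner_diff_left normal_proj[OF assms] normal_derivative[OF assms])

lemma xi_normal: "normal_field \<A> x \<xi>"
  using xi by (simp add: xi_submanifold_def)

lemma pd_xi_tangent:
  assumes c: "c \<in> \<A>" "q \<in> chart_dom c" shows "pd c i \<xi> q = proj (fr c q) (pd c i \<xi> q)"
proof -
  have "nconn c x i \<xi> q = 0"
    using xi c unfolding xi_submanifold_def parallel_normal_def by blast
  then show ?thesis by (simp add: nconn_def nor_part_def tan_part_eq[OF c])
qed

lemma pd_xi_span: "c \<in> \<A> \<Longrightarrow> q \<in> chart_dom c \<Longrightarrow> pd c i \<xi> q \<in> span (range (fr c q))"
  by (subst pd_xi_tangent) (simp_all add: proj_in_span)

lemma pd_xi_xi: "c \<in> \<A> \<Longrightarrow> q \<in> chart_dom c \<Longrightarrow> pd c i \<xi> q \<bullet> \<xi> q = 0"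
  by (subst pd_xi_tangent) (simp_all add: normal_proj[OF xi_normal])

lemma gradient_eq:
  assumes c: "c \<in> \<A>" "q \<in> chart_dom c"
  shows "gradient c x u q = (\<Sum>i\<in>UNIV. pd c i u q *\<^sub>R cofr c q i)"
  unfolding gradient_def dual_def inv_metric_def metric_gram
  by (simp add: scaleR_sum_right mult.commute)

lemma gradient_chart:
  assumes "C1 u" "c \<in> \<A>" "d \<in> \<A>" "q \<in> chart_dom c" "q \<in> chart_dom d"
  shows "gradient d x u q = gradient c x u q"
proof -
  have pdu: "pd d i u q = (\<Sum>k\<in>UNIV. jac c d q $ k $ i *\<^sub>R pd c k u q)" for i
    by (rule pd_chart_change[OF assms(2-5) differentiable_chart[OF assms(2,4) C1D[OF assms(1,2)]]])
  have "(\<Sum>i\<in>UNIV. pd d i u q *\<^sub>R cofr d q i) = (\<Sum>k\<in>UNIV. pd c k u q *\<^sub>R cofr c q k)"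
    unfolding pdu
    by (rule trace_change[OF invertible_jac[OF assms(2-5)] immersion_frame_change[OF x assms(2-5)]
          frame_x[OF assms(2,4)] bounded_bilinear_scaleR])
  then show ?thesis using gradient_eq assms(2-5) by simp
qed

lemma gradient_x_xi:
  assumes c: "c \<in> \<A>" "q \<in> chart_dom c"
  shows "gradient c x (\<lambda>r. x r \<bullet> \<xi> r) q = (\<Sum>i\<in>UNIV. (x q \<bullet> pd c i \<xi> q) *\<^sub>R cofr c q i)"
proof -
  have "pd c i (\<lambda>r. x r \<bullet> \<xi> r) q = x q \<bullet> pd c i \<xi> q" for i
    using pd_inner[OF c immersion_Ck[OF x c(1)] normal_field_Ck[OF xi_normal c(1)], of i]
      normal_fieldD[OF xi_normal c, of i] by (simp add: inner_commute)
  then show ?thesis by (simp add: gradient_eq[OF c])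
qed

text \<open>A parallel normal field has tangent derivatives, so its shape operator is minus its
  derivative. By the symmetry of the second fundamental form the value at \<open>xtan\<close> has
  the components \<open>- (x q \<bullet> pd c i \<xi> q)\<close>, and these belong to minus the
  gradient.\<close>

lemma weingarten_xtan:
  assumes c: "c \<in> \<A>" "q \<in> chart_dom c"
  shows "weingarten c x \<xi> q (xtan q) = - gradient c x (\<lambda>r. x r \<bullet> \<xi> r) q"
proof -
  let ?S = "span (range (fr c q))" let ?W = "- gradient c x (\<lambda>r. x r \<bullet> \<xi> r) q"
  note fr = frame_x[OF c]
  have xt: "xtan q = proj (fr c q) (x q)" using xtan[OF c] tan_part_eq[OF c] by simp
  have comp: "tan_comp c x q v $ i = v \<bullet> cofr c q i" if "v \<in> ?S" for v i
    unfolding tan_comp_def by (simp add: the_components[OF fr that])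
  have W: "?W \<in> ?S"
    unfolding gradient_eq[OF c] by (intro span_neg span_sum span_scale dual_in_span)
  have form: "?W \<bullet> Y = second_form c x q (xtan q) Y \<bullet> \<xi> q" if Y: "Y \<in> ?S" for Y
  proof -
    have "second_form c x q (xtan q) Y \<bullet> \<xi> q
       = (\<Sum>i\<in>UNIV. \<Sum>j\<in>UNIV. (xtan q \<bullet> cofr c q i) * (Y \<bullet> cofr c q j) * (sff c x i j q \<bullet> \<xi> q))"
      unfolding second_form_def using comp[OF Y] comp[of "xtan q"] proj_in_span[of "fr c q" "x q"]
      by (simp add: inner_sum_left xt)
    also have "\<dots> = - (\<Sum>i\<in>UNIV. \<Sum>j\<in>UNIV. (xtan q \<bullet> cofr c q i) * (Y \<bullet> cofr c q j) * (pd c j \<xi> q \<bullet> fr c q i))"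
      by (simp add: sff_normal[OF xi_normal c] normal_derivative_sym[OF xi_normal c, of _ _] sum_negf
          normal_derivative[OF xi_normal c] pd_pd_commute[OF c])
    also have "\<dots> = - (\<Sum>j\<in>UNIV. \<Sum>i\<in>UNIV. (xtan q \<bullet> cofr c q i) * (Y \<bullet> cofr c q j) * (pd c j \<xi> q \<bullet> fr c q i))"
      by (subst sum.swap) (rule refl)
    also have "\<dots> = - (\<Sum>j\<in>UNIV. (Y \<bullet> cofr c q j) * (pd c j \<xi> q \<bullet> proj (fr c q) (xtan q)))"
      by (simp add: proj_def inner_sum_right sum_distrib_left mult_ac)
    also have "\<dots> = - (\<Sum>j\<in>UNIV. (Y \<bullet> cofr c q j) * (pd c j \<xi> q \<bullet> x q))"
    proof -
      \<comment> \<open>The derivative of \<xi> is tangent and does not see the normal part of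
        x.\<close>
      have "pd c j \<xi> q \<bullet> proj (fr c q) (xtan q) = pd c j \<xi> q \<bullet> x q" for j
        using proj_inner_span[OF fr pd_xi_span[OF c], of "xtan q" j] proj_inner_span[OF fr pd_xi_span[OF c], of "x q" j]
        by (simp add: xt inner_commute)
      then show ?thesis by simp
    qed
    also have "\<dots> = ?W \<bullet> Y"
      unfolding gradient_x_xi[OF c] by (simp add: inner_sum_left inner_sum_right inner_commute mult.commute)
    finally show ?thesis ..
  qed
  show ?thesis
    unfolding weingarten_def tangent_space_def
  proof (rule the_equality)
    show "?W \<in> ?S \<and> (\<forall>Y\<in>?S. ?W \<bullet> Y = second_form c x q (xtan q) Y \<bullet> \<xi> q)"
      using W form by blast
    fix Z assume Z: "Z \<in> ?S \<and> (\<forall>Y\<in>?S. Z \<bullet> Y = second_form c x q (xtan q) Y \<bullet> \<xi> q)"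
    have "Z \<bullet> fr c q i = ?W \<bullet> fr c q i" for i
    proof -
      have i: "fr c q i \<in> ?S" by (rule span_base) blast
      show ?thesis using form[OF i] Z i by simp
    qed
    then show "Z = ?W" using span_eqI[OF fr _ W] Z by blast
  qed
qed

text \<open>Of the six second-derivative terms in the combination of metric derivatives, four cancel
  because partial derivatives commute, and the other two are equal.\<close>

lemma christoffel_eq:
  assumes c: "c \<in> \<A>" "q \<in> chart_dom c"
  shows "christoffel c x k i j q = pd c i (pd c j x) q \<bullet> cofr c q k"
proof -
  have dg: "pd c i (\<lambda>r. metric c x r $ j $ l) q = fr c q j \<bullet> pd c i (pd c l x) q + pd c i (pd c j x) q \<bullet> fr c q l" for i j l
    unfolding metric_def using pd_inner[OF c Ck_fr'[OF c(1)] Ck_fr'[OF c(1)], of i j l] by simp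
  have "pd c i (\<lambda>r. metric c x r $ j $ l) q + pd c j (\<lambda>r. metric c x r $ i $ l) q - pd c l (\<lambda>r. metric c x r $ i $ j) q
     = 2 * (fr c q l \<bullet> pd c i (pd c j x) q)" for l
    unfolding dg pd_pd_commute[OF c, of l i] pd_pd_commute[OF c, of l j] pd_pd_commute[OF c, of j i]
    by (simp add: inner_commute)
  then show ?thesis
    unfolding christoffel_def inv_metric_def metric_gram[symmetric] dual_def
    by (simp add: inner_sum_right sum_distrib_left sum_divide_distrib metric_gram inner_commute)
qed

lemma Ck_half_square:
  assumes "normal_field \<A> x \<eta>" "c \<in> \<A>"
  shows "Ck_on k (coord_range c) ((\<lambda>r. \<eta> r \<bullet> \<eta> r / 2) \<circ> param c)"
proof -
  have "Ck_on k (coord_range c) (\<lambda>u. \<eta> (param c u))" for k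
    using normal_field_Ck[OF assms, of k] by (simp only: o_def)
  then show ?thesis
    unfolding o_def divide_inverse by (intro Ck_on_mult Ck_on_inner chart_open(2)[OF assms(2)] Ck_on_const)
qed

lemma pd_half_square:
  assumes eta: "normal_field \<A> x \<eta>" and c: "c \<in> \<A>" "r \<in> chart_dom c"
  shows "pd c j (\<lambda>r. \<eta> r \<bullet> \<eta> r / 2) r = pd c j \<eta> r \<bullet> \<eta> r"
proof -
  note eta_Ck = normal_field_Ck[OF eta c(1)]
  have eta_Ck': "Ck_on k (coord_range c) (\<lambda>u. \<eta> (param c u))" for k using eta_Ck[of k] by (simp only: o_def)
  have "pd c j (\<lambda>r. (1/2) *\<^sub>R (\<eta> r \<bullet> \<eta> r)) r = (1/2) *\<^sub>R pd c j (\<lambda>r. \<eta> r \<bullet> \<eta> r) r + pd c j (\<lambda>r. 1/2::real) r *\<^sub>R (\<eta> r \<bullet> \<eta> r)"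
    by (rule pd_scaleR[OF c]) (unfold o_def, intro Ck_on_const, intro Ck_on_inner chart_open(2)[OF c(1)] eta_Ck')
  also have "\<dots> = pd c j \<eta> r \<bullet> \<eta> r"
    by (simp add: pd_const pd_inner[OF c eta_Ck eta_Ck] inner_commute)
  finally show ?thesis by simp
qed

lemma nconn_eq: "c \<in> \<A> \<Longrightarrow> q \<in> chart_dom c \<Longrightarrow> nconn c x j \<nu> q = pd c j \<nu> q - proj (fr c q) (pd c j \<nu> q)"
  by (simp add: nconn_def nor_part_def tan_part_eq)

lemma nconn_inner:
  assumes eta: "normal_field \<A> x \<eta>" and c: "c \<in> \<A>" "q \<in> chart_dom c"
  shows "nconn c x j \<eta> q \<bullet> \<eta> q = pd c j (\<lambda>r. \<eta> r \<bullet> \<eta> r / 2) q"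
  by (simp add: nconn_eq[OF c] pd_half_square[OF assms] inner_diff_left normal_proj[OF assms])

lemma tan_comp_eq:
  assumes c: "c \<in> \<A>" "q \<in> chart_dom c" and v: "v \<in> span (range (fr c q))"
  shows "tan_comp c x q v $ i = v \<bullet> cofr c q i"
  unfolding tan_comp_def by (simp add: the_components[OF frame_x[OF c] v])

text \<open>\<open>\<triangle>\<^sup>\<bottom>\<close> pairs with a normal field \<open>\<eta>\<close> as in Bochner's formula for \<open>|\<eta>|\<^sup>2 / 2\<close>.\<close>

lemma normal_laplacian_inner:
  assumes eta: "normal_field \<A> x \<eta>" and c: "c \<in> \<A>" "q \<in> chart_dom c"
    and G: "G = (\<lambda>r. gradient c x (\<lambda>r. \<eta> r \<bullet> \<eta> r / 2) r)"
  shows "normal_laplacian c x \<eta> q \<bullet> \<eta> q = (\<Sum>i\<in>UNIV. pd c i G q \<bullet> cofr c q i)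
     - (\<Sum>i\<in>UNIV. \<Sum>j\<in>UNIV. (cofr c q i \<bullet> cofr c q j) * (nconn c x i \<eta> q \<bullet> nconn c x j \<eta> q))"
proof -
  note fr = frame_x[OF c] note op = chart_open(2)[OF c(1)]
  let ?U = "\<lambda>r. \<eta> r \<bullet> \<eta> r / 2"
  note eta_Ck = normal_field_Ck[OF eta c(1)]
  have deta_Ck: "Ck_on k (coord_range c) (pd c j \<eta> \<circ> param c)" for k j by (rule Ck_pd[OF c(1) eta_Ck])
  note U_Ck = Ck_half_square[OF eta c(1)]
  have dU_Ck: "Ck_on k (coord_range c) (pd c j ?U \<circ> param c)" for k j by (rule Ck_pd[OF c(1) U_Ck])
  have dU_Ck': "Ck_on k (coord_range c) (\<lambda>u. pd c j ?U (param c u))" for k j using dU_Ck[of k j] by (simp only: o_def)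
  have G_eq: "G r = (\<Sum>i\<in>UNIV. pd c i ?U r *\<^sub>R cofr c r i)" if "r \<in> chart_dom c" for r
    unfolding G by (rule gradient_eq[OF c(1) that])
  have G_Ck: "Ck_on (Suc 0) (coord_range c) (G \<circ> param c)"
  proof -
    let ?G = "\<lambda>u. \<Sum>i\<in>UNIV. pd c i ?U (param c u) *\<^sub>R cofr c (param c u) i"
    have "Ck_on (Suc 0) (coord_range c) ?G"
      by (intro Ck_on_sum Ck_on_scaleR op dU_Ck' Ck_cofr[OF c(1)])
    then show ?thesis
      using Ck_on_cong[OF op, of "G \<circ> param c" ?G] G_eq param_in_dom[OF c(1)] by simp
  qed
  note nconn = nconn_eq[OF c(1)] note nconn_eta = nconn_inner[OF eta c(1)]
  have nconn_Ck: "Ck_on (Suc 0) (coord_range c) (nconn c x j \<eta> \<circ> param c)" for j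
  proof -
    let ?N = "\<lambda>u. pd c j \<eta> (param c u) - proj (fr c (param c u)) (pd c j \<eta> (param c u))"
    have "Ck_on (Suc 0) (coord_range c) ?N"
      unfolding proj_def
      using deta_Ck[of "Suc 0" j, unfolded o_def]
      by (intro Ck_on_sum Ck_on_scaleR Ck_on_inner Ck_on_diff op Ck_cofr[OF c(1)] Ck_fr[OF c(1)])
    then show ?thesis
      using Ck_on_cong[OF op, of "nconn c x j \<eta> \<circ> param c" ?N] nconn param_in_dom[OF c(1)] by simp
  qed
  have ddU: "pd c i (pd c j ?U) q = nconn c x j \<eta> q \<bullet> pd c i \<eta> q + pd c i (nconn c x j \<eta>) q \<bullet> \<eta> q" for i j
  proof -
    have "pd c i (pd c j ?U) q = pd c i (\<lambda>r. nconn c x j \<eta> r \<bullet> \<eta> r) q"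
      by (rule pd_cong_dom[OF c]) (simp add: nconn_eta)
    also have "\<dots> = nconn c x j \<eta> q \<bullet> pd c i \<eta> q + pd c i (nconn c x j \<eta>) q \<bullet> \<eta> q"
      by (rule pd_inner[OF c nconn_Ck eta_Ck])
    finally show ?thesis .
  qed
  \<comment> \<open>A normal derivative is normal, so the tangential part of the derivative of
    \<eta> drops out of the product.\<close>
  have nn: "nconn c x j \<eta> q \<bullet> pd c i \<eta> q = nconn c x i \<eta> q \<bullet> nconn c x j \<eta> q" for i j
  proof -
    have "nconn c x j \<eta> q \<bullet> fr c q k = 0" for k
      by (simp add: nconn[OF c(2)] inner_diff_left proj_inner_frame[OF fr])
    then have "nconn c x j \<eta> q \<bullet> proj (fr c q) (pd c i \<eta> q) = 0"
      by (simp add: proj_def inner_sum_right)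
    then show ?thesis
      by (subst inner_commute[of "nconn c x i \<eta> q"]) (simp add: nconn[OF c(2), of i] inner_diff_right)
  qed
  have second: "nconn c x i (nconn c x j \<eta>) q \<bullet> \<eta> q = pd c i (pd c j ?U) q - nconn c x i \<eta> q \<bullet> nconn c x j \<eta> q" for i j
    using ddU[of i j] nn[of j i] normal_proj[OF eta c]
    by (simp add: nconn_def[of c x i "nconn c x j \<eta>"] nor_part_def tan_part_eq[OF c] inner_diff_left)
  have GU: "G r \<bullet> fr c r l = pd c l ?U r" if "r \<in> chart_dom c" for l r
    by (simp add: G_eq[OF that] inner_sum_left inner_dual_frame[OF frame_x[OF c(1) that]] if_distrib[of "\<lambda>z. _ * z"] cong: if_cong)
  \<comment> \<open>Differentiating the relation \<open>GU\<close>, instead of the formula for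
    \<open>G\<close>, avoids derivatives of the dual frame.\<close>
  have dG: "pd c k G q \<bullet> fr c q l = pd c k (pd c l ?U) q - G q \<bullet> pd c k (pd c l x) q" for k l
  proof -
    have "pd c k (pd c l ?U) q = pd c k (\<lambda>r. G r \<bullet> fr c r l) q"
      by (rule pd_cong_dom[OF c]) (simp add: GU)
    also have "\<dots> = G q \<bullet> pd c k (pd c l x) q + pd c k G q \<bullet> fr c q l"
      by (rule pd_inner[OF c G_Ck Ck_fr'[OF c(1)]])
    finally show ?thesis by simp
  qed
  \<comment> \<open>\<open>G\<close> is tangent, so pairing it with a second derivative of x sees
    only the Christoffel part. This matches the correction terms of the Laplacian with those of the
    divergence of \<open>G\<close>.\<close>
  have chr: "(\<Sum>k\<in>UNIV. christoffel c x k i j q * pd c k ?U q) = G q \<bullet> pd c i (pd c j x) q" for i j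
    unfolding G_eq[OF c(2)] by (simp add: christoffel_eq[OF c] inner_sum_left inner_sum_right inner_commute mult.commute)
  have "(\<Sum>i\<in>UNIV. pd c i G q \<bullet> cofr c q i)
     = (\<Sum>i\<in>UNIV. \<Sum>j\<in>UNIV. (cofr c q i \<bullet> cofr c q j) * (pd c i (pd c j ?U) q - G q \<bullet> pd c i (pd c j x) q))"
  proof (rule sum.cong[OF refl])
    fix i
    show "pd c i G q \<bullet> cofr c q i = (\<Sum>j\<in>UNIV. (cofr c q i \<bullet> cofr c q j) * (pd c i (pd c j ?U) q - G q \<bullet> pd c i (pd c j x) q))"
      by (subst (1) dual_eq[OF fr]) (simp add: inner_sum_right dG)
  qed
  moreover have "normal_laplacian c x \<eta> q \<bullet> \<eta> q = (\<Sum>i\<in>UNIV. \<Sum>j\<in>UNIV. (cofr c q i \<bullet> cofr c q j) *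
      (pd c i (pd c j ?U) q - nconn c x i \<eta> q \<bullet> nconn c x j \<eta> q - G q \<bullet> pd c i (pd c j x) q))"
    by (simp add: normal_laplacian_def inv_metric_eq[OF c] inner_sum_left inner_diff_left second nconn_eta[OF c(2)] chr)
  ultimately show ?thesis
    by (simp add: sum_subtractf right_diff_distrib)
qed

definition grad :: "('a \<Rightarrow> real) \<Rightarrow> 'a \<Rightarrow> 'b" where
  "grad u q = gradient (chart_at \<A> q) x u q"

lemma grad_eq: "C1 u \<Longrightarrow> c \<in> \<A> \<Longrightarrow> q \<in> chart_dom c \<Longrightarrow> grad u q = gradient c x u q"
  unfolding grad_def by (rule gradient_chart[OF _ _ chart_at(1) _ chart_at(2)])

lemma C1_grad:
  assumes u: "\<And>c. c \<in> \<A> \<Longrightarrow> Ck_on (Suc (Suc 0)) (coord_range c) (u \<circ> param c)"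
  shows "C1 (grad u)"
  unfolding C1_def
proof
  fix c assume c: "c \<in> \<A>"
  note op = chart_open(2)[OF c]
  have u1: "C1 u" unfolding C1_def using u Ck_on_Suc_imp by blast
  let ?G = "\<lambda>v. \<Sum>i\<in>UNIV. pd c i u (param c v) *\<^sub>R cofr c (param c v) i"
  have "Ck_on (Suc 0) (coord_range c) (\<lambda>v. pd c i u (param c v))" for i
    using Ck_pd[OF c u[OF c]] by (simp only: o_def)
  then have "Ck_on (Suc 0) (coord_range c) ?G"
    by (intro Ck_on_sum Ck_on_scaleR op Ck_cofr[OF c])
  moreover have "(grad u \<circ> param c) v = ?G v" if "v \<in> coord_range c" for v
    using grad_eq[OF u1 c param_in_dom[OF c that]] gradient_eq[OF c param_in_dom[OF c that]] by simp
  ultimately show "Ck_on (Suc 0) (coord_range c) (grad u \<circ> param c)"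
    using Ck_on_cong[OF op, of "grad u \<circ> param c" ?G] by blast
qed

text \<open>
  The quantity \<open>A2\<close> is \<open>\<partial>\<^sub>t\<^sup>2 log\<close> of the weighted density; together with the integrand of the
  theorem it is a divergence.
\<close>

lemma integrand_identity:
  assumes eta: "normal_field \<A> x \<eta>" and Z: "C1 Z" and w: "C1 w"
    and dw: "\<And>i. pd (chart_at \<A> q) i w q = - (w q * (x q \<bullet> fr (chart_at \<A> q) q i - x q \<bullet> pd (chart_at \<A> q) i \<xi> q))"
    and F: "\<And>r. dt F r 0 = \<eta> r" "vector_derivative (dt F q) (at 0) = Z q"
    and c_def: "c = chart_at \<A> q"
    and A2: "A2 = - (\<eta> q \<bullet> \<eta> q) - (x q - \<xi> q) \<bullet> Z q + (\<Sum>i\<in>UNIV. pd c i Z q \<bullet> cofr c q i)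
       - (\<Sum>i\<in>UNIV. \<Sum>j\<in>UNIV. (pd c i \<eta> q \<bullet> cofr c q j) * (pd c j \<eta> q \<bullet> cofr c q i))
       + (\<Sum>i\<in>UNIV. \<Sum>j\<in>UNIV. (cofr c q i \<bullet> cofr c q j) * (nconn c x i \<eta> q \<bullet> nconn c x j \<eta> q))"
  shows "dvg (\<lambda>r. w r *\<^sub>R (Z r + grad (\<lambda>r. \<eta> r \<bullet> \<eta> r / 2) r)) q
       = w q * (A2 + second_variation_integrand \<A> \<xi> x F q)"
proof -
  have c: "c \<in> \<A>" "q \<in> chart_dom c" unfolding c_def by (rule chart_at)+
  note fr = frame_x[OF c]
  let ?U = "\<lambda>r. \<eta> r \<bullet> \<eta> r / 2"
  let ?G = "grad ?U" let ?Y = "\<lambda>r. Z r + ?G r"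
  let ?NN = "\<Sum>i\<in>UNIV. \<Sum>j\<in>UNIV. (cofr c q i \<bullet> cofr c q j) * (nconn c x i \<eta> q \<bullet> nconn c x j \<eta> q)"
  let ?Q = "\<Sum>i\<in>UNIV. \<Sum>j\<in>UNIV. (pd c i \<eta> q \<bullet> cofr c q j) * (pd c j \<eta> q \<bullet> cofr c q i)"
  have U1: "C1 ?U" unfolding C1_def using Ck_half_square[OF eta] by blast
  have G1: "C1 ?G" by (rule C1_grad[OF Ck_half_square[OF eta]])
  have Y1: "C1 ?Y" unfolding C1_def
  proof
    fix d assume d: "d \<in> \<A>"
    show "Ck_on (Suc 0) (coord_range d) (?Y \<circ> param d)"
      using Ck_on_add[OF chart_open(2)[OF d] C1D[OF Z d] C1D[OF G1 d]] by (simp only: o_def)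
  qed
  have dG: "pd c i ?G q = pd c i (\<lambda>r. gradient c x ?U r) q" for i
    by (rule pd_cong_dom[OF c]) (rule grad_eq[OF U1 c(1)])
  have lap: "normal_laplacian c x \<eta> q \<bullet> \<eta> q = (\<Sum>i\<in>UNIV. pd c i ?G q \<bullet> cofr c q i) - ?NN"
    unfolding dG by (rule normal_laplacian_inner[OF eta c refl])
  have G_eq: "?G q = (\<Sum>i\<in>UNIV. pd c i ?U q *\<^sub>R cofr c q i)"
    using grad_eq[OF U1 c] gradient_eq[OF c] by simp
  \<comment> \<open>By the assumption \<open>dw\<close>, this is minus the logarithmic gradient of
    \<open>w\<close>. Its pairing with \<open>?G\<close> will be the connection term.\<close>
  define V where "V = xtan q + weingarten c x \<xi> q (xtan q)"
  have xt: "xtan q = proj (fr c q) (x q)" using xtan[OF c] tan_part_eq[OF c] by simp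
  have V_eq: "V = (\<Sum>i\<in>UNIV. (x q \<bullet> fr c q i - x q \<bullet> pd c i \<xi> q) *\<^sub>R cofr c q i)"
    unfolding V_def weingarten_xtan[OF c] gradient_x_xi[OF c] unfolding xt proj_eq_dual[OF fr]
    by (simp add: scaleR_diff_left sum_subtractf)
  have V_span: "V \<in> span (range (fr c q))"
    unfolding V_eq by (intro span_sum span_scale dual_in_span)
  have conn: "normal_connection c x V \<eta> q \<bullet> \<eta> q = V \<bullet> ?G q"
    unfolding normal_connection_def G_eq
    by (simp add: inner_sum_left inner_sum_right tan_comp_eq[OF c V_span] nconn_inner[OF eta c] mult.commute)
  have hh: "(\<Sum>i\<in>UNIV. \<Sum>j\<in>UNIV. \<Sum>k\<in>UNIV. \<Sum>l\<in>UNIV.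
      (inv_metric c x q $ i $ k * inv_metric c x q $ j $ l * (sff c x i j q \<bullet> \<eta> q)) *\<^sub>R sff c x k l q) \<bullet> \<eta> q = ?Q"
  proof -
    have "(\<Sum>i\<in>UNIV. \<Sum>j\<in>UNIV. \<Sum>k\<in>UNIV. \<Sum>l\<in>UNIV.
      (inv_metric c x q $ i $ k * inv_metric c x q $ j $ l * (sff c x i j q \<bullet> \<eta> q)) *\<^sub>R sff c x k l q) \<bullet> \<eta> q
      = (\<Sum>i\<in>UNIV. \<Sum>j\<in>UNIV. \<Sum>k\<in>UNIV. \<Sum>l\<in>UNIV. (cofr c q i \<bullet> cofr c q k) * (cofr c q j \<bullet> cofr c q l) *
          ((pd c i \<eta> q \<bullet> fr c q j) * (pd c k \<eta> q \<bullet> fr c q l)))"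
      by (simp add: inner_sum_left inv_metric_eq[OF c] sff_normal[OF eta c] mult.assoc)
    also have "\<dots> = ?Q"
      by (rule normal_second_form_square[OF fr normal_derivative_sym[OF eta c]])
    finally show ?thesis .
  qed
  have integrand: "second_variation_integrand \<A> \<xi> x F q
     = (\<Sum>i\<in>UNIV. pd c i ?G q \<bullet> cofr c q i) - ?NN - V \<bullet> ?G q + ?Q + \<eta> q \<bullet> \<eta> q
       + gradient c x (\<lambda>r. x r \<bullet> \<xi> r) q \<bullet> Z q"
  proof -
    have "second_variation_integrand \<A> \<xi> x F q
     = (normal_laplacian c x \<eta> q - normal_connection c x V \<eta> q
            + (\<Sum>i\<in>UNIV. \<Sum>j\<in>UNIV. \<Sum>k\<in>UNIV. \<Sum>l\<in>UNIV.
      (inv_metric c x q $ i $ k * inv_metric c x q $ j $ l * (sff c x i j q \<bullet> \<eta> q)) *\<^sub>R sff c x k l q)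
            + \<eta> q) \<bullet> \<eta> q + gradient c x (\<lambda>r. x r \<bullet> \<xi> r) q \<bullet> Z q"
      unfolding second_variation_integrand_def Let_def F c_def[symmetric] V_def xtan[OF c] ..
    then show ?thesis by (simp only: inner_add_left inner_diff_left lap conn hh)
  qed
  have dX: "pd c i (\<lambda>r. w r *\<^sub>R ?Y r) q = w q *\<^sub>R (pd c i Z q + pd c i ?G q) + pd c i w q *\<^sub>R ?Y q" for i
    using pd_scaleR[OF c C1D[OF w c(1)] C1D[OF Y1 c(1)], of i] pd_add[OF c C1D[OF Z c(1)] C1D[OF G1 c(1)], of i] by simp
  have "(\<Sum>i\<in>UNIV. pd c i w q * (?Y q \<bullet> cofr c q i)) = - (w q * (V \<bullet> ?Y q))"
    unfolding V_eq c_def dw[folded c_def]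
    by (simp add: dw inner_sum_left inner_sum_right sum_distrib_left sum_negf inner_commute mult.assoc)
  then have sumX: "(\<Sum>i\<in>UNIV. pd c i (\<lambda>r. w r *\<^sub>R ?Y r) q \<bullet> cofr c q i)
     = w q * ((\<Sum>i\<in>UNIV. pd c i Z q \<bullet> cofr c q i) + (\<Sum>i\<in>UNIV. pd c i ?G q \<bullet> cofr c q i)) - w q * (V \<bullet> ?Y q)"
    unfolding dX by (simp add: inner_add_left sum.distrib sum_distrib_left distrib_left)
  \<comment> \<open>The vector on the left is the mean curvature vector. It is normal while the
    gradient field is tangent, so in the divergence it meets \<open>Z\<close> only.\<close>
  have "(\<xi> q - (x q - xtan q)) \<bullet> fr c q i = 0" for i
    by (simp add: inner_diff_left normal_fieldD[OF xi_normal c] xt proj_inner_frame[OF fr])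
  then have HG: "(\<xi> q - (x q - xtan q)) \<bullet> ?G q = 0"
    unfolding G_eq inner_sum_right by (simp add: normal_dual)
  \<comment> \<open>The term with the gradient of \<langle>x, \<xi>\<rangle> originates here. The
    remaining \<open>xtan q \<bullet> Z q\<close> combines with the mean curvature part into
    \<open>- (x q - \<xi> q) \<bullet> Z q\<close>, as in \<open>A2\<close>.\<close>
  have VZ: "V \<bullet> Z q = xtan q \<bullet> Z q - gradient c x (\<lambda>r. x r \<bullet> \<xi> r) q \<bullet> Z q"
    unfolding V_def weingarten_xtan[OF c] by (simp add: inner_diff_left)
  have "dvg (\<lambda>r. w r *\<^sub>R ?Y r) q = (\<Sum>i\<in>UNIV. pd c i (\<lambda>r. w r *\<^sub>R ?Y r) q \<bullet> cofr c q i)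
      + w q * ((\<xi> q - (x q - xtan q)) \<bullet> ?Y q)"
    unfolding dvg_def divg_def c_def by simp
  also have "\<dots> = w q * (A2 + second_variation_integrand \<A> \<xi> x F q)"
    unfolding sumX integrand A2 inner_add_right[of _ "Z q"] HG VZ
    by (simp add: inner_diff_left algebra_simps)
  finally show ?thesis .
qed

end

section \<open>Derivatives in time\<close>

lemma has_real_derivative_from_has_derivative:
  fixes f :: "real \<Rightarrow> real"
  assumes "(f has_derivative L) (at t)" shows "(f has_real_derivative L 1) (at t)"
proof -
  have "L h = L 1 * h" for h
    using linear_scale[OF has_derivative_linear[OF assms], of h 1] by simp
  then have "L = (\<lambda>h. L 1 * h)" by (rule ext)
  then show ?thesis using assms unfolding has_field_derivative_def by metis
qed

text \<open>For a fixed point, \<open>z\<close> stands for \<xi> and \<open>k\<close> for \<kappa>.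
  The first claim exhibits the logarithmic derivative of the density, and the second differentiates
  it once more. The difficulty is the derivative of the dual frame, which is determined by its
  pairings with tangent and with normal vectors.\<close>

lemma weighted_density_derivatives:
  fixes y y1 y2 :: "real \<Rightarrow> 'b::euclidean_space" and a a1 a2 :: "'m::finite \<Rightarrow> real \<Rightarrow> 'b"
  assumes S: "open S" "t \<in> S"
    and y: "(y has_vector_derivative y1 t) (at t)" "(y1 has_vector_derivative y2 t) (at t)"
    and a: "\<And>i. (a i has_vector_derivative a1 i t) (at t)" "\<And>i. (a1 i has_vector_derivative a2 i t) (at t)"
    and fr: "\<And>s. s \<in> S \<Longrightarrow> frame (\<lambda>i. a i s)" and aC: "\<And>i. Ck_on (Suc 0) S (a i)"
  defines "e \<equiv> \<lambda>i s. dual (\<lambda>i. a i s) i"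
  shows "((\<lambda>s. exp (k - (norm (y s - z))\<^sup>2 / 2) * vol (\<lambda>i. a i s)) has_real_derivative
      exp (k - (norm (y t - z))\<^sup>2 / 2) * vol (\<lambda>i. a i t) * ((\<Sum>i\<in>UNIV. a1 i t \<bullet> e i t) - (y t - z) \<bullet> y1 t)) (at t)"
    and "((\<lambda>s. (\<Sum>i\<in>UNIV. a1 i s \<bullet> e i s) - (y s - z) \<bullet> y1 s) has_real_derivative
      - (y1 t \<bullet> y1 t) - (y t - z) \<bullet> y2 t + (\<Sum>i\<in>UNIV. a2 i t \<bullet> e i t)
       - (\<Sum>i\<in>UNIV. \<Sum>j\<in>UNIV. (a1 i t \<bullet> e j t) * (a1 j t \<bullet> e i t))
       + (\<Sum>i\<in>UNIV. \<Sum>j\<in>UNIV. (e i t \<bullet> e j t) *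
           ((a1 i t - proj (\<lambda>i. a i t) (a1 i t)) \<bullet> (a1 j t - proj (\<lambda>i. a i t) (a1 j t))))) (at t)"
proof -
  let ?a = "\<lambda>i. a i t" let ?P = "proj ?a"
  have frt: "frame ?a" by (rule fr[OF S(2)])
  have aD: "(a i has_derivative (\<lambda>h. h *\<^sub>R a1 i t)) (at t)" for i
    using a(1) by (simp add: has_vector_derivative_def)
  have a1D: "(a1 i has_derivative (\<lambda>h. h *\<^sub>R a2 i t)) (at t)" for i
    using a(2) by (simp add: has_vector_derivative_def)
  have yD: "((\<lambda>s. y s - z) has_derivative (\<lambda>h. h *\<^sub>R y1 t)) (at t)"
    using has_derivative_diff[OF y(1)[unfolded has_vector_derivative_def] has_derivative_const[of z]] by simp
  have y1D: "(y1 has_derivative (\<lambda>h. h *\<^sub>R y2 t)) (at t)"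
    using y(2) by (simp add: has_vector_derivative_def)
  have "((\<lambda>s. vol (\<lambda>i. a i s)) has_derivative (\<lambda>h. vol ?a * (\<Sum>i\<in>UNIV. (h *\<^sub>R a1 i t) \<bullet> dual ?a i))) (at t)"
    by (rule has_derivative_vol[OF aD frt])
  from has_real_derivative_from_has_derivative[OF this]
  have V: "((\<lambda>s. vol (\<lambda>i. a i s)) has_real_derivative vol ?a * (\<Sum>i\<in>UNIV. a1 i t \<bullet> e i t)) (at t)"
    by (simp add: e_def)
  from has_real_derivative_from_has_derivative[OF has_derivative_inner[OF yD yD]]
  have N: "((\<lambda>s. (norm (y s - z))\<^sup>2) has_real_derivative 2 * ((y t - z) \<bullet> y1 t)) (at t)"
    by (simp add: power2_norm_eq_inner inner_commute)
  have "((\<lambda>s. exp (k - (norm (y s - z))\<^sup>2 / 2)) has_real_derivative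
      exp (k - (norm (y t - z))\<^sup>2 / 2) * (- ((y t - z) \<bullet> y1 t))) (at t)"
  proof -
    have "((\<lambda>s. k - (norm (y s - z))\<^sup>2 / 2) has_real_derivative - ((y t - z) \<bullet> y1 t)) (at t)"
      using DERIV_diff[OF DERIV_const DERIV_cdivide[OF N, of 2], of k] by simp
    then show ?thesis by (rule DERIV_fun_exp)
  qed
  from DERIV_mult[OF this V]
  show "((\<lambda>s. exp (k - (norm (y s - z))\<^sup>2 / 2) * vol (\<lambda>i. a i s)) has_real_derivative
      exp (k - (norm (y t - z))\<^sup>2 / 2) * vol ?a * ((\<Sum>i\<in>UNIV. a1 i t \<bullet> e i t) - (y t - z) \<bullet> y1 t)) (at t)"
    by (rule DERIV_cong) (simp add: algebra_simps)
  have eC: "Ck_on (Suc 0) S (e i)" for i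
    unfolding e_def by (rule Ck_on_dual[OF S(1) aC fr])
  define e' where "e' i = frechet_derivative (e i) (at t)" for i
  have eD: "(e i has_derivative e' i) (at t)" for i
    unfolding e'_def by (rule Ck_on_SucD[OF eC S(2)])
  let ?n = "\<lambda>i. a1 i t - ?P (a1 i t)"
  have na: "?n i \<bullet> ?a j = 0" for i j
    by (simp add: inner_diff_left proj_inner_frame[OF frt])
  have tang: "e' i 1 \<bullet> ?a j = - (a1 j t \<bullet> e i t)" for i j
    using dual_derivative_tangent[OF S fr aD eD[unfolded e_def], where h = 1 and i = i and j = j] by (simp add: e_def inner_commute)
  have norml: "e' i 1 \<bullet> ?n i = (\<Sum>j\<in>UNIV. (e i t \<bullet> e j t) * (a1 j t \<bullet> ?n i))" for i
    using dual_derivative_normal[OF S fr aD eD[unfolded e_def] na, where h = 1 and i = i] by (simp add: e_def)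
  have nn: "a1 j t \<bullet> ?n i = ?n i \<bullet> ?n j" for i j
  proof -
    have "?P (a1 j t) \<bullet> ?n i = 0"
      unfolding proj_def[of ?a "a1 j t"] using na[of i] by (simp add: inner_sum_left inner_commute[of "a _ t"])
    then have "a1 j t \<bullet> ?n i = ?n j \<bullet> ?n i" by (simp only: inner_diff_left[of "a1 j t"] diff_zero)
    then show ?thesis by (simp only: inner_commute[of "?n j"])
  qed
  \<comment> \<open>The tangential part of \<open>a1 i t\<close> gives the trace of a square, with a
    minus sign; the normal part gives the squared norm of the normal derivatives.\<close>
  have split: "a1 i t \<bullet> e' i 1 = - (\<Sum>j\<in>UNIV. (a1 i t \<bullet> e j t) * (a1 j t \<bullet> e i t))
      + (\<Sum>j\<in>UNIV. (e i t \<bullet> e j t) * (?n i \<bullet> ?n j))" for i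
  proof -
    have "a1 i t \<bullet> e' i 1 = ?P (a1 i t) \<bullet> e' i 1 + e' i 1 \<bullet> ?n i"
      by (simp add: inner_diff_right inner_commute)
    also have "?P (a1 i t) \<bullet> e' i 1 = - (\<Sum>j\<in>UNIV. (a1 i t \<bullet> e j t) * (a1 j t \<bullet> e i t))"
      unfolding proj_def e_def[symmetric] using tang[of i]
      by (simp add: inner_sum_left inner_commute[of "a _ t" "e' i 1"] sum_negf e_def)
    finally show ?thesis unfolding norml nn .
  qed
  have "((\<lambda>s. (\<Sum>i\<in>UNIV. a1 i s \<bullet> e i s) - (y s - z) \<bullet> y1 s) has_derivative
     (\<lambda>h. (\<Sum>i\<in>UNIV. a1 i t \<bullet> e' i h + (h *\<^sub>R a2 i t) \<bullet> e i t)
         - ((y t - z) \<bullet> (h *\<^sub>R y2 t) + (h *\<^sub>R y1 t) \<bullet> y1 t))) (at t)"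
    by (intro has_derivative_diff has_derivative_sum has_derivative_inner a1D eD yD y1D)
  from has_real_derivative_from_has_derivative[OF this]
  show "((\<lambda>s. (\<Sum>i\<in>UNIV. a1 i s \<bullet> e i s) - (y s - z) \<bullet> y1 s) has_real_derivative
      - (y1 t \<bullet> y1 t) - (y t - z) \<bullet> y2 t + (\<Sum>i\<in>UNIV. a2 i t \<bullet> e i t)
       - (\<Sum>i\<in>UNIV. \<Sum>j\<in>UNIV. (a1 i t \<bullet> e j t) * (a1 j t \<bullet> e i t))
       + (\<Sum>i\<in>UNIV. \<Sum>j\<in>UNIV. (e i t \<bullet> e j t) * (?n i \<bullet> ?n j))) (at t)"
    by (rule DERIV_cong) (simp add: split sum.distrib sum_negf sum_subtractf)
qed

text \<open>The functions \<open>f q\<close> themselves may be nonzero off \<open>K\<close>; only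
  their derivatives are dominated, by a constant on a set of finite measure. The mean value
  inequality passes this bound on to the difference quotients.\<close>

lemma has_real_derivative_integral:
  fixes f f' :: "'a \<Rightarrow> real \<Rightarrow> real"
  assumes K: "K \<in> sets M" "emeasure M K < \<infinity>" and t: "\<bar>t\<bar> < \<delta>"
    and der: "\<And>q s. \<bar>s\<bar> < \<delta> \<Longrightarrow> (f q has_real_derivative f' q s) (at s)"
    and int: "\<And>s. \<bar>s\<bar> < \<delta> \<Longrightarrow> integrable M (\<lambda>q. f q s)"
    and meas: "(\<lambda>q. f' q t) \<in> borel_measurable M"
    and bound: "\<And>q s. \<bar>s\<bar> < \<delta> \<Longrightarrow> \<bar>f' q s\<bar> \<le> B * indicator K q"
  shows "((\<lambda>s. LINT q|M. f q s) has_real_derivative (LINT q|M. f' q t)) (at t)"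
  unfolding has_field_derivative_iff tendsto_at_iff_sequentially
proof (intro allI impI)
  fix X :: "nat \<Rightarrow> real" assume X: "\<forall>i. X i \<in> UNIV - {t}" "X \<longlonglongrightarrow> t"
  have ev: "\<forall>\<^sub>F n in sequentially. dist (X n) t < \<delta> - \<bar>t\<bar>"
    using tendstoD[OF X(2)] t by simp
  then obtain m where m: "\<And>n. n \<ge> m \<Longrightarrow> dist (X n) t < \<delta> - \<bar>t\<bar>"
    unfolding eventually_sequentially by blast
  \<comment> \<open>A tail of the sequence stays where the derivative bound holds; the offset is
    undone at the end.\<close>
  define Y where "Y n = X (n + m)" for n
  have Y: "\<bar>Y n\<bar> < \<delta>" "Y n \<noteq> t" for n
    using m[of "n + m"] X(1) by (auto simp: Y_def dist_real_def)
  have Ylim: "Y \<longlonglongrightarrow> t" unfolding Y_def by (rule LIMSEQ_ignore_initial_segment[OF X(2)])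
  let ?q = "\<lambda>n q. (f q (Y n) - f q t) / (Y n - t)"
  have "(\<lambda>n. LINT q|M. ?q n q) \<longlonglongrightarrow> (LINT q|M. f' q t)"
  proof (rule integral_dominated_convergence)
    show "(\<lambda>q. f' q t) \<in> borel_measurable M" by (rule meas)
    show "?q n \<in> borel_measurable M" for n
      using borel_measurable_integrable[OF int[OF Y(1)[of n]]] borel_measurable_integrable[OF int[OF t]] by simp
    show "integrable M (\<lambda>q. B * indicator K q)"
      using K by (intro integrable_mult_right) (simp add: integrable_indicator_iff)
    show "AE q in M. (\<lambda>n. ?q n q) \<longlonglongrightarrow> f' q t"
    proof (rule AE_I2)
      fix q
      have "((\<lambda>s. (f q s - f q t) / (s - t)) \<longlongrightarrow> f' q t) (at t)"
        using der[OF t, of q] by (simp add: has_field_derivative_iff)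
      moreover have "filterlim Y (at t) sequentially"
        using Ylim Y(2) by (simp add: filterlim_at)
      ultimately show "(\<lambda>n. ?q n q) \<longlonglongrightarrow> f' q t" by (rule filterlim_compose)
    qed
    show "AE q in M. norm (?q n q) \<le> B * indicator K q" for n
    proof (rule AE_I2)
      fix q
      have "norm (f q (Y n) - f q t) \<le> B * indicator K q * norm (Y n - t)"
      proof (rule field_differentiable_bound)
        show "convex {-\<delta><..<\<delta>}" by simp
        show "(f q has_real_derivative f' q s) (at s within {-\<delta><..<\<delta>})" if "s \<in> {-\<delta><..<\<delta>}" for s
          by (rule has_field_derivative_at_within[OF der]) (use that in auto)
        show "norm (f' q s) \<le> B * indicator K q" if "s \<in> {-\<delta><..<\<delta>}" for s
          using bound[of s q] that by auto
      qed (use Y(1)[of n] t in auto)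
      moreover have "norm (Y n - t) > 0" using Y(2)[of n] by simp
      ultimately show "norm (?q n q) \<le> B * indicator K q"
        by (simp add: divide_le_eq)
    qed
  qed
  moreover have "(LINT q|M. ?q n q) = ((LINT q|M. f q (Y n)) - (LINT q|M. f q t)) / (Y n - t)" for n
    using int[OF Y(1)[of n]] int[OF t] by simp
  ultimately have "(\<lambda>n. ((LINT q|M. f q (Y n)) - (LINT q|M. f q t)) / (Y n - t)) \<longlonglongrightarrow> (LINT q|M. f' q t)"
    by (simp only:)
  then have "(\<lambda>n. ((LINT q|M. f q (X (n + m))) - (LINT q|M. f q t)) / (X (n + m) - t)) \<longlonglongrightarrow> (LINT q|M. f' q t)"
    unfolding Y_def .
  then show "((\<lambda>s. ((LINT q|M. f q s) - (LINT q|M. f q t)) / (s - t)) \<circ> X) \<longlonglongrightarrow> (LINT q|M. f' q t)"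
    unfolding o_def by (rule LIMSEQ_offset)
qed

section \<open>Space and time derivatives on a coordinate cylinder\<close>

abbreviation dT :: "('e::euclidean_space \<times> real \<Rightarrow> 'c::euclidean_space) \<Rightarrow> 'e \<times> real \<Rightarrow> 'c" where
  "dT g p \<equiv> frechet_derivative g (at p) (0, 1)"

abbreviation dX :: "'m::finite \<Rightarrow> ((real^'m) \<times> real \<Rightarrow> 'c::euclidean_space) \<Rightarrow> (real^'m) \<times> real \<Rightarrow> 'c" where
  "dX i g p \<equiv> frechet_derivative g (at p) (axis i 1, 0)"

lemma has_vector_derivative_time:
  assumes g: "Ck_on (Suc k) S g" "(u, t) \<in> S"
  shows "((\<lambda>s. g (u, s)) has_vector_derivative dT g (u, t)) (at t)"
proof -
  have line: "((\<lambda>s. (u, s)) has_derivative (\<lambda>h. (0, h))) (at t)"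
    by (rule has_derivative_Pair[OF has_derivative_const has_derivative_ident])
  have gD: "(g has_derivative frechet_derivative g (at (u, t))) (at (u, t))" by (rule Ck_on_SucD[OF g])
  have "((\<lambda>s. g (u, s)) has_derivative (\<lambda>h. frechet_derivative g (at (u, t)) (0, h))) (at t)"
    using diff_chain_at[OF line gD] by (simp add: o_def)
  moreover have "(\<lambda>h. frechet_derivative g (at (u, t)) (0, h)) = (\<lambda>h. h *\<^sub>R dT g (u, t))"
  proof
    fix h
    have "frechet_derivative g (at (u, t)) (h *\<^sub>R (0, 1)) = h *\<^sub>R dT g (u, t)"
      by (rule linear_scale[OF has_derivative_linear[OF gD]])
    then show "frechet_derivative g (at (u, t)) (0, h) = h *\<^sub>R dT g (u, t)"
      by (simp only: scaleR_Pair scaleR_zero_right real_scaleR_def mult_1_right)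
  qed
  ultimately show ?thesis unfolding has_vector_derivative_def by (simp only:)
qed

lemma has_derivative_slice:
  assumes g: "Ck_on (Suc k) S g" "(u, t) \<in> S"
  shows "((\<lambda>v. g (v, t)) has_derivative (\<lambda>h. frechet_derivative g (at (u, t)) (h, 0))) (at u)"
proof -
  have line: "((\<lambda>v. (v, t)) has_derivative (\<lambda>h. (h, 0))) (at u)"
    by (rule has_derivative_Pair[OF has_derivative_ident has_derivative_const])
  show ?thesis using diff_chain_at[OF line Ck_on_SucD[OF g]] by (simp add: o_def)
qed

lemma Ck_on_slice:
  assumes "open U" "Ck_on k (U \<times> I) g" "t \<in> I"
  shows "Ck_on k U (\<lambda>u. g (u, t))"
  by (rule Ck_on_compose[OF assms(1) Ck_on_Pair[OF assms(1) Ck_on_id[OF assms(1)] Ck_on_const] assms(2)])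
    (use assms(3) in auto)

lemma Ck_on_time_slice:
  assumes "open I" "Ck_on k (U \<times> I) g" "u \<in> U"
  shows "Ck_on k I (\<lambda>t. g (u, t))"
  by (rule Ck_on_compose[OF assms(1) Ck_on_Pair[OF assms(1) Ck_on_const Ck_on_id[OF assms(1)]] assms(2)])
    (use assms(3) in auto)

lemma Ck_on_fst:
  assumes "open U" "open I" "Ck_on k U g"
  shows "Ck_on k (U \<times> I) (\<lambda>p. g (fst p))"
  by (rule Ck_on_compose[OF open_Times[OF assms(1,2)] Ck_on_bounded_linear[OF bounded_linear_fst open_Times[OF assms(1,2)]] assms(3)])
    auto

section \<open>The variation in charts\<close>

locale xi_variation = xi_immersion \<A> \<xi> x
  for \<A> :: "('a::{t2_space, second_countable_topology}, 'm::finite) chart set" and \<xi> x :: "'a \<Rightarrow> 'b::euclidean_space" +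
  fixes F :: "'a \<Rightarrow> real \<Rightarrow> 'b" and \<epsilon> :: real
  assumes cv: "compact_variation \<A> x \<epsilon> F" and nv: "normal_variation \<A> x \<epsilon> F"
begin

abbreviation J :: "real set" where "J \<equiv> {-\<epsilon><..<\<epsilon>}"

definition Fc :: "('a, 'm) chart \<Rightarrow> (real^'m) \<times> real \<Rightarrow> 'b" where
  "Fc c = (\<lambda>(u, t). F (param c u) t)"

lemma Fc_apply [simp]: "Fc c (u, t) = F (param c u) t"
  by (simp add: Fc_def)

lemma variation: "variation \<A> x \<epsilon> F"
  using cv by (simp add: compact_variation_def)

lemma eps: "0 < \<epsilon>" and F0: "F q 0 = x q"
  using variation by (simp_all add: variation_def)

lemma F_immersion: "t \<in> J \<Longrightarrow> immersion \<A> (\<lambda>q. F q t)"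
  using variation unfolding variation_def by blast

lemma F_smooth: assumes "c \<in> \<A>" shows "Ck_on k (coord_range c \<times> J) (Fc c)"
proof -
  have "smooth_on (coord_range c \<times> J) (Fc c)"
    using variation assms unfolding variation_def Fc_def by blast
  then show ?thesis by (simp add: smooth_on_def)
qed

lemma open_J: "open J" by (rule open_greaterThanLessThan)

lemma J0: "0 \<in> J" using eps by simp

lemma open_cyl: "c \<in> \<A> \<Longrightarrow> open (coord_range c \<times> J)"
  by (rule open_Times[OF chart_open(2) open_J])

lemma dt_eq:
  assumes "c \<in> \<A>" "u \<in> coord_range c" "t \<in> J"
  shows "dt F (param c u) t = dT (Fc c) (u, t)"
  unfolding dt_def
  by (rule vector_derivative_at) (use has_vector_derivative_time[OF F_smooth[OF assms(1), of "Suc 0"], of u t] assms in simp)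

lemma dTF_smooth: "c \<in> \<A> \<Longrightarrow> Ck_on k (coord_range c \<times> J) (dT (Fc c))"
  by (rule Ck_on_frechet[OF F_smooth])

lemma dTTF_smooth: "c \<in> \<A> \<Longrightarrow> Ck_on k (coord_range c \<times> J) (dT (dT (Fc c)))"
  by (rule Ck_on_frechet[OF dTF_smooth])

lemma dXF_smooth: "c \<in> \<A> \<Longrightarrow> Ck_on k (coord_range c \<times> J) (dX i (Fc c))"
  by (rule Ck_on_frechet[OF F_smooth])

lemma dXTF_smooth: "c \<in> \<A> \<Longrightarrow> Ck_on k (coord_range c \<times> J) (dX i (dT (Fc c)))"
  by (rule Ck_on_frechet[OF dTF_smooth])

definition eta :: "'a \<Rightarrow> 'b" where "eta q = dt F q 0"
definition Z :: "'a \<Rightarrow> 'b" where "Z q = vector_derivative (dt F q) (at 0)"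

lemma eta_normal: "normal_field \<A> x eta"
  using nv unfolding normal_variation_def eta_def[abs_def] by simp

lemma eta_eq: "c \<in> \<A> \<Longrightarrow> u \<in> coord_range c \<Longrightarrow> eta (param c u) = dT (Fc c) (u, 0)"
  unfolding eta_def by (rule dt_eq[OF _ _ J0])

lemma Z_eq:
  assumes c: "c \<in> \<A>" "u \<in> coord_range c" shows "Z (param c u) = dT (dT (Fc c)) (u, 0)"
  unfolding Z_def
proof (rule vector_derivative_at)
  have "((\<lambda>s. dT (Fc c) (u, s)) has_vector_derivative dT (dT (Fc c)) (u, 0)) (at 0)"
    by (rule has_vector_derivative_time[OF dTF_smooth[OF c(1), of "Suc 0"]]) (use c J0 in simp)
  then show "(dt F (param c u) has_vector_derivative dT (dT (Fc c)) (u, 0)) (at 0)"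
    by (rule has_vector_derivative_transform_within_open[OF _ open_J J0]) (simp add: dt_eq[OF c])
qed

lemma pd_slice:
  assumes c: "c \<in> \<A>" "u \<in> coord_range c" and t: "t \<in> J" and g: "Ck_on (Suc k) (coord_range c \<times> J) g"
    and h: "\<And>v. v \<in> coord_range c \<Longrightarrow> h (param c v) = g (v, t)"
  shows "pd c i h (param c u) = dX i g (u, t)"
proof -
  have "((\<lambda>v. g (v, t)) has_derivative (\<lambda>v. frechet_derivative g (at (u, t)) (v, 0))) (at u)"
    by (rule has_derivative_slice[OF g]) (use c t in simp)
  then have "((h \<circ> param c) has_derivative (\<lambda>v. frechet_derivative g (at (u, t)) (v, 0))) (at u)"
    by (rule has_derivative_transform_within_open[OF _ chart_open(2)[OF c(1)] c(2)]) (simp add: h)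
  then have "((h \<circ> param c) has_derivative (\<lambda>v. frechet_derivative g (at (u, t)) (v, 0))) (at (coord c (param c u)))"
    using c by simp
  from pdI[OF this] show ?thesis .
qed

lemma pd_F: "c \<in> \<A> \<Longrightarrow> u \<in> coord_range c \<Longrightarrow> t \<in> J \<Longrightarrow> pd c i (\<lambda>q. F q t) (param c u) = dX i (Fc c) (u, t)"
  by (rule pd_slice[OF _ _ _ F_smooth[of c "Suc 0"]]) simp_all

lemma pd_x: "c \<in> \<A> \<Longrightarrow> u \<in> coord_range c \<Longrightarrow> pd c i x (param c u) = dX i (Fc c) (u, 0)"
  by (rule pd_slice[OF _ _ J0 F_smooth[of c "Suc 0"]]) (simp_all add: F0)

lemma pd_eta: "c \<in> \<A> \<Longrightarrow> u \<in> coord_range c \<Longrightarrow> pd c i eta (param c u) = dX i (dT (Fc c)) (u, 0)"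
  by (rule pd_slice[OF _ _ J0 dTF_smooth[of c "Suc 0"]]) (simp_all add: eta_eq)

lemma pd_Z: "c \<in> \<A> \<Longrightarrow> u \<in> coord_range c \<Longrightarrow> pd c i Z (param c u) = dX i (dT (dT (Fc c))) (u, 0)"
  by (rule pd_slice[OF _ _ J0 dTTF_smooth[of c "Suc 0"]]) (simp_all add: Z_eq)

lemma C1_Z: "C1 Z"
  unfolding C1_def
proof
  fix c assume c: "c \<in> \<A>"
  have "Ck_on (Suc 0) (coord_range c) (\<lambda>u. dT (dT (Fc c)) (u, 0))"
    by (rule Ck_on_slice[OF chart_open(2)[OF c] dTTF_smooth[OF c] J0])
  then show "Ck_on (Suc 0) (coord_range c) (Z \<circ> param c)"
    using Ck_on_cong[OF chart_open(2)[OF c], of "Z \<circ> param c" "\<lambda>u. dT (dT (Fc c)) (u, 0)"] Z_eq[OF c] by simp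
qed

lemma frame_F: "c \<in> \<A> \<Longrightarrow> u \<in> coord_range c \<Longrightarrow> t \<in> J \<Longrightarrow> frame (\<lambda>i. dX i (Fc c) (u, t))"
  using immersion_frame[OF F_immersion, of t c "param c u"] by (simp add: pd_F)

lemma vol_F: "c \<in> \<A> \<Longrightarrow> u \<in> coord_range c \<Longrightarrow> t \<in> J \<Longrightarrow>
    vol_density c (\<lambda>q. F q t) (param c u) = vol (\<lambda>i. dX i (Fc c) (u, t))"
  unfolding vol_density_vol by (simp add: pd_F)

text \<open>The compact closure of \<open>B\<close> serves for all times at once. Off it the
  velocity vanishes for every \<open>t \<in> J\<close>, so \<open>F q\<close> is constant in time
  there and the acceleration is 0.\<close>

lemma support:
  obtains K where "compact K" "\<And>q t. q \<notin> K \<Longrightarrow> t \<in> J \<Longrightarrow> F q t = x q"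
    "\<And>q. q \<notin> K \<Longrightarrow> eta q = 0" "\<And>q. q \<notin> K \<Longrightarrow> Z q = 0"
proof -
  obtain B where B: "compact (closure B)" "\<And>t. t \<in> J \<Longrightarrow> closure {q. dt F q t \<noteq> 0} \<subseteq> B"
    using cv unfolding compact_variation_def by blast
  have dt0: "dt F q t = 0" if q: "q \<notin> closure B" and t: "t \<in> J" for q t
  proof (rule ccontr)
    assume "dt F q t \<noteq> 0"
    then have "q \<in> {q. dt F q t \<noteq> 0}" by simp
    then have "q \<in> closure {q. dt F q t \<noteq> 0}" by (rule subsetD[OF closure_subset])
    then have "q \<in> B" by (rule subsetD[OF B(2)[OF t]])
    then have "q \<in> closure B" by (rule subsetD[OF closure_subset])
    then show False using q by contradiction
  qed
  have F_const: "F q t = x q" if q: "q \<notin> closure B" and t: "t \<in> J" for q t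
  proof -
    obtain c where c: "c \<in> \<A>" "q \<in> chart_dom c" by (rule chart_exists)
    have zero: "(F q has_derivative (\<lambda>h. 0)) (at s within J)" if s: "s \<in> J" for s
    proof -
      have u: "coord c q \<in> coord_range c" using c by blast
      have "((\<lambda>s. Fc c (coord c q, s)) has_vector_derivative dT (Fc c) (coord c q, s)) (at s)"
        by (rule has_vector_derivative_time[OF F_smooth[OF c(1), of "Suc 0"]]) (use u s in simp)
      moreover have "dT (Fc c) (coord c q, s) = 0"
        using dt_eq[OF c(1) u s] dt0[OF q s] c by simp
      ultimately have "(F q has_derivative (\<lambda>h. 0)) (at s)"
        using c by (simp add: has_vector_derivative_def)
      then show ?thesis by (rule has_derivative_at_withinI)
    qed
    have "\<exists>k. \<forall>s\<in>J. F q s = k"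
      by (rule has_derivative_zero_constant[OF _ zero]) simp_all
    then obtain k where "\<forall>s\<in>J. F q s = k" ..
    from bspec[OF this t] bspec[OF this J0] show ?thesis by (simp only: F0)
  qed
  have Z0: "Z q = 0" if q: "q \<notin> closure B" for q
    unfolding Z_def
  proof (rule vector_derivative_at)
    show "(dt F q has_vector_derivative 0) (at 0)"
      by (rule has_vector_derivative_transform_within_open[OF has_vector_derivative_const open_J J0])
        (simp add: dt0[OF q])
  qed
  have eta0: "eta q = 0" if q: "q \<notin> closure B" for q
    unfolding eta_def by (rule dt0[OF q J0])
  show ?thesis by (rule that[OF B(1) F_const eta0 Z0])
qed

lemma continuous_on_cylinder:
  fixes g :: "'a \<Rightarrow> real \<Rightarrow> real"
  assumes h: "\<And>c. c \<in> \<A> \<Longrightarrow> continuous_on (coord_range c \<times> J) (h c)"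
    "\<And>c u t. c \<in> \<A> \<Longrightarrow> u \<in> coord_range c \<Longrightarrow> t \<in> J \<Longrightarrow> g (param c u) t = h c (u, t)"
  shows "continuous_on (UNIV \<times> J) (\<lambda>p. g (fst p) (snd p))"
proof -
  have "continuous_on (chart_dom c \<times> J) (\<lambda>p. g (fst p) (snd p))" if c: "c \<in> \<A>" for c
  proof -
    have 1: "continuous_on (chart_dom c \<times> J) (\<lambda>p. (coord c (fst p), snd p))"
      by (intro continuous_on_Pair continuous_on_compose2[OF coord_continuous[OF c]] continuous_on_fst continuous_on_snd
          continuous_on_id) auto
    have "continuous_on (chart_dom c \<times> J) (\<lambda>p. h c (coord c (fst p), snd p))"
      by (rule continuous_on_compose2[OF h(1)[OF c] 1]) auto
    moreover have "g (fst p) (snd p) = h c (coord c (fst p), snd p)" if p: "p \<in> chart_dom c \<times> J" for p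
      using h(2)[OF c, of "coord c (fst p)" "snd p"] p c by (auto simp: mem_Times_iff)
    ultimately show ?thesis by (simp cong: continuous_on_cong)
  qed
  then have "continuous_on (\<Union>c\<in>\<A>. chart_dom c \<times> J) (\<lambda>p. g (fst p) (snd p))"
    by (intro continuous_on_open_UN) (auto intro: open_Times chart_open open_J)
  moreover have "(\<Union>c\<in>\<A>. chart_dom c \<times> J) = (\<Union>c\<in>\<A>. chart_dom c) \<times> J"
    by auto
  moreover have "(\<Union>c\<in>\<A>. chart_dom c) = UNIV" using smooth_atlas by (simp add: smooth_atlas_def)
  ultimately show ?thesis by simp
qed

end

context atlas
begin

lemma pd_diff:
  assumes "c \<in> \<A>" "q \<in> chart_dom c" "Ck_on (Suc 0) (coord_range c) (f \<circ> param c)" "Ck_on (Suc 0) (coord_range c) (g \<circ> param c)"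
  shows "pd c i (\<lambda>q. f q - g q) q = pd c i f q - pd c i g q"
proof -
  have u: "coord c q \<in> coord_range c" using assms(2) by blast
  have "((\<lambda>q. f q - g q) \<circ> param c has_derivative
     (\<lambda>h. frechet_derivative (f \<circ> param c) (at (coord c q)) h - frechet_derivative (g \<circ> param c) (at (coord c q)) h)) (at (coord c q))"
    using has_derivative_diff[OF Ck_on_SucD[OF assms(3) u] Ck_on_SucD[OF assms(4) u]] by (simp add: o_def)
  from pdI[OF this] show ?thesis by (simp add: pd_def)
qed

lemma pd_exp:
  assumes "c \<in> \<A>" "q \<in> chart_dom c" "Ck_on (Suc 0) (coord_range c) (g \<circ> param c)"
  shows "pd c i (\<lambda>q. exp (g q :: real)) q = exp (g q) * pd c i g q"
proof -
  have u: "coord c q \<in> coord_range c" using assms(2) by blast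
  have "((\<lambda>q. exp (g q)) \<circ> param c has_derivative
     (\<lambda>h. exp ((g \<circ> param c) (coord c q)) * frechet_derivative (g \<circ> param c) (at (coord c q)) h)) (at (coord c q))"
    using DERIV_compose_FDERIV[OF DERIV_exp Ck_on_SucD[OF assms(3) u]] by (simp add: o_def mult.commute)
  from pdI[OF this] show ?thesis using assms(1,2) by (simp add: pd_def)
qed

end

section \<open>The second variation\<close>

text \<open>
  The two functionals of the theorem are the cases \<open>\<kappa> = 0\<close> and \<open>\<kappa> = |\<xi>|\<^sup>2 / 2\<close>; the latter is only
  locally constant.
\<close>

locale weighted_xi_variation = xi_variation \<A> \<xi> x F \<epsilon>
  for \<A> :: "('a::{t2_space, second_countable_topology}, 'm::finite) chart set"
    and \<xi> x :: "'a \<Rightarrow> 'b::euclidean_space" and F \<epsilon> +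
  fixes \<kappa> :: "'a \<Rightarrow> real" and \<psi> :: "('a \<Rightarrow> 'b) \<Rightarrow> 'a \<Rightarrow> real"
  assumes psi: "\<And>y q. \<psi> y q = (norm (y q - \<xi> q))\<^sup>2 / 2 - \<kappa> q"
    and kappa_Ck: "\<And>c k. c \<in> \<A> \<Longrightarrow> Ck_on k (coord_range c) (\<kappa> \<circ> param c)"
    and pd_kappa: "\<And>c q i. c \<in> \<A> \<Longrightarrow> q \<in> chart_dom c \<Longrightarrow> pd c i \<kappa> q = 0"
begin

definition R :: "'a \<Rightarrow> real \<Rightarrow> real" where "R = relative_density \<A> \<psi> F"

text \<open>The density as a function of the coordinates and of time jointly. Joint smoothness is
  needed for bounds uniform in time; the squared norm appears as an inner product to fit the rules
  for \<open>C\<^sup>k\<close> functions.\<close>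

definition Rc :: "('a, 'm) chart \<Rightarrow> (real^'m) \<times> real \<Rightarrow> real" where
  "Rc c p = exp (\<kappa> (param c (fst p)) - (Fc c p - \<xi> (param c (fst p))) \<bullet> (Fc c p - \<xi> (param c (fst p))) / 2)
     * vol (\<lambda>i. dX i (Fc c) p) / vol_density c x (param c (fst p))"

definition ratio :: "'a \<Rightarrow> real \<Rightarrow> real" where
  "ratio q t = vol_density (chart_at \<A> q) (\<lambda>r. F r t) q / vol_density (chart_at \<A> q) x q"

lemma F_zero: "(\<lambda>r. F r 0) = x"
  by (rule ext) (rule F0)

text \<open>Numerator and denominator acquire the same Jacobian factor when the chart
  changes.\<close>

lemma ratio_eq:
  assumes c: "c \<in> \<A>" "q \<in> chart_dom c" and t: "t \<in> J"
  shows "ratio q t = vol_density c (\<lambda>r. F r t) q / vol_density c x q"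
proof -
  let ?d = "chart_at \<A> q"
  have d: "?d \<in> \<A>" "q \<in> chart_dom ?d" by (rule chart_at)+
  have 1: "vol_density ?d (\<lambda>r. F r t) q = \<bar>det (jac c ?d q)\<bar> * vol_density c (\<lambda>r. F r t) q"
    by (rule vol_density_change[OF F_immersion[OF t] c(1) d(1) c(2) d(2)])
  have 2: "vol_density ?d x q = \<bar>det (jac c ?d q)\<bar> * vol_density c x q"
    by (rule vol_density_change[OF immersion_x c(1) d(1) c(2) d(2)])
  have "\<bar>det (jac c ?d q)\<bar> \<noteq> 0"
    using invertible_jac[OF c(1) d(1) c(2) d(2)] by (simp add: invertible_det_nz)
  then show ?thesis unfolding ratio_def 1 2 by (rule mult_divide_mult_cancel_left)
qed

lemma ratio_pos: assumes "t \<in> J" shows "ratio q t > 0"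
  unfolding ratio_def
  by (intro divide_pos_pos vol_density_pos[OF F_immersion[OF assms] chart_at] vol_density_pos[OF immersion_x chart_at])

lemma R_eq: "R q t = exp (- \<psi> (\<lambda>r. F r t) q) * ratio q t"
  by (simp add: R_def relative_density_def ratio_def F_zero)

lemma R_chart:
  assumes c: "c \<in> \<A>" "u \<in> coord_range c" and t: "t \<in> J"
  shows "R (param c u) t = Rc c (u, t)"
  unfolding R_eq ratio_eq[OF c(1) param_in_dom[OF c] t] vol_F[OF c t] Rc_def
  by (simp add: psi power2_norm_eq_inner)

lemma Rc_smooth: assumes c: "c \<in> \<A>" shows "Ck_on k (coord_range c \<times> J) (Rc c)"
proof -
  note op = open_cyl[OF c] note op1 = chart_open(2)[OF c]
  have kap: "Ck_on k (coord_range c \<times> J) (\<lambda>p. \<kappa> (param c (fst p)))"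
    by (rule Ck_on_fst[OF op1 open_J]) (use kappa_Ck[OF c, of k] in \<open>simp only: o_def\<close>)
  have xic: "Ck_on k (coord_range c \<times> J) (\<lambda>p. \<xi> (param c (fst p)))"
    by (rule Ck_on_fst[OF op1 open_J]) (use normal_field_Ck[OF xi_normal c, of k] in \<open>simp only: o_def\<close>)
  have v0: "Ck_on k (coord_range c \<times> J) (\<lambda>p. vol_density c x (param c (fst p)))"
    by (rule Ck_on_fst[OF op1 open_J Ck_vol_density[OF immersion_x c]])
  have v: "Ck_on k (coord_range c \<times> J) (\<lambda>p. vol (\<lambda>i. dX i (Fc c) p))"
  proof (rule Ck_on_vol[OF op dXF_smooth[OF c]])
    fix p assume "p \<in> coord_range c \<times> J"
    then show "frame (\<lambda>i. dX i (Fc c) p)" using frame_F[OF c, of "fst p" "snd p"] by (simp add: mem_Times_iff)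
  qed
  have inn: "Ck_on k (coord_range c \<times> J) (\<lambda>p. (Fc c p - \<xi> (param c (fst p))) \<bullet> (Fc c p - \<xi> (param c (fst p))) / 2)"
    unfolding divide_inverse
    by (intro Ck_on_mult Ck_on_inner Ck_on_diff op F_smooth[OF c] xic Ck_on_const)
  have nz: "vol_density c x (param c (fst p)) \<noteq> 0" if p: "p \<in> coord_range c \<times> J" for p
    using vol_density_pos[OF immersion_x c param_in_dom[OF c, of "fst p"]] p by (auto simp: mem_Times_iff)
  have "Ck_on k (coord_range c \<times> J) (\<lambda>p. exp (\<kappa> (param c (fst p)) - (Fc c p - \<xi> (param c (fst p))) \<bullet> (Fc c p - \<xi> (param c (fst p))) / 2)
     * vol (\<lambda>i. dX i (Fc c) p) / vol_density c x (param c (fst p)))"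
    by (rule Ck_on_divide[OF op Ck_on_mult[OF op Ck_on_exp[OF op Ck_on_diff[OF op kap inn]] v] v0 nz])
  then show ?thesis unfolding Rc_def[abs_def] .
qed

definition R1 :: "'a \<Rightarrow> real \<Rightarrow> real" where "R1 q = deriv (R q)"
definition R2 :: "'a \<Rightarrow> real \<Rightarrow> real" where "R2 q = deriv (R1 q)"

lemma R_chart_derivative:
  assumes c: "c \<in> \<A>" "u \<in> coord_range c" and t: "t \<in> J"
  shows "(R (param c u) has_real_derivative dT (Rc c) (u, t)) (at t)"
proof -
  have "((\<lambda>s. Rc c (u, s)) has_vector_derivative dT (Rc c) (u, t)) (at t)"
    by (rule has_vector_derivative_time[OF Rc_smooth[OF c(1), of "Suc 0"]]) (use c t in simp)
  then have "((\<lambda>s. Rc c (u, s)) has_real_derivative dT (Rc c) (u, t)) (at t)"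
    by (simp only: has_real_derivative_iff_has_vector_derivative)
  then show ?thesis
    by (rule has_field_derivative_transform_within_open[OF _ open_J t]) (rule R_chart[OF c, symmetric])
qed

lemma R1_chart: "c \<in> \<A> \<Longrightarrow> u \<in> coord_range c \<Longrightarrow> t \<in> J \<Longrightarrow> R1 (param c u) t = dT (Rc c) (u, t)"
  unfolding R1_def by (rule DERIV_imp_deriv[OF R_chart_derivative])

lemma R1_chart_derivative:
  assumes c: "c \<in> \<A>" "u \<in> coord_range c" and t: "t \<in> J"
  shows "(R1 (param c u) has_real_derivative dT (dT (Rc c)) (u, t)) (at t)"
proof -
  have "((\<lambda>s. dT (Rc c) (u, s)) has_vector_derivative dT (dT (Rc c)) (u, t)) (at t)"
    by (rule has_vector_derivative_time[OF Ck_on_frechet[OF Rc_smooth[OF c(1), of "Suc (Suc 0)"]]]) (use c t in simp)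
  then have "((\<lambda>s. dT (Rc c) (u, s)) has_real_derivative dT (dT (Rc c)) (u, t)) (at t)"
    by (simp only: has_real_derivative_iff_has_vector_derivative)
  then show ?thesis
    by (rule has_field_derivative_transform_within_open[OF _ open_J t]) (rule R1_chart[OF c, symmetric])
qed

lemma R2_chart: "c \<in> \<A> \<Longrightarrow> u \<in> coord_range c \<Longrightarrow> t \<in> J \<Longrightarrow> R2 (param c u) t = dT (dT (Rc c)) (u, t)"
  unfolding R2_def by (rule DERIV_imp_deriv[OF R1_chart_derivative])

lemma chart_point:
  obtains c u where "c \<in> \<A>" "u \<in> coord_range c" "q = param c u"
proof -
  obtain c where c: "c \<in> \<A>" "q \<in> chart_dom c" by (rule chart_exists)
  have "coord c q \<in> coord_range c" using c(2) by (rule imageI)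
  moreover have "q = param c (coord c q)" using c by simp
  ultimately show ?thesis using that c(1) by metis
qed

lemma DERIV_R: assumes t: "t \<in> J" shows "(R q has_real_derivative R1 q t) (at t)"
proof -
  obtain c u where c: "c \<in> \<A>" "u \<in> coord_range c" and q: "q = param c u" by (rule chart_point)
  show ?thesis unfolding q R1_chart[OF c t] by (rule R_chart_derivative[OF c t])
qed

lemma DERIV_R1: assumes t: "t \<in> J" shows "(R1 q has_real_derivative R2 q t) (at t)"
proof -
  obtain c u where c: "c \<in> \<A>" "u \<in> coord_range c" and q: "q = param c u" by (rule chart_point)
  show ?thesis unfolding q R2_chart[OF c t] by (rule R1_chart_derivative[OF c t])
qed

lemma continuous_R1: "continuous_on (UNIV \<times> J) (\<lambda>p. R1 (fst p) (snd p))"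
  by (rule continuous_on_cylinder[where h = "\<lambda>c. dT (Rc c)" and g = R1, OF _ R1_chart])
    (rule Ck_on_continuous_on[OF Ck_on_frechet[OF Rc_smooth]])

lemma continuous_R2: "continuous_on (UNIV \<times> J) (\<lambda>p. R2 (fst p) (snd p))"
  by (rule continuous_on_cylinder[where h = "\<lambda>c. dT (dT (Rc c))" and g = R2, OF _ R2_chart])
    (rule Ck_on_continuous_on[OF Ck_on_frechet[OF Ck_on_frechet[OF Rc_smooth]]])

lemma continuous_R: "continuous_on (UNIV \<times> J) (\<lambda>p. R (fst p) (snd p))"
  by (rule continuous_on_cylinder[where h = Rc and g = R, OF _ R_chart]) (rule Ck_on_continuous_on[OF Rc_smooth])

lemma continuous_space_slice:
  assumes "continuous_on (UNIV \<times> J) (\<lambda>p. g (fst p) (snd p))" "t \<in> J"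
  shows "continuous_on UNIV (\<lambda>q. g q t)"
proof -
  have "continuous_on UNIV (\<lambda>q. (\<lambda>p. g (fst p) (snd p)) (q, t))"
    by (rule continuous_on_compose2[OF assms(1) continuous_on_Pair[OF continuous_on_id continuous_on_const]])
      (use assms(2) in auto)
  then show ?thesis by simp
qed

text \<open>Since \<open>K\<close> is closed, F agrees with x near \<open>q\<close> and not just at
  \<open>q\<close>; this is needed because the density involves space derivatives.\<close>

lemma R_constant:
  assumes K: "closed K" "\<And>q t. q \<notin> K \<Longrightarrow> t \<in> J \<Longrightarrow> F q t = x q" and q: "q \<notin> K" and t: "t \<in> J"
  shows "R q t = R q 0" "R1 q t = 0" "R2 q t = 0"
proof -
  have R0: "R q s = R q 0" if s: "s \<in> J" for s
  proof -
    have "pd (chart_at \<A> q) i (\<lambda>r. F r s) q = pd (chart_at \<A> q) i x q" for i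
    proof (rule pd_cong[OF chart_at(1), where W = "chart_dom (chart_at \<A> q) - K"])
      show "q \<in> chart_dom (chart_at \<A> q) - K" using q chart_at(2) by simp
      show "open (chart_dom (chart_at \<A> q) - K)" by (rule open_Diff[OF chart_open(1)[OF chart_at(1)] K(1)])
      show "F r s = x r" if "r \<in> chart_dom (chart_at \<A> q) - K" for r
        using K(2)[OF _ s, of r] that by simp
    qed simp
    then have "vol_density (chart_at \<A> q) (\<lambda>r. F r s) q = vol_density (chart_at \<A> q) x q"
      unfolding vol_density_vol by simp
    moreover have "\<psi> (\<lambda>r. F r s) q = \<psi> x q" unfolding psi using K(2)[OF q s] by simp
    ultimately show ?thesis by (simp add: R_eq ratio_def F_zero)
  qed
  show "R q t = R q 0" by (rule R0[OF t])
  have R1_0: "R1 q s = 0" if s: "s \<in> J" for s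
    unfolding R1_def
    by (rule DERIV_imp_deriv, rule has_field_derivative_transform_within_open[OF DERIV_const open_J s])
      (rule R0[symmetric])
  show "R1 q t = 0" by (rule R1_0[OF t])
  show "R2 q t = 0"
    unfolding R2_def
    by (rule DERIV_imp_deriv, rule has_field_derivative_transform_within_open[OF DERIV_const open_J t])
      (rule R1_0[symmetric])
qed

lemma uniform_bound:
  assumes g: "continuous_on (UNIV \<times> J) (\<lambda>p. g (fst p) (snd p))"
    and K: "compact K" "\<And>q t. q \<notin> K \<Longrightarrow> t \<in> J \<Longrightarrow> g q t = (0::real)"
  obtains B where "\<And>q t. \<bar>t\<bar> < \<epsilon> / 2 \<Longrightarrow> \<bar>g q t\<bar> \<le> B * indicator K q"
proof -
  \<comment> \<open>The time interval is open, so a compact smaller one is needed for a uniform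
    bound.\<close>
  let ?I = "{-(\<epsilon>/2)..\<epsilon>/2}"
  have sub: "K \<times> ?I \<subseteq> UNIV \<times> J" using eps by auto
  have "compact ((\<lambda>p. g (fst p) (snd p)) ` (K \<times> ?I))"
    by (rule compact_continuous_image[OF continuous_on_subset[OF g sub] compact_Times[OF K(1) compact_Icc]])
  from compact_imp_bounded[OF this]
  obtain B where B: "\<forall>v\<in>(\<lambda>p. g (fst p) (snd p)) ` (K \<times> ?I). norm v \<le> B"
    unfolding bounded_iff ..
  have "\<bar>g q t\<bar> \<le> B * indicator K q" if t: "\<bar>t\<bar> < \<epsilon> / 2" for q t
  proof (cases "q \<in> K")
    case True
    then have "(q, t) \<in> K \<times> ?I" using t by auto
    then have "g q t \<in> (\<lambda>p. g (fst p) (snd p)) ` (K \<times> ?I)" by (rule rev_image_eqI) simp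
    from bspec[OF B this] show ?thesis using True by simp
  next
    case False
    have "t \<in> J" using t eps by auto
    then show ?thesis using K(2)[OF False] False by simp
  qed
  then show ?thesis by (rule that)
qed

text \<open>The factor \<open>ratio q t\<close> converts the volume of F at time \<open>t\<close>
  into that of x. The identity holds in the extended nonnegative reals, finite or not.\<close>

lemma weighted_volume_eq:
  assumes t: "t \<in> J"
  shows "weighted_volume \<A> \<psi> (\<lambda>q. F q t) = (\<integral>\<^sup>+q. ennreal (R q t) \<partial>volume_measure \<A> x)"
proof -
  note [measurable_cong] = sets_volume_measure[OF immersion_x]
  have "continuous_on UNIV (\<lambda>q. ratio q t)"
  proof (rule continuous_on_manifold)
    fix c assume c: "c \<in> \<A>"
    have "continuous_on (coord_range c) (\<lambda>u. vol_density c (\<lambda>r. F r t) (param c u) / vol_density c x (param c u))"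
    proof (rule continuous_on_divide)
      show "continuous_on (coord_range c) (\<lambda>u. vol_density c (\<lambda>r. F r t) (param c u))"
        by (rule Ck_on_continuous_on[OF Ck_vol_density[OF F_immersion[OF t] c]])
      show "continuous_on (coord_range c) (\<lambda>u. vol_density c x (param c u))"
        by (rule Ck_on_continuous_on[OF Ck_vol_density[OF immersion_x c]])
      show "\<forall>u\<in>coord_range c. vol_density c x (param c u) \<noteq> 0"
        using vol_density_pos[OF immersion_x c param_in_dom[OF c]] by (metis less_irrefl)
    qed
    moreover have "ratio (param c u) t = vol_density c (\<lambda>r. F r t) (param c u) / vol_density c x (param c u)"
      if "u \<in> coord_range c" for u
      by (rule ratio_eq[OF c param_in_dom[OF c that] t])
    ultimately show "continuous_on (coord_range c) (\<lambda>u. ratio (param c u) t)"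
      by (simp cong: continuous_on_cong)
  qed
  from borel_measurable_continuous_onI[OF this]
  have ratio_meas[measurable]: "(\<lambda>q. ratio q t) \<in> borel_measurable borel" .
  have R_meas[measurable]: "(\<lambda>q. R q t) \<in> borel_measurable borel"
    by (rule borel_measurable_continuous_onI[OF continuous_space_slice[OF continuous_R t]])
  have exp_eq: "exp (- \<psi> (\<lambda>r. F r t) q) = R q t / ratio q t" for q
    using ratio_pos[OF t, of q] by (simp add: R_eq)
  have density: "volume_measure \<A> (\<lambda>q. F q t) = density (volume_measure \<A> x) (\<lambda>q. ennreal (ratio q t))"
  proof (rule volume_measure_ratio[OF immersion_x F_immersion[OF t] ratio_meas])
    fix c q assume c: "c \<in> \<A>" "q \<in> chart_dom c"
    show "vol_density c (\<lambda>q. F q t) q = ratio q t * vol_density c x q"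
      using vol_density_pos[OF immersion_x c] by (simp add: ratio_eq[OF c t])
  qed
  have "weighted_volume \<A> \<psi> (\<lambda>q. F q t)
      = (\<integral>\<^sup>+q. ennreal (R q t / ratio q t) \<partial>density (volume_measure \<A> x) (\<lambda>q. ennreal (ratio q t)))"
    unfolding weighted_volume_def density exp_eq ..
  also have "\<dots> = (\<integral>\<^sup>+q. ennreal (ratio q t) * ennreal (R q t / ratio q t) \<partial>volume_measure \<A> x)"
    by (rule nn_integral_density) measurable
  also have "\<dots> = (\<integral>\<^sup>+q. ennreal (R q t) \<partial>volume_measure \<A> x)"
  proof (rule nn_integral_cong)
    fix q
    have "ennreal (ratio q t) * ennreal (R q t / ratio q t) = ennreal (ratio q t * (R q t / ratio q t))"
      by (rule ennreal_mult'[symmetric]) (rule less_imp_le[OF ratio_pos[OF t]])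
    also have "ratio q t * (R q t / ratio q t) = R q t" using ratio_pos[OF t, of q] by simp
    finally show "ennreal (ratio q t) * ennreal (R q t / ratio q t) = ennreal (R q t)" .
  qed
  finally show ?thesis .
qed

abbreviation w :: "'a \<Rightarrow> real" where "w q \<equiv> exp (- \<psi> x q)"

lemma R_zero: "R q 0 = w q"
  using vol_density_pos[OF immersion_x chart_at, of q] by (simp add: R_eq ratio_def F_zero)

text \<open>The trace of the derivative of a normal field is minus its product with the mean
  curvature vector; the equation of a \<xi>-submanifold balances this against the weight. A
  \<xi>-submanifold is thus critical for normal variations, pointwise in the density.\<close>

lemma first_variation_zero:
  assumes c: "c \<in> \<A>" "q \<in> chart_dom c"
  shows "(\<Sum>i\<in>UNIV. pd c i eta q \<bullet> cofr c q i) - (x q - \<xi> q) \<bullet> eta q = 0"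
proof -
  note fr = frame_x[OF c]
  have xt: "xtan q = proj (fr c q) (x q)" using xtan[OF c] tan_part_eq[OF c] by simp
  have "(\<Sum>i\<in>UNIV. pd c i eta q \<bullet> cofr c q i)
      = (\<Sum>i\<in>UNIV. \<Sum>j\<in>UNIV. (cofr c q i \<bullet> cofr c q j) * (pd c i eta q \<bullet> fr c q j))"
  proof (rule sum.cong[OF refl])
    fix i
    have "pd c i eta q \<bullet> cofr c q i = pd c i eta q \<bullet> (\<Sum>j\<in>UNIV. (cofr c q i \<bullet> cofr c q j) *\<^sub>R fr c q j)"
      using dual_eq[OF fr, of i] by (rule arg_cong)
    then show "pd c i eta q \<bullet> cofr c q i = (\<Sum>j\<in>UNIV. (cofr c q i \<bullet> cofr c q j) * (pd c i eta q \<bullet> fr c q j))"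
      by (simp only: inner_sum_right inner_scaleR_right)
  qed
  also have "\<dots> = - ((\<xi> q - (x q - xtan q)) \<bullet> eta q)"
    unfolding H_eq[OF c]
    by (simp add: inner_sum_left inner_diff_left normal_proj[OF eta_normal c] normal_derivative[OF eta_normal c] sum_negf)
  finally show ?thesis
    using normal_proj[OF eta_normal c, of "x q"] by (simp add: xt inner_diff_left)
qed

text \<open>With \<open>l\<close> the logarithmic derivative, R' = R l and hence R'' = R
  (\<open>l\<^sup>2\<close> + l'). At time 0 the first variation makes \<open>l\<close> vanish,
  leaving only l'.\<close>

lemma R2_zero_eq:
  fixes q defines "c \<equiv> chart_at \<A> q"
  shows "R2 q 0 = w q * (- (eta q \<bullet> eta q) - (x q - \<xi> q) \<bullet> Z q + (\<Sum>i\<in>UNIV. pd c i Z q \<bullet> cofr c q i)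
       - (\<Sum>i\<in>UNIV. \<Sum>j\<in>UNIV. (pd c i eta q \<bullet> cofr c q j) * (pd c j eta q \<bullet> cofr c q i))
       + (\<Sum>i\<in>UNIV. \<Sum>j\<in>UNIV. (cofr c q i \<bullet> cofr c q j) * (nconn c x i eta q \<bullet> nconn c x j eta q)))"
    (is "_ = w q * ?A2")
proof -
  have c: "c \<in> \<A>" "q \<in> chart_dom c" unfolding c_def by (rule chart_at)+
  define u where "u = coord c q"
  have u: "u \<in> coord_range c" unfolding u_def using c(2) by (rule imageI)
  have q: "param c u = q" unfolding u_def using c by simp
  have in_cyl: "(u, t) \<in> coord_range c \<times> J" if "t \<in> J" for t using u that by simp
  let ?G = "Fc c"
  let ?y = "\<lambda>s. ?G (u, s)" let ?y1 = "\<lambda>s. dT ?G (u, s)" let ?y2 = "\<lambda>s. dT (dT ?G) (u, s)"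
  let ?a = "\<lambda>i s. dX i ?G (u, s)" let ?a1 = "\<lambda>i s. dX i (dT ?G) (u, s)" let ?a2 = "\<lambda>i s. dX i (dT (dT ?G)) (u, s)"
  let ?v0 = "vol_density c x q"
  let ?E = "\<lambda>s. exp (\<kappa> q - (norm (?y s - \<xi> q))\<^sup>2 / 2) * vol (\<lambda>i. ?a i s)"
  let ?l = "\<lambda>s. (\<Sum>i\<in>UNIV. ?a1 i s \<bullet> dual (\<lambda>i. ?a i s) i) - (?y s - \<xi> q) \<bullet> ?y1 s"
  have y: "(?y has_vector_derivative ?y1 t) (at t)" "(?y1 has_vector_derivative ?y2 t) (at t)" if t: "t \<in> J" for t
    by (rule has_vector_derivative_time[OF F_smooth[OF c(1), of "Suc 0"] in_cyl[OF t]])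
       (rule has_vector_derivative_time[OF dTF_smooth[OF c(1), of "Suc 0"] in_cyl[OF t]])
  have a: "(?a i has_vector_derivative ?a1 i t) (at t)" if t: "t \<in> J" for i t
  proof -
    \<comment> \<open>Exchanging time and space derivatives makes the velocity of the frame the
      space derivative of the velocity field.\<close>
    have "dT (dX i ?G) (u, t) = ?a1 i t"
      by (rule frechet_derivative_commute[OF F_smooth[OF c(1)] open_cyl[OF c(1)] in_cyl[OF t]])
    then show ?thesis
      using has_vector_derivative_time[OF dXF_smooth[OF c(1), of "Suc 0" i] in_cyl[OF t]] by (simp only:)
  qed
  have a1: "(?a1 i has_vector_derivative ?a2 i t) (at t)" if t: "t \<in> J" for i t
  proof -
    have "dT (dX i (dT ?G)) (u, t) = ?a2 i t"
      by (rule frechet_derivative_commute[OF dTF_smooth[OF c(1)] open_cyl[OF c(1)] in_cyl[OF t]])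
    then show ?thesis
      using has_vector_derivative_time[OF dXTF_smooth[OF c(1), of "Suc 0" i] in_cyl[OF t]] by (simp only:)
  qed
  have fr: "frame (\<lambda>i. ?a i s)" if "s \<in> J" for s by (rule frame_F[OF c(1) u that])
  have aC: "Ck_on (Suc 0) J (?a i)" for i
    by (rule Ck_on_time_slice[OF open_J dXF_smooth[OF c(1)] u])
  note derivatives = weighted_density_derivatives[where y = "?y" and ?y1.0 = "?y1" and ?y2.0 = "?y2" and a = "?a" and ?a1.0 = "?a1" and ?a2.0 = "?a2"
      and z = "\<xi> q", OF open_J _ _ _ _ _ fr aC]
  note l_der = derivatives(2)[OF J0 y[OF J0] a[OF J0] a1[OF J0]]
  have R_E: "R q s = ?E s / ?v0" if s: "s \<in> J" for s
    unfolding R_eq ratio_eq[OF c s] using vol_F[OF c(1) u s] by (simp add: q psi)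
  have R_der: "(R q has_real_derivative R q t * ?l t) (at t)" if t: "t \<in> J" for t
  proof -
    have "((\<lambda>s. ?E s / ?v0) has_real_derivative ?E t * ?l t / ?v0) (at t)"
      by (rule DERIV_cdivide[OF derivatives(1)[OF t y[OF t] a[OF t] a1[OF t]]])
    then have "(R q has_real_derivative ?E t * ?l t / ?v0) (at t)"
      by (rule has_field_derivative_transform_within_open[OF _ open_J t]) (rule R_E[symmetric])
    then show ?thesis by (simp add: R_E[OF t])
  qed
  have R1_eq: "R1 q t = R q t * ?l t" if t: "t \<in> J" for t
    unfolding R1_def by (rule DERIV_imp_deriv[OF R_der[OF t]])
  have at0: "?y 0 = x q" "?y1 0 = eta q" "?y2 0 = Z q" "\<And>i. ?a i 0 = fr c q i" "\<And>i. ?a1 i 0 = pd c i eta q" "\<And>i. ?a2 i 0 = pd c i Z q"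
    using eta_eq[OF c(1) u] Z_eq[OF c(1) u] pd_x[OF c(1) u] pd_eta[OF c(1) u] pd_Z[OF c(1) u] by (simp_all add: q F0)
  have l0: "?l 0 = 0" unfolding at0 by (rule first_variation_zero[OF c])
  have l_der': "(?l has_real_derivative ?A2) (at 0)"
    using l_der unfolding at0 nconn_eq[OF c] .
  have "((\<lambda>t. R q t * ?l t) has_real_derivative R q 0 * ?l 0 * ?l 0 + ?A2 * R q 0) (at 0)"
    by (rule DERIV_mult[OF R_der[OF J0] l_der'])
  then have "(R1 q has_real_derivative R q 0 * ?l 0 * ?l 0 + ?A2 * R q 0) (at 0)"
    by (rule has_field_derivative_transform_within_open[OF _ open_J J0]) (rule R1_eq[symmetric])
  then have "R2 q 0 = R q 0 * ?l 0 * ?l 0 + ?A2 * R q 0"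
    unfolding R2_def by (rule DERIV_imp_deriv)
  then show ?thesis unfolding l0 R_zero by simp
qed

lemma w_Ck: "c \<in> \<A> \<Longrightarrow> Ck_on k (coord_range c) (w \<circ> param c)"
  and pd_w: "c \<in> \<A> \<Longrightarrow> q \<in> chart_dom c \<Longrightarrow> pd c i w q = - (w q * (x q \<bullet> fr c q i - x q \<bullet> pd c i \<xi> q))"
proof -
  let ?D = "\<lambda>r. x r - \<xi> r"
  have w_eq: "w = (\<lambda>r. exp (\<kappa> r - (1/2) *\<^sub>R (?D r \<bullet> ?D r)))"
    by (rule ext) (simp add: psi power2_norm_eq_inner)
  have D_Ck: "Ck_on k (coord_range c) (?D \<circ> param c)" if c: "c \<in> \<A>" for c k
    using Ck_on_diff[OF chart_open(2)[OF c] immersion_Ck[OF immersion_x c] normal_field_Ck[OF xi_normal c]]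
    by (simp only: o_def)
  have DD_Ck: "Ck_on k (coord_range c) ((\<lambda>r. ?D r \<bullet> ?D r) \<circ> param c)" if c: "c \<in> \<A>" for c k
    using Ck_on_inner[OF chart_open(2)[OF c] D_Ck[OF c] D_Ck[OF c]] by (simp only: o_def)
  have half: "Ck_on k (coord_range c) ((\<lambda>r. 1/2::real) \<circ> param c)" for c :: "('a, 'm) chart" and k
    unfolding o_def by (rule Ck_on_const)
  have hDD_Ck: "Ck_on k (coord_range c) ((\<lambda>r. (1/2) *\<^sub>R (?D r \<bullet> ?D r)) \<circ> param c)" if c: "c \<in> \<A>" for c k
    using Ck_on_scaleR[OF chart_open(2)[OF c] half DD_Ck[OF c]] by (simp only: o_def)
  have g_Ck: "Ck_on k (coord_range c) ((\<lambda>r. \<kappa> r - (1/2) *\<^sub>R (?D r \<bullet> ?D r)) \<circ> param c)" if c: "c \<in> \<A>" for c k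
    using Ck_on_diff[OF chart_open(2)[OF c] kappa_Ck[OF c] hDD_Ck[OF c]] by (simp only: o_def)
  show "Ck_on k (coord_range c) (w \<circ> param c)" if c: "c \<in> \<A>"
    unfolding w_eq using Ck_on_exp[OF chart_open(2)[OF c] g_Ck[OF c]] by (simp only: o_def)
  show "pd c i w q = - (w q * (x q \<bullet> fr c q i - x q \<bullet> pd c i \<xi> q))" if c: "c \<in> \<A>" "q \<in> chart_dom c"
  proof -
    have 1: "pd c i ?D q = fr c q i - pd c i \<xi> q"
      by (rule pd_diff[OF c immersion_Ck[OF immersion_x c(1)] normal_field_Ck[OF xi_normal c(1)]])
    have 2: "pd c i (\<lambda>r. ?D r \<bullet> ?D r) q = 2 * (?D q \<bullet> (fr c q i - pd c i \<xi> q))"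
      by (simp add: pd_inner[OF c D_Ck[OF c(1)] D_Ck[OF c(1)]] 1 inner_commute[of _ "x q - \<xi> q"])
    have 3: "pd c i (\<lambda>r. (1/2) *\<^sub>R (?D r \<bullet> ?D r)) q = ?D q \<bullet> (fr c q i - pd c i \<xi> q)"
      unfolding pd_scaleR[OF c half DD_Ck[OF c(1)]] 2 pd_const by simp
    \<comment> \<open>\<xi> is normal to the coordinate fields and has locally constant length, so
      both products with \<xi> vanish.\<close>
    have 4: "?D q \<bullet> (fr c q i - pd c i \<xi> q) = x q \<bullet> fr c q i - x q \<bullet> pd c i \<xi> q"
      using normal_fieldD[OF xi_normal c, of i] pd_xi_xi[OF c, of i]
      by (simp add: inner_diff_left inner_diff_right inner_commute[of "\<xi> q"])
    have "pd c i w q = exp (\<kappa> q - (1/2) *\<^sub>R (?D q \<bullet> ?D q)) * (0 - (x q \<bullet> fr c q i - x q \<bullet> pd c i \<xi> q))"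
      unfolding w_eq pd_exp[OF c g_Ck[OF c(1)]] pd_diff[OF c kappa_Ck[OF c(1)] hDD_Ck[OF c(1)]] 3 4 pd_kappa[OF c] ..
    then show ?thesis unfolding fun_cong[OF w_eq, of q] by (simp add: algebra_simps)
  qed
qed

abbreviation integrand :: "'a \<Rightarrow> real" where
  "integrand q \<equiv> second_variation_integrand \<A> \<xi> x F q * w q"

lemma integral_R2:
  "integrable (volume_measure \<A> x) (\<lambda>q. R2 q 0)"
  "(LINT q|volume_measure \<A> x. R2 q 0) = - (LINT q|volume_measure \<A> x. integrand q)"
proof -
  obtain K where K: "compact K" "\<And>q t. q \<notin> K \<Longrightarrow> t \<in> J \<Longrightarrow> F q t = x q"
    "\<And>q. q \<notin> K \<Longrightarrow> eta q = 0" "\<And>q. q \<notin> K \<Longrightarrow> Z q = 0"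
    by (rule support) blast
  have clK: "closed K" by (rule compact_imp_closed[OF K(1)])
  let ?u = "\<lambda>r. eta r \<bullet> eta r / 2"
  let ?X = "\<lambda>r. w r *\<^sub>R (Z r + grad ?u r)"
  have w1: "C1 w" unfolding C1_def using w_Ck by blast
  have g1: "C1 (grad ?u)" by (rule C1_grad[OF Ck_half_square[OF eta_normal]])
  have "C1 (\<lambda>r. Z r + grad ?u r)" unfolding C1_def
  proof
    fix d assume d: "d \<in> \<A>"
    show "Ck_on (Suc 0) (coord_range d) ((\<lambda>r. Z r + grad ?u r) \<circ> param d)"
      using Ck_on_add[OF chart_open(2)[OF d] C1D[OF C1_Z d] C1D[OF g1 d]] by (simp only: o_def)
  qed
  then have X1: "C1 ?X" by (rule C1_scaleR[OF w1])
  have X0: "?X q = 0" if q: "q \<notin> K" for q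
  proof -
    have "pd (chart_at \<A> q) i ?u q = 0" for i
      by (rule pd_zero_off_support[OF chart_at clK q]) (simp add: K(3))
    then have "grad ?u q = 0" unfolding grad_def gradient_eq[OF chart_at] by simp
    then show ?thesis using K(4)[OF q] by simp
  qed
  have ident: "dvg ?X q = R2 q 0 + integrand q" for q
    using integrand_identity[OF eta_normal C1_Z w1 pd_w[OF chart_at] eta_def[symmetric] Z_def[symmetric] refl refl, of q]
    unfolding R2_zero_eq by (simp add: algebra_simps)
  have R2_off: "R2 q 0 = 0" if q: "q \<notin> K" for q
    by (rule R_constant(3)[OF clK K(2) q J0])
  show int2: "integrable (volume_measure \<A> x) (\<lambda>q. R2 q 0)"
    by (rule integrable_volume_compact_support[OF immersion_x K(1) continuous_space_slice[OF continuous_R2 J0] R2_off])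
  have intX: "integrable (volume_measure \<A> x) (dvg ?X)" by (rule integrable_dvg[OF X1 K(1) X0])
  \<comment> \<open>Integrability of the integrand comes for free: it is a difference of two
    integrable functions.\<close>
  have "integrand q = dvg ?X q - R2 q 0" for q using ident[of q] by linarith
  then have "(LINT q|volume_measure \<A> x. integrand q) = (LINT q|volume_measure \<A> x. dvg ?X q - R2 q 0)"
    by (simp only:)
  also have "\<dots> = (LINT q|volume_measure \<A> x. dvg ?X q) - (LINT q|volume_measure \<A> x. R2 q 0)"
    by (rule Bochner_Integration.integral_diff[OF intX int2])
  also have "(LINT q|volume_measure \<A> x. dvg ?X q) = 0"
    by (rule divergence_theorem[OF X1 K(1) X0])
  finally show "(LINT q|volume_measure \<A> x. R2 q 0) = - (LINT q|volume_measure \<A> x. integrand q)" by simp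
qed

theorem second_variation:
  "has_second_variation \<A> \<psi> \<epsilon> F (- (LINT q|volume_measure \<A> x. integrand q))"
proof (cases "\<forall>t\<in>J. weighted_volume \<A> \<psi> (\<lambda>q. F q t) < \<infinity>")
  case False
  \<comment> \<open>In the infinite case the second time derivative of the density is taken at each
    point; it has compact support, so its integral exists.\<close>
  have "has_bochner_integral (volume_measure \<A> x) (\<lambda>q. R2 q 0) (- (LINT q|volume_measure \<A> x. integrand q))"
    using has_bochner_integral_integrable[OF integral_R2(1)] unfolding integral_R2(2) .
  then have "has_bochner_integral (volume_measure \<A> (\<lambda>q. F q 0))
      (\<lambda>q. deriv (deriv (relative_density \<A> \<psi> F q)) 0) (- (LINT q|volume_measure \<A> x. integrand q))"
    unfolding F_zero R2_def R1_def R_def .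
  then show ?thesis unfolding has_second_variation_def if_not_P[OF False] .
next
  case True
  \<comment> \<open>On the half interval the bounds for \<open>R1\<close> and \<open>R2\<close> are
    uniform, as differentiation under the integral sign requires.\<close>
  let ?M = "volume_measure \<A> x" let ?\<delta> = "\<epsilon> / 2"
  note [measurable_cong] = sets_volume_measure[OF immersion_x]
  obtain K where K: "compact K" "\<And>q t. q \<notin> K \<Longrightarrow> t \<in> J \<Longrightarrow> F q t = x q"
    by (rule support) blast
  have clK: "closed K" by (rule compact_imp_closed[OF K(1)])
  have K_sets: "K \<in> sets ?M" unfolding sets_volume_measure[OF immersion_x] by (rule borel_closed[OF clK])
  have K_fin: "emeasure ?M K < \<infinity>" by (rule emeasure_volume_compact[OF immersion_x K(1)])
  have small: "t \<in> J" if "\<bar>t\<bar> < ?\<delta>" for t using that eps by auto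
  have R_nonneg: "0 \<le> R q t" if "t \<in> J" for q t
    unfolding R_eq using ratio_pos[OF that, of q] by simp
  have R_meas: "(\<lambda>q. R q t) \<in> borel_measurable ?M" if t: "t \<in> J" for t
    using borel_measurable_continuous_onI[OF continuous_space_slice[OF continuous_R t]] by simp
  have int: "integrable ?M (\<lambda>q. R q t)" if t: "t \<in> J" for t
  proof (rule integrableI_nonneg[OF R_meas[OF t]])
    show "AE q in ?M. 0 \<le> R q t" by (rule AE_I2) (rule R_nonneg[OF t])
    have "weighted_volume \<A> \<psi> (\<lambda>q. F q t) < \<infinity>" using True t by blast
    then show "(\<integral>\<^sup>+q. ennreal (R q t) \<partial>?M) < \<infinity>" unfolding weighted_volume_eq[OF t] .
  qed
  have V_eq: "enn2real (weighted_volume \<A> \<psi> (\<lambda>q. F q t)) = (LINT q|?M. R q t)" if t: "t \<in> J" for t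
  proof -
    have "(\<integral>\<^sup>+q. ennreal (R q t) \<partial>?M) = ennreal (LINT q|?M. R q t)"
      by (rule nn_integral_eq_integral[OF int[OF t]]) (rule AE_I2, rule R_nonneg[OF t])
    moreover have "0 \<le> (LINT q|?M. R q t)" by (rule integral_nonneg_AE) (rule AE_I2, rule R_nonneg[OF t])
    ultimately show ?thesis unfolding weighted_volume_eq[OF t] by simp
  qed
  have R1_off: "R1 q t = 0" if q: "q \<notin> K" and t: "t \<in> J" for q t
    by (rule R_constant(2)[OF clK K(2) q t])
  have R2_off: "R2 q t = 0" if q: "q \<notin> K" and t: "t \<in> J" for q t
    by (rule R_constant(3)[OF clK K(2) q t])
  obtain B1 where B1: "\<And>q t. \<bar>t\<bar> < ?\<delta> \<Longrightarrow> \<bar>R1 q t\<bar> \<le> B1 * indicator K q"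
  proof (rule uniform_bound[OF continuous_R1 K(1) R1_off])
    fix B assume B: "\<And>q t. \<bar>t\<bar> < ?\<delta> \<Longrightarrow> \<bar>R1 q t\<bar> \<le> B * indicator K q"
    show ?thesis by (rule that[OF B])
  qed
  obtain B2 where B2: "\<And>q t. \<bar>t\<bar> < ?\<delta> \<Longrightarrow> \<bar>R2 q t\<bar> \<le> B2 * indicator K q"
  proof (rule uniform_bound[OF continuous_R2 K(1) R2_off])
    fix B assume B: "\<And>q t. \<bar>t\<bar> < ?\<delta> \<Longrightarrow> \<bar>R2 q t\<bar> \<le> B * indicator K q"
    show ?thesis by (rule that[OF B])
  qed
  have int1: "integrable ?M (\<lambda>q. R1 q t)" if t: "t \<in> J" for t
    by (rule integrable_volume_compact_support[OF immersion_x K(1) continuous_space_slice[OF continuous_R1 t] R1_off[OF _ t]])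
  define V' where "V' t = (LINT q|?M. R1 q t)" for t
  have "((\<lambda>s. enn2real (weighted_volume \<A> \<psi> (\<lambda>q. F q s))) has_real_derivative V' t) (at t)" if t: "\<bar>t\<bar> < ?\<delta>" for t
  proof -
    have "((\<lambda>s. LINT q|?M. R q s) has_real_derivative V' t) (at t)"
      unfolding V'_def
      by (rule has_real_derivative_integral[OF K_sets K_fin t DERIV_R[OF small] int[OF small]
            borel_measurable_integrable[OF int1[OF small[OF t]]] B1])
    then show ?thesis
      by (rule has_field_derivative_transform_within_open[OF _ open_J small[OF t]]) (rule V_eq[symmetric])
  qed
  moreover have "\<forall>\<^sub>F t in nhds 0. \<bar>t\<bar> < ?\<delta>"
  proof -
    have "\<forall>\<^sub>F t in nhds 0. t \<in> {-?\<delta><..<?\<delta>}"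
      by (rule eventually_nhds_in_open) (use eps in auto)
    then show ?thesis by (rule eventually_mono) auto
  qed
  ultimately have ev: "\<forall>\<^sub>F t in nhds 0.
      ((\<lambda>s. enn2real (weighted_volume \<A> \<psi> (\<lambda>q. F q s))) has_real_derivative V' t) (at t)"
    by (rule eventually_mono[rotated])
  have zero: "\<bar>0\<bar> < ?\<delta>" using eps by simp
  have "(V' has_real_derivative (LINT q|?M. R2 q 0)) (at 0)"
    unfolding V'_def[abs_def]
    by (rule has_real_derivative_integral[OF K_sets K_fin zero DERIV_R1[OF small] int1[OF small]
          borel_measurable_integrable[OF integral_R2(1)] B2])
  then have "(V' has_real_derivative - (LINT q|?M. integrand q)) (at 0)" unfolding integral_R2(2) .
  then show ?thesis unfolding has_second_variation_def using True ev by auto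
qed

end

theorem theorem4p3:
  fixes \<A> :: "('a::{t2_space, second_countable_topology}, 'm::finite) chart set"
    and x \<xi> :: "'a \<Rightarrow> real ^ 'n::finite"
    and F :: "'a \<Rightarrow> real \<Rightarrow> real ^ 'n"
    and \<epsilon> :: real
    and p :: nat
  assumes "smooth_atlas \<A>"
    and "CARD('n) = CARD('m) + p"
    and "xi_submanifold \<A> \<xi> x"
    and "compact_variation \<A> x \<epsilon> F"
    and "normal_variation \<A> x \<epsilon> F"
  shows "has_second_variation \<A> (f_weight \<xi>) \<epsilon> F
           (- (LINT q|volume_measure \<A> x.
                 second_variation_integrand \<A> \<xi> x F q * exp (- f_weight \<xi> x q)))
       \<and> has_second_variation \<A> (fbar_weight \<xi>) \<epsilon> F
           (- (LINT q|volume_measure \<A> x.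
                 second_variation_integrand \<A> \<xi> x F q * exp (- fbar_weight \<xi> x q)))"
proof -
  interpret xi_variation \<A> \<xi> x F \<epsilon>
    by unfold_locales (rule assms)+
  interpret V: weighted_xi_variation \<A> \<xi> x F \<epsilon> "\<lambda>q. 0" "f_weight \<xi>"
  proof
    show "Ck_on k (coord_range c) ((\<lambda>q. 0::real) \<circ> param c)" for c :: "('a, 'm) chart" and k
      unfolding o_def by (rule Ck_on_const)
  qed (simp_all add: f_weight_def pd_const)
  interpret Vbar: weighted_xi_variation \<A> \<xi> x F \<epsilon> "\<lambda>q. \<xi> q \<bullet> \<xi> q / 2" "fbar_weight \<xi>"
  proof
    \<comment> \<open>\<xi> is itself a normal field, so the derivative of half its squared length
      is given by \<open>pd_half_square\<close>.\<close>
    show "pd c i (\<lambda>q. \<xi> q \<bullet> \<xi> q / 2) q = 0" if "c \<in> \<A>" "q \<in> chart_dom c" for c q i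
      unfolding pd_half_square[OF xi_normal that] by (rule pd_xi_xi[OF that])
  qed (simp_all only: fbar_weight_def f_weight_def power2_norm_eq_inner Ck_half_square[OF xi_normal])
  show ?thesis using V.second_variation Vbar.second_variation by (rule conjI)
qed

end
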